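(* Every $n$-vertex triangulation on a non-orientable surface has a non-contractible cycle of length at most $2\sqrt{n}$.
   Context: A triangulation on a surface is a finite simple graph embedded on the (compact, boundaryless) surface such that every face is bounded by a triangle. A cycle of the embedded graph is non-contractible if, viewed as a closed curve on the surface, it is not contractible to a point. *)

theory Defs
  imports "HOL-Analysis.Analysis"
begin

section \<open>Surfaces\<close>

text \<open>Second countability need not be required: it follows from compactness and the local condition.\<close>

definition surface :: "'a topology \<Rightarrow> bool" where
  "surface X \<longleftrightarrow>
     topspace X \<noteq> {} \<and> compact_space X \<and> connected_space X \<and> Hausdorff_space X \<and>
     (\<forall>x \<in> topspace X. \<exists>U. openin X U \<and> x \<in> U \<and>
        subtopology X U homeomorphic_space (euclidean :: complex topology))"

text \<open>The square \<open>[0,1] \<times> [-1,1]\<close> with its left and right sides identified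
  by \<open>(0, t) \<sim> (1, -t)\<close>.\<close>

definition moebius_identified :: "real \<times> real \<Rightarrow> real \<times> real \<Rightarrow> bool" where
  "moebius_identified p q \<longleftrightarrow>
     p = q \<or>
     (fst p = 0 \<and> fst q = 1 \<and> snd q = - snd p) \<or>
     (fst p = 1 \<and> fst q = 0 \<and> snd q = - snd p)"

definition moebius_band :: "'a topology \<Rightarrow> bool" where
  "moebius_band M \<longleftrightarrow>
     (\<exists>h. quotient_map (top_of_set ({0..1} \<times> {-1..1})) M h \<and>
          (\<forall>p \<in> {0..1} \<times> {-1..1}. \<forall>q \<in> {0..1} \<times> {-1..1}.
             h p = h q \<longleftrightarrow> moebius_identified p q))"

definition non_orientable :: "'a topology \<Rightarrow> bool" where
  "non_orientable X \<longleftrightarrow> (\<exists>S \<subseteq> topspace X. moebius_band (subtopology X S))"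

section \<open>Graphs and cycles\<close>

definition finite_simple_graph :: "'v set \<Rightarrow> 'v set set \<Rightarrow> bool" where
  "finite_simple_graph V E \<longleftrightarrow> finite V \<and> (\<forall>e \<in> E. e \<subseteq> V \<and> card e = 2)"

definition cycle_edges :: "'v list \<Rightarrow> 'v set set" where
  "cycle_edges vs = {{vs ! i, vs ! (Suc i mod length vs)} | i. i < length vs}"

text \<open>A cycle is listed by its vertices, the last one being adjacent to the first;
  its length as a cycle is the length of the list.\<close>

definition graph_cycle :: "'v set \<Rightarrow> 'v set set \<Rightarrow> 'v list \<Rightarrow> bool" where
  "graph_cycle V E vs \<longleftrightarrow>
     3 \<le> length vs \<and> distinct vs \<and> set vs \<subseteq> V \<and> cycle_edges vs \<subseteq> E"

section \<open>Embedded graphs and triangulations\<close>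

text \<open>The map \<open>\<phi>\<close> places the vertices, and \<open>\<psi> e\<close> parametrises the arc that draws the
  edge \<open>e\<close>.\<close>

definition embedded_graph ::
    "'a topology \<Rightarrow> 'v set \<Rightarrow> 'v set set \<Rightarrow> ('v \<Rightarrow> 'a) \<Rightarrow> ('v set \<Rightarrow> real \<Rightarrow> 'a) \<Rightarrow> bool" where
  "embedded_graph X V E \<phi> \<psi> \<longleftrightarrow>
     finite_simple_graph V E \<and>
     inj_on \<phi> V \<and> \<phi> ` V \<subseteq> topspace X \<and>
     (\<forall>e \<in> E. embedding_map (top_of_set {0..1}) X (\<psi> e) \<and>
        {\<psi> e 0, \<psi> e 1} = \<phi> ` e \<and>
        \<psi> e ` {0<..<1} \<inter> \<phi> ` V = {}) \<and>
     (\<forall>e \<in> E. \<forall>e' \<in> E. e \<noteq> e' \<longrightarrow> \<psi> e ` {0<..<1} \<inter> \<psi> e' ` {0<..<1} = {})"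

definition drawn_edges :: "('v set \<Rightarrow> real \<Rightarrow> 'a) \<Rightarrow> 'v set set \<Rightarrow> 'a set" where
  "drawn_edges \<psi> F = (\<Union>e \<in> F. \<psi> e ` {0..1})"

definition faces ::
    "'a topology \<Rightarrow> 'v set \<Rightarrow> 'v set set \<Rightarrow> ('v \<Rightarrow> 'a) \<Rightarrow> ('v set \<Rightarrow> real \<Rightarrow> 'a) \<Rightarrow> 'a set set" where
  "faces X V E \<phi> \<psi> =
     connected_components_of (subtopology X (topspace X - (\<phi> ` V \<union> drawn_edges \<psi> E)))"

text \<open>That a face is bounded by a triangle means that it is the interior of a closed disc whose
  boundary circle is the triangle. Merely asking that the frontier of the face be a triangle
  would admit faces that are not discs, such as an open Moebius band.\<close>

definition bounded_by_triangle ::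
    "'a topology \<Rightarrow> 'v set \<Rightarrow> 'v set set \<Rightarrow> ('v set \<Rightarrow> real \<Rightarrow> 'a) \<Rightarrow> 'a set \<Rightarrow> bool" where
  "bounded_by_triangle X V E \<psi> F \<longleftrightarrow>
     (\<exists>vs h. graph_cycle V E vs \<and> length vs = 3 \<and>
        embedding_map (top_of_set (cball (0::complex) 1)) X h \<and>
        h ` ball 0 1 = F \<and>
        h ` sphere 0 1 = drawn_edges \<psi> (cycle_edges vs))"

definition surface_triangulation ::
    "'a topology \<Rightarrow> 'v set \<Rightarrow> 'v set set \<Rightarrow> ('v \<Rightarrow> 'a) \<Rightarrow> ('v set \<Rightarrow> real \<Rightarrow> 'a) \<Rightarrow> bool" where
  "surface_triangulation X V E \<phi> \<psi> \<longleftrightarrow>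
     embedded_graph X V E \<phi> \<psi> \<and>
     (\<forall>F \<in> faces X V E \<phi> \<psi>. bounded_by_triangle X V E \<psi> F)"

section \<open>Non-contractible cycles\<close>

definition contractible_curve :: "'a topology \<Rightarrow> (complex \<Rightarrow> 'a) \<Rightarrow> bool" where
  "contractible_curve X f \<longleftrightarrow>
     (\<exists>a. homotopic_with (\<lambda>_. True) (top_of_set (sphere 0 1)) X f (\<lambda>_. a))"

text \<open>The curve traced by a cycle is determined up to a homeomorphism of the circle, so
  contractibility does not depend on the parametrisation \<open>f\<close>.\<close>

definition non_contractible_cycle ::
    "'a topology \<Rightarrow> ('v set \<Rightarrow> real \<Rightarrow> 'a) \<Rightarrow> 'v list \<Rightarrow> bool" where
  "non_contractible_cycle X \<psi> vs \<longleftrightarrow>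
     (\<exists>f. embedding_map (top_of_set (sphere (0::complex) 1)) X f \<and>
          f ` sphere 0 1 = drawn_edges \<psi> (cycle_edges vs) \<and>
          \<not> contractible_curve X f)"

end

theory Submission imports Defs begin

text \<open>Fix a double cover of the surface, that is, a cohomology class with coefficients in the field
  with two elements, that is non-trivial. The Moebius band yields one: its sheets are exchanged
  whenever the core circle of the band is crossed, and the complement of the core in the band is
  connected. Since faces are discs, a non-trivial double cover is non-trivial on some cycle of the
  graph, and conversely every simplicial cocycle is realised by a double cover, so that a cycle on
  which some cocycle is odd is not contractible.

  Let \<open>k\<close> be the minimal length of a closed walk on which some cocycle is odd. A closed walk that
  attains it is a cycle \<open>C\<close>. Consider the levels of the distance from a vertex of \<open>C\<close> if \<open>k = 2 m\<close> and
  from an edge of \<open>C\<close> if \<open>k = 2 m + 1\<close>. For \<open>i < m\<close> the ball of radius \<open>i\<close> contains no odd closed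
  walk, and therefore the two points of \<open>C\<close> in level \<open>i\<close> lie in the same component of the level:
  otherwise a cycle in the boundary of the ball, which bounds, would meet \<open>C\<close> an odd number of
  times. A path in level \<open>i\<close> that joins these two points has length at least \<open>2 i\<close>
  (respectively \<open>2 i + 1\<close>), since otherwise it would make a shortcut of \<open>C\<close>. Adding up the
  sizes of the levels gives at least \<open>k\<^sup>2 / 4\<close> vertices.\<close>

section \<open>Odd closed walks in a combinatorial surface\<close>

text \<open>The minimum is taken over all cocycles at once because the argument needs balls in which
  every cocycle is even on closed walks, not just the cocycle of the Moebius band. Only then does
  each functional that vanishes on all face boundaries also vanish on the boundary cycle of a ball,
  and linear algebra over the field with two elements turns this into a set of faces that the cycle
  bounds. The price is that the shortest walk may belong to a class unrelated to the band, which is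
  why an arbitrary cocycle has to be realised by a double cover. Intersection numbers are replaced
  by following the membership of faces in this set along \<open>C\<close>: it changes across the
  edges of the bounded cycle only. For \<open>k = 2 m\<close> the levels contribute
  \<open>1 + 3 + ... + (2 m - 1) = m^2\<close> vertices, which is where the constant comes
  from.\<close>

lemma odd_card_Int_sym_diff:
  assumes "finite u"
  shows "odd (card (u \<inter> (a - c \<union> (c - a)))) \<longleftrightarrow> odd (card (u \<inter> a)) \<noteq> odd (card (u \<inter> c))"
proof -
  have 1: "card (u \<inter> (a - c \<union> (c - a))) = card (u \<inter> (a - c)) + card (u \<inter> (c - a))"
    using assms by (subst card_Un_disjoint[symmetric]) (auto intro: arg_cong[where f=card])
  have 2: "card (u \<inter> a) = card (u \<inter> (a - c)) + card (u \<inter> (a \<inter> c))"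
    using assms by (subst card_Un_disjoint[symmetric]) (auto intro: arg_cong[where f=card])
  have 3: "card (u \<inter> c) = card (u \<inter> (c - a)) + card (u \<inter> (a \<inter> c))"
    using assms by (subst card_Un_disjoint[symmetric]) (auto intro: arg_cong[where f=card])
  show ?thesis unfolding 1 2 3 by auto
qed

lemma odd_card_sym_diff_Int:
  assumes "finite u"
  shows "odd (card ((a - c \<union> (c - a)) \<inter> u)) \<longleftrightarrow> odd (card (a \<inter> u)) \<noteq> odd (card (c \<inter> u))"
  using odd_card_Int_sym_diff[OF assms, of a c] by (simp add: Int_commute)

text \<open>Sets are vectors over the field with two elements here, and the set \<open>u\<close> stands for the
  functional that counts intersections modulo 2.\<close>

lemma span_or_functional_mod_2:
  assumes "finite Fs" "finite E" "\<And>F. F \<in> Fs \<Longrightarrow> b F \<subseteq> E" "a \<subseteq> E"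
  shows "(\<exists>D\<subseteq>Fs. \<forall>e\<in>E. e \<in> a \<longleftrightarrow> odd (card {F\<in>D. e \<in> b F})) \<or>
         (\<exists>u\<subseteq>E. (\<forall>F\<in>Fs. even (card (u \<inter> b F))) \<and> odd (card (u \<inter> a)))"
  using assms(1,3,4)
proof (induction Fs arbitrary: a rule: finite_induct)
  case empty
  show ?case
  proof (cases "a = {}")
    case False
    then obtain e where "e \<in> a" by auto
    then show ?thesis using empty by (intro disjI2 exI[of _ "{e}"]) auto
  qed auto
next
  case (insert G Fs)
  have bG: "b G \<subseteq> E" using insert by auto
  \<comment> \<open>\<open>a\<close> is a combination of the vectors of \<open>insert G Fs\<close>
    exactly if \<open>a\<close> or \<open>?a'\<close>, its sum with the new vector, is a combination
    of those of \<open>Fs\<close>.\<close>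
  let ?a' = "a - b G \<union> (b G - a)"
  have fin: "finite u" if "u \<subseteq> E" for u using that assms(2) finite_subset by auto
  note IH1 = insert.IH[of a] and IH2 = insert.IH[of ?a']
  consider (D) D where "D \<subseteq> Fs" "\<forall>e\<in>E. e \<in> a \<longleftrightarrow> odd (card {F\<in>D. e \<in> b F})"
    | (D') D where "D \<subseteq> Fs" "\<forall>e\<in>E. e \<in> ?a' \<longleftrightarrow> odd (card {F\<in>D. e \<in> b F})"
    | (u) u u' where "u \<subseteq> E" "u' \<subseteq> E" "\<forall>F\<in>Fs. even (card (u \<inter> b F))" "odd (card (u \<inter> a))"
        "\<forall>F\<in>Fs. even (card (u' \<inter> b F))" "odd (card (u' \<inter> ?a'))"
    using IH1 IH2 insert.prems bG by (smt (verit) Diff_subset insertCI subset_trans sup.bounded_iff)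
  then show ?case
  proof cases
    case D
    then show ?thesis by blast
  next
    case D'
    have G: "G \<notin> D" and fD: "finite D" using D' insert by (auto intro: finite_subset)
    have "e \<in> a \<longleftrightarrow> odd (card {F \<in> insert G D. e \<in> b F})" if "e \<in> E" for e
    proof -
      have "{F \<in> insert G D. e \<in> b F} =
        (if e \<in> b G then insert G {F \<in> D. e \<in> b F} else {F \<in> D. e \<in> b F})" by auto
      then have "odd (card {F \<in> insert G D. e \<in> b F}) \<longleftrightarrow> (e \<in> b G) \<noteq> odd (card {F \<in> D. e \<in> b F})"
        using G fD by auto
      then show ?thesis using D' that by auto
    qed
    then show ?thesis using D' by (intro disjI1 exI[of _ "insert G D"]) auto
  next
    case u
    have o: "odd (card (u' \<inter> a)) \<noteq> odd (card (u' \<inter> b G))"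
      using u(6) odd_card_Int_sym_diff[OF fin[OF u(2)]] by blast
    show ?thesis
    proof (cases "even (card (u \<inter> b G)) \<or> even (card (u' \<inter> b G))")
      case True
      then show ?thesis using u o by blast
    next
      case False
      \<comment> \<open>Both functionals are odd on \<open>b G\<close>, so their sum is even there.
        By \<open>o\<close> the second one is even on \<open>a\<close>, so the sum is still odd on
        \<open>a\<close>.\<close>
      let ?w = "u - u' \<union> (u' - u)"
      have "\<forall>F\<in>insert G Fs. even (card (?w \<inter> b F))"
      proof
        fix F assume F: "F \<in> insert G Fs"
        then have "finite (b F)" using insert.prems fin by blast
        then show "even (card (?w \<inter> b F))" using odd_card_sym_diff_Int[of "b F" u u'] u False F by auto
      qed
      moreover have "odd (card (?w \<inter> a))"
        using odd_card_sym_diff_Int[of a u u'] fin[OF insert.prems(2)] u o False by auto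
      ultimately show ?thesis using u by (intro disjI2 exI[of _ ?w]) auto
    qed
  qed
qed

section \<open>Closed combinatorial surfaces, walks and distance levels\<close>

text \<open>Faces are abstract objects with a vertex set attached, since two faces may have the same
  three vertices. By \<open>two_faces\<close> the link of a vertex is a union of cycles;
  \<open>link_connected\<close> says that it is connected, in a form that avoids paths: a property
  of faces that is preserved across the edges at \<open>x\<close> is constant around
  \<open>x\<close>.\<close>

locale combinatorial_surface =
  fixes V :: "'v set" and E :: "'v set set" and Fs :: "'f set" and vt :: "'f \<Rightarrow> 'v set"
  assumes finite_V: "finite V"
    and edge: "\<And>e. e \<in> E \<Longrightarrow> e \<subseteq> V \<and> card e = 2"
    and finite_Fs: "finite Fs"
    and card_face: "\<And>F. F \<in> Fs \<Longrightarrow> card (vt F) = 3"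
    and face_edge: "\<And>F x y. F \<in> Fs \<Longrightarrow> x \<in> vt F \<Longrightarrow> y \<in> vt F \<Longrightarrow> x \<noteq> y \<Longrightarrow> {x, y} \<in> E"
    and two_faces: "\<And>e. e \<in> E \<Longrightarrow> card {F \<in> Fs. e \<subseteq> vt F} = 2"
    and link_connected: "\<And>x P F G. x \<in> V \<Longrightarrow>
      (\<And>F G e. F \<in> Fs \<Longrightarrow> G \<in> Fs \<Longrightarrow> e \<in> E \<Longrightarrow> x \<in> e \<Longrightarrow> e \<subseteq> vt F \<Longrightarrow> e \<subseteq> vt G \<Longrightarrow> P F = P G) \<Longrightarrow>
      F \<in> Fs \<Longrightarrow> G \<in> Fs \<Longrightarrow> x \<in> vt F \<Longrightarrow> x \<in> vt G \<Longrightarrow> (P F :: bool) = P G"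
begin

definition cocycle :: "'v set set \<Rightarrow> bool" where
  "cocycle u \<longleftrightarrow> (\<forall>F\<in>Fs. \<forall>x y z. vt F = {x, y, z} \<longrightarrow> x \<noteq> y \<longrightarrow> x \<noteq> z \<longrightarrow> y \<noteq> z \<longrightarrow>
     ({x, y} \<in> u \<longleftrightarrow> ({x, z} \<in> u) \<noteq> ({y, z} \<in> u)))"

text \<open>\<open>walk u x n b y\<close>: some walk of length \<open>n\<close> from \<open>x\<close> to \<open>y\<close> has value \<open>b\<close> under the
  cochain \<open>u\<close>, where \<open>True\<close> stands for the residue 1.\<close>

inductive walk :: "'v set set \<Rightarrow> 'v \<Rightarrow> nat \<Rightarrow> bool \<Rightarrow> 'v \<Rightarrow> bool" for u x where
  walk_0: "walk u x 0 False x"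
| walk_Suc: "walk u x n b y \<Longrightarrow> {y, z} \<in> E \<Longrightarrow> c = (b \<noteq> ({y, z} \<in> u)) \<Longrightarrow> walk u x (Suc n) c z"

lemma edge_neq: "{x, y} \<in> E \<Longrightarrow> x \<noteq> y"
  using edge by force

lemma edge_in_V: "{x, y} \<in> E \<Longrightarrow> x \<in> V \<and> y \<in> V"
  using edge by force

lemma walk_edge: "{x, y} \<in> E \<Longrightarrow> walk u x (Suc 0) ({x, y} \<in> u) y"
  by (rule walk_Suc[OF walk_0]) auto

lemma walk_append:
  assumes "walk u y m c z" "walk u x n b y"
  shows "walk u x (n + m) (b \<noteq> c) z"
  using assms(1)
proof (induction rule: walk.induct)
  case walk_0
  then show ?case using assms by simp
next
  case (walk_Suc m c y' z' c')
  show ?case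
    by (simp, rule walk.walk_Suc[OF walk_Suc.IH walk_Suc.hyps(2)]) (use walk_Suc.hyps in auto)
qed

lemma walk_sym: "walk u x n b y \<Longrightarrow> walk u y n b x"
proof (induction rule: walk.induct)
  case (walk_Suc n b y z c)
  have "walk u z (Suc 0) ({y, z} \<in> u) y" 
    using walk_edge[of z y u] walk_Suc.hyps by (simp add: insert_commute)
  from walk_append[OF walk_Suc.IH this] show ?case using walk_Suc.hyps(3)
    by (cases b) simp_all
qed (rule walk_0)

text \<open>\<open>s\<close> records the values of the initial segments, so that the value of any
  segment is the difference of two entries of \<open>s\<close>; \<open>path_walk\<close> reads it
  off.\<close>

lemma walk_ex_path:
  assumes "walk u x n b y"
  shows "\<exists>p s. p 0 = x \<and> p n = y \<and> \<not> s 0 \<and> s n = b \<and>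
    (\<forall>j<n. {p j, p (Suc j)} \<in> E \<and> s (Suc j) = (s j \<noteq> ({p j, p (Suc j)} \<in> u)))"
  using assms
proof (induction rule: walk.induct)
  case walk_0
  show ?case by (rule exI[of _ "\<lambda>_. x"], rule exI[of _ "\<lambda>_. False"]) auto
next
  case (walk_Suc n b y z c)
  then obtain p s where ps: "p 0 = x" "p n = y" "\<not> s 0" "s n = b"
    "\<And>j. j<n \<Longrightarrow> {p j, p (Suc j)} \<in> E \<and> s (Suc j) = (s j \<noteq> ({p j, p (Suc j)} \<in> u))" by blast
  show ?case
    by (rule exI[of _ "p(Suc n := z)"], rule exI[of _ "s(Suc n := c)"])
      (use ps walk_Suc.hyps in \<open>auto simp: less_Suc_eq\<close>)
qed

lemma path_walk:
  assumes "\<And>j. j < n \<Longrightarrow> {p j, p (Suc j)} \<in> E \<and> s (Suc j) = (s j \<noteq> ({p j, p (Suc j)} \<in> u))"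
    and "a \<le> c" "c \<le> n"
  shows "walk u (p a) (c - a) (s a \<noteq> s c) (p c)"
  using assms(2,3)
proof (induction c rule: dec_induct)
  case base
  then show ?case by (simp add: walk_0)
next
  case (step c)
  have "walk u (p a) (Suc (c - a)) (s a \<noteq> s (Suc c)) (p (Suc c))"
    by (rule walk_Suc[OF step.IH]) (use assms(1)[of c] step in auto)
  then show ?case using step by (simp add: Suc_diff_le)
qed

fun gball :: "'v set \<Rightarrow> nat \<Rightarrow> 'v set" where
  "gball R 0 = R"
| "gball R (Suc i) = gball R i \<union> {y. \<exists>x\<in>gball R i. {x, y} \<in> E}"

fun level :: "'v set \<Rightarrow> nat \<Rightarrow> 'v set" where
  "level R 0 = R"
| "level R (Suc i) = gball R (Suc i) - gball R i"

lemma gball_mono: "i \<le> j \<Longrightarrow> gball R i \<subseteq> gball R j"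
  by (induction j rule: dec_induct) auto

lemma level_subset_gball: "level R i \<subseteq> gball R i"
  by (cases i) auto

lemma level_disjoint_gball: "i < j \<Longrightarrow> level R j \<inter> gball R i = {}"
  using gball_mono[of i "j - 1" R] by (cases j) auto

lemma level_disjoint: "i \<noteq> j \<Longrightarrow> level R i \<inter> level R j = {}"
  using level_disjoint_gball[of i j R] level_disjoint_gball[of j i R] level_subset_gball[of R]
  by (cases "i < j") (fastforce simp: not_less)+

lemma gball_subset_V: "R \<subseteq> V \<Longrightarrow> gball R i \<subseteq> V"
  by (induction i) (auto dest: edge_in_V)

lemma gball_edge: "x \<in> gball R i \<Longrightarrow> {x, y} \<in> E \<Longrightarrow> y \<in> gball R (Suc i)"
  by auto

lemma gball_walk: "x \<in> gball R i \<Longrightarrow> \<exists>\<rho>\<in>R. \<exists>d\<le>i. \<exists>b. walk u \<rho> d b x"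
proof (induction i arbitrary: x)
  case 0
  then show ?case using walk_0 by auto
next
  case (Suc i)
  show ?case
  proof (cases "x \<in> gball R i")
    case True
    then show ?thesis using Suc.IH[OF True] le_Suc_eq by blast
  next
    case False
    then obtain y where "y \<in> gball R i" "{y, x} \<in> E" using Suc.prems by auto
    then show ?thesis using Suc.IH[of y] walk_Suc by (meson not_less_eq_eq)
  qed
qed

text \<open>A neighbour of \<open>x\<close> nearer to \<open>R\<close> than level \<open>i\<close>
  would put \<open>x\<close> into the ball of radius \<open>i\<close>.\<close>

lemma level_edge:
  assumes "x \<in> level R (Suc i)" "{x, y} \<in> E"
  shows "y \<notin> gball R i \<or> y \<in> level R i"
proof (cases i)
  case (Suc j)
  have "x \<in> gball R i" if "y \<in> gball R j" using that assms(2) Suc by (auto simp: insert_commute)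
  then show ?thesis using assms(1) Suc by auto
qed auto

lemma face_edges_eq:
  assumes "F \<in> Fs" "vt F = {x, y, z}" "x \<noteq> y" "x \<noteq> z" "y \<noteq> z"
  shows "{e \<in> E. e \<subseteq> vt F} = {{x, y}, {x, z}, {y, z}}"
proof -
  have "e \<in> {{x, y}, {x, z}, {y, z}}" if "e \<in> E" "e \<subseteq> vt F" for e
  proof -
    have "card e = 2" using edge that(1) by simp
    then obtain a b where "e = {a, b}" "a \<noteq> b" unfolding card_2_iff by auto
    then show ?thesis using that assms by auto
  qed
  then show ?thesis using assms face_edge[OF assms(1)] by auto
qed

lemma face_3:
  assumes "F \<in> Fs"
  obtains x y z where "vt F = {x, y, z}" "x \<noteq> y" "x \<noteq> z" "y \<noteq> z"
  using card_face[OF assms] by (metis card_3_iff)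

lemma edge_face:
  assumes "e \<in> E" obtains F where "F \<in> Fs" "e \<subseteq> vt F"
  using two_faces[OF assms] by (metis (mono_tags, lifting) card.empty empty_Collect_eq zero_neq_numeral)

lemma cocycleI_even:
  assumes "\<And>F. F \<in> Fs \<Longrightarrow> even (card (u \<inter> {e \<in> E. e \<subseteq> vt F}))"
  shows "cocycle u"
  unfolding cocycle_def
proof (intro ballI allI impI)
  fix F x y z assume *: "F \<in> Fs" "vt F = {x, y, z}" "x \<noteq> y" "x \<noteq> z" "y \<noteq> z"
  then have ne: "{x,y} \<noteq> {x,z}" "{x,y} \<noteq> {y,z}" "{x,z} \<noteq> {y,z}" by (auto simp: doubleton_eq_iff)
  have "even (card (u \<inter> {{x, y}, {x, z}, {y, z}}))"
    using assms[OF *(1)] face_edges_eq[OF *] by simp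
  then show "({x, y} \<in> u) = (({x, z} \<in> u) \<noteq> ({y, z} \<in> u))"
    using ne by (auto simp: Int_insert_right split: if_splits)
qed

lemma finite_E: "finite E"
  using edge finite_V by (meson Pow_iff finite_Pow_iff finite_subset subsetI)

end

section \<open>Shortest odd closed walks and the levels around them\<close>

text \<open>A connection of minimal length repeats no point, because the part between two
  occurrences could be cut out.\<close>

lemma rtrancl_relpow_lt_card:
  assumes "finite A" "R \<subseteq> A \<times> A" "x \<in> A" "(x, y) \<in> R\<^sup>*"
  shows "\<exists>l < card A. (x, y) \<in> R ^^ l"
proof -
  define l where "l = (LEAST l. (x, y) \<in> R ^^ l)"
  have l: "(x, y) \<in> R ^^ l"
    using rtrancl_imp_relpow[OF assms(4)] unfolding l_def by (auto intro: LeastI)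
  have least: "(x, y) \<notin> R ^^ j" if "j < l" for j
    using not_less_Least that unfolding l_def by blast
  obtain f where f: "f 0 = x" "f l = y" "\<And>i. i < l \<Longrightarrow> (f i, f (Suc i)) \<in> R"
    using l unfolding relpow_fun_conv by blast
  have pow: "(f a, f b) \<in> R ^^ (b - a)" if "a \<le> b" "b \<le> l" for a b
    unfolding relpow_fun_conv by (rule exI[of _ "\<lambda>i. f (a + i)"]) (use f that in auto)
  have "f i \<noteq> f j" if "i < j" "j \<le> l" for i j
  proof
    assume "f i = f j"
    then have "(x, y) \<in> R ^^ i O R ^^ (l - j)"
      using pow[of 0 i] pow[of j l] f that by auto
    then have "(x, y) \<in> R ^^ (i + (l - j))" by (simp add: relpow_add)
    moreover have "i + (l - j) < l" using that by simp
    ultimately show False using least by blast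
  qed
  then have "inj_on f {..l}" by (intro inj_onI) (metis atMost_iff linorder_neqE_nat)
  moreover have "f ` {..l} \<subseteq> A"
  proof safe
    fix i assume "i \<le> l"
    then show "f i \<in> A" using f(1) f(3)[of "i - 1"] assms(2,3) by (cases i) auto
  qed
  ultimately have "l + 1 \<le> card A" using card_inj_on_le[of f "{..l}" A] assms(1) by simp
  then show ?thesis using l by (intro exI[of _ l]) auto
qed

text \<open>The minimum is attained by the cocycle \<open>u\<close>, but \<open>shorter\<close>
  speaks of every cocycle \<open>w\<close>; \<open>potential\<close> depends on this
  generality.\<close>

locale shortest_odd_walk = combinatorial_surface V E Fs vt
  for V :: "'v set" and E :: "'v set set" and Fs :: "'f set" and vt :: "'f \<Rightarrow> 'v set" +
  fixes u :: "'v set set" and k :: nat and p :: "nat \<Rightarrow> 'v" and s :: "nat \<Rightarrow> bool"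
  assumes cocycle_u: "cocycle u"
    and step: "\<And>j. j < k \<Longrightarrow> {p j, p (Suc j)} \<in> E \<and> s (Suc j) = (s j \<noteq> ({p j, p (Suc j)} \<in> u))"
    and closed: "p k = p 0" and s0: "\<not> s 0" and sk: "s k"
    and shorter: "\<And>w n x. cocycle w \<Longrightarrow> n < k \<Longrightarrow> \<not> walk w x n True x"
begin

lemma segment: "a \<le> c \<Longrightarrow> c \<le> k \<Longrightarrow> walk u (p a) (c - a) (s a \<noteq> s c) (p c)"
  using path_walk[of k p s u a c] step by blast

lemma even_if_shorter: "walk w x n b x \<Longrightarrow> cocycle w \<Longrightarrow> n < k \<Longrightarrow> \<not> b"
  using shorter by (cases b) auto

text \<open>The connecting walk closes up with either of the two arcs between \<open>p a\<close> and
  \<open>p c\<close>. The values of these two closed walks add up to the odd value of the whole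
  walk, so they cannot both be shorter than \<open>k\<close>.\<close>

lemma geodesic:
  assumes w: "walk u (p a) d b (p c)" and "a \<le> c" "c \<le> k"
  shows "d \<ge> c - a \<or> d \<ge> k - (c - a)"
proof (rule ccontr)
  assume "\<not> ?thesis"
  then have d: "d < c - a" "d < k - (c - a)" by auto
  have "walk u (p a) (d + (c - a)) (b \<noteq> (s a \<noteq> s c)) (p a)"
    using walk_append[OF walk_sym[OF segment] w] assms by simp
  then have 1: "b = (s a \<noteq> s c)"
    using even_if_shorter[OF _ cocycle_u] d assms by fastforce
  have "walk u (p c) ((k - c) + (a - 0)) ((s c \<noteq> s k) \<noteq> (s 0 \<noteq> s a)) (p a)"
    using walk_append[OF segment[of 0 a, folded closed] segment[of c k]] assms by simp
  from walk_append[OF w this]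
  have 2: "walk u (p c) (k - c + (a - 0) + d) (((s c \<noteq> s k) \<noteq> (s 0 \<noteq> s a)) \<noteq> b) (p c)" .
  have "k - c + (a - 0) + d < k" using d assms by auto
  then have "\<not> (((s c \<noteq> s k) \<noteq> (s 0 \<noteq> s a)) \<noteq> b)"
    using even_if_shorter[OF 2 cocycle_u] by blast
  then show False using 1 s0 sk by auto
qed

lemma p_neq: "a < c \<Longrightarrow> c < k \<Longrightarrow> p a \<noteq> p c"
  using geodesic[of a 0 False c] walk_0[of u "p a"] by auto

lemma inj_p: "inj_on p {..<k}"
  by (rule inj_onI) (metis lessThan_iff linorder_neqE_nat p_neq)

text \<open>Length 1 would need a loop, and a closed walk of length 2 runs back along its first
  edge, so that its value is 0.\<close>

lemma k_ge_3: "3 \<le> k"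
proof -
  have "k \<noteq> 0" using s0 sk by metis
  moreover have "k \<noteq> 1" using step[of 0] closed edge_neq by force
  moreover have "k \<noteq> 2"
  proof
    assume "k = 2"
    then have "s 2 = ((s 0 \<noteq> ({p 0, p 1} \<in> u)) \<noteq> ({p 1, p 0} \<in> u))"
      using step[of 0] step[of 1] closed by (simp add: numeral_2_eq_2)
    then show False using \<open>k = 2\<close> s0 sk by (simp add: insert_commute)
  qed
  ultimately show ?thesis by auto
qed

text \<open>The levels are taken from a vertex of the walk if its length is even and from an edge of it
  if its length is odd.\<close>

definition r :: nat where "r = (if even k then 1 else 2)"
definition m :: nat where "m = (k + 1 - r) div 2"
definition roots :: "'v set" where "roots = p ` {..<r}"

abbreviation "B \<equiv> gball roots"
abbreviation "L \<equiv> level roots"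
text \<open>The two arms of the walk: \<open>px i\<close> comes \<open>i\<close> steps after the
  last root, \<open>py i\<close> comes \<open>i\<close> steps before \<open>p k = p 0\<close>. As
  \<open>k = 2 * m + r - 1\<close>, they meet in \<open>px m = py m\<close>, opposite to the
  roots.\<close>

abbreviation "px i \<equiv> p (r - Suc 0 + i)"
abbreviation "py i \<equiv> p (k - i)"

lemma k_eq: "k + 1 = 2 * m + r"
  using k_ge_3 unfolding m_def r_def by (auto elim!: oddE)

lemma r_cases: "r = 1 \<or> r = 2" unfolding r_def by auto

lemma m_pos: "0 < m" using k_eq r_cases k_ge_3 by auto

lemma roots_V: "roots \<subseteq> V"
proof -
  have "p j \<in> V" if "j < r" for j
    using edge_in_V[of "p j" "p (Suc j)"] step[of j] that r_cases k_ge_3 by auto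
  then show ?thesis unfolding roots_def by auto
qed

lemma px_ball: "i \<le> m \<Longrightarrow> px i \<in> B i"
proof (induction i)
  case 0
  then show ?case using r_cases by (auto simp: roots_def)
next
  case (Suc i)
  then show ?case using step[of "r - 1 + i"] k_eq r_cases gball_edge[of "px i" roots i "px (Suc i)"]
    by auto
qed

lemma py_ball: "i \<le> m \<Longrightarrow> py i \<in> B i"
proof (induction i)
  case 0
  then show ?case using r_cases closed by (auto simp: roots_def)
next
  case (Suc i)
  have "Suc (k - Suc i) = k - i" "k - Suc i < k" using Suc.prems k_eq r_cases by auto
  then show ?case using step[of "k - Suc i"] Suc.IH Suc.prems
      gball_edge[of "py i" roots i "py (Suc i)"]
    by (auto simp: insert_commute)
qed

text \<open>A walk of length at most \<open>i\<close> from a root to a further point of the walk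
  would be a shortcut excluded by \<open>geodesic\<close>.\<close>

lemma not_in_ball:
  assumes "j \<le> k" "p j \<in> B i" shows "j \<le> r - 1 + i \<or> k - i \<le> j"
proof (rule ccontr)
  assume n: "\<not> ?thesis"
  obtain \<rho> d b where *: "\<rho> < r" "d \<le> i" "walk u (p \<rho>) d b (p j)"
    using gball_walk[OF assms(2), of u] unfolding roots_def by auto
  then have "d \<ge> j - \<rho> \<or> d \<ge> k - (j - \<rho>)" using geodesic[of \<rho> d b j] assms n by auto
  then show False using * n by auto
qed

lemma px_level: "i \<le> m \<Longrightarrow> px i \<in> L i"
  using px_ball[of i] not_in_ball[of "r - 1 + i" "i - 1"] k_eq r_cases by (cases i) auto

lemma py_level: "i \<le> m \<Longrightarrow> py i \<in> L i"
  using py_ball[of i] not_in_ball[of "k - i" "i - 1"] k_eq r_cases by (cases i) auto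

text \<open>By \<open>not_in_ball\<close> only points of the two arms at distance at most
  \<open>i\<close> qualify, and those at smaller distance have their own level. This isolates
  \<open>px i\<close> as the only point of the walk on its side once \<open>py i\<close> is assumed
  to lie elsewhere.\<close>

lemma p_level_index:
  assumes "i < m" "j < k" "p j \<in> L i" shows "j = r - 1 + i \<or> j = k - i \<or> i = 0 \<and> j < r"
proof -
  have *: "j \<le> r - 1 + i \<or> k - i \<le> j"
    using not_in_ball[of j i] assms level_subset_gball[of roots i] by auto
  have 1: "j' < i \<Longrightarrow> j = r - 1 + j' \<Longrightarrow> False" for j'
    using px_level[of j'] assms level_disjoint[of j' i roots] by auto
  have 2: "j' < i \<Longrightarrow> j = k - j' \<Longrightarrow> False" for j'
    using py_level[of j'] assms level_disjoint[of j' i roots] by auto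
  have 3: "j < r \<Longrightarrow> i = 0"
    using assms level_disjoint[of 0 i roots] by (cases "i = 0") (auto simp: roots_def)
  show ?thesis
  proof (rule ccontr)
    assume n: "\<not> ?thesis"
    then have "j \<ge> r" using 3 assms by linarith
    then consider "r \<le> j" "j < r - 1 + i" | "k - i < j" "r \<le> j" using * n by linarith
    then show False
    proof cases
      case 1
      then show False using \<open>\<And>j'. j' < i \<Longrightarrow> j = r - 1 + j' \<Longrightarrow> False\<close>[of "j - (r - 1)"] r_cases by fastforce
    next
      case 2
      then show False using \<open>\<And>j'. j' < i \<Longrightarrow> j = k - j' \<Longrightarrow> False\<close>[of "k - j"] \<open>j < k\<close> \<open>k - i < j\<close> by fastforce
    qed
  qed
qed

text \<open>Closed walks inside the ball of radius \<open>i < m\<close> are too short to be odd, so cocycles are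
  coboundaries there.\<close>

lemma potential:
  assumes "cocycle w" "i < m"
  shows "\<exists>\<sigma> :: 'v \<Rightarrow> bool. \<forall>x\<in>B i. \<forall>y\<in>B i. {x, y} \<in> E \<longrightarrow> ({x, y} \<in> w \<longleftrightarrow> \<sigma> x \<noteq> \<sigma> y)"
proof -
  have "\<exists>\<rho> d b. \<rho> < r \<and> d \<le> i \<and> walk w (p \<rho>) d b x" if "x \<in> B i" for x
    using gball_walk[OF that, of w] unfolding roots_def by auto
  then obtain \<rho> d b where *: "\<And>x. x \<in> B i \<Longrightarrow> \<rho> x < r \<and> d x \<le> i \<and> walk w (p (\<rho> x)) (d x) (b x) x"
    by metis
  \<comment> \<open>When the levels start from an edge there are two roots. Values of walks from
    different roots are made comparable by adding the value of the root edge for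
    \<open>p 1\<close>.\<close>
  define off where "off a \<longleftrightarrow> a = 1 \<and> {p 0, p 1} \<in> w" for a :: nat
  have off: "\<exists>n\<le>r - 1. walk w (p a) n (off a \<noteq> off c) (p c)" if "a < r" "c < r" for a c
  proof -
    have e: "r = 2 \<Longrightarrow> {p 0, p 1} \<in> E" using step[of 0] k_ge_3 by auto
    from that r_cases consider "a = c" | "r = 2" "a = 0" "c = 1" | "r = 2" "a = 1" "c = 0" by linarith
    then show ?thesis
    proof cases
      case 1
      then show ?thesis using walk_0 by auto
    next
      case 2
      then show ?thesis using walk_edge[of "p 0" "p 1" w] e by (auto simp: off_def)
    next
      case 3
      then show ?thesis using walk_edge[of "p 1" "p 0" w] e by (auto simp: off_def insert_commute)
    qed
  qed
  define \<sigma> where "\<sigma> x \<longleftrightarrow> off (\<rho> x) \<noteq> b x" for x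
  have "{x, y} \<in> w \<longleftrightarrow> \<sigma> x \<noteq> \<sigma> y" if "x \<in> B i" "y \<in> B i" "{x, y} \<in> E" for x y
  proof -
    have x: "\<rho> x < r" "d x \<le> i" "walk w (p (\<rho> x)) (d x) (b x) x"
      and y: "\<rho> y < r" "d y \<le> i" "walk w (p (\<rho> y)) (d y) (b y) y" using * that by auto
    obtain n where n: "n \<le> r - 1" "walk w (p (\<rho> y)) n (off (\<rho> y) \<noteq> off (\<rho> x)) (p (\<rho> x))"
      using off[OF y(1) x(1)] by auto
    have "walk w x (Suc 0 + d y + n + d x)
      (((({x, y} \<in> w) \<noteq> b y) \<noteq> (off (\<rho> y) \<noteq> off (\<rho> x))) \<noteq> b x) x"
      by (intro walk_append[OF x(3)] walk_append[OF n(2)] walk_append[OF walk_sym[OF y(3)]]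
          walk_edge that)
    \<comment> \<open>The length is at most \<open>1 + 2 * i + (r - 1)\<close>, and
      \<open>i < m\<close> bounds this by \<open>k - 1\<close>.\<close>
    moreover have "Suc 0 + d y + n + d x < k" using x y n k_eq \<open>i < m\<close> r_cases by auto
    ultimately have "\<not> (((({x, y} \<in> w) \<noteq> b y) \<noteq> (off (\<rho> y) \<noteq> off (\<rho> x))) \<noteq> b x)"
      by (rule even_if_shorter[OF _ assms(1)])
    then show ?thesis unfolding \<sigma>_def by auto
  qed
  then show ?thesis by (intro exI[of _ \<sigma>] ballI impI)
qed

section \<open>Components of the levels and the cycles that separate them\<close>

definition lrel :: "nat \<Rightarrow> ('v \<times> 'v) set" where
  "lrel i = {(x, y). x \<in> L i \<and> y \<in> L i \<and> {x, y} \<in> E}"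

text \<open>The component of \<open>px i\<close> in the subgraph induced by level
  \<open>i\<close>.\<close>

definition side :: "nat \<Rightarrow> 'v set" where
  "side i = (lrel i)\<^sup>* `` {px i}"

lemma side_level: "i < m \<Longrightarrow> side i \<subseteq> L i"
proof -
  assume "i < m"
  then have "px i \<in> L i" by (simp add: px_level)
  moreover have "y \<in> L i" if "(x, y) \<in> (lrel i)\<^sup>*" "x \<in> L i" for x y
    using that by (induction rule: rtrancl_induct) (auto simp: lrel_def)
  ultimately show ?thesis unfolding side_def by auto
qed

lemma side_edge: "i < m \<Longrightarrow> x \<in> side i \<Longrightarrow> y \<in> L i \<Longrightarrow> {x, y} \<in> E \<Longrightarrow> y \<in> side i"
  using side_level[of i] unfolding side_def lrel_def
  by (auto intro: rtrancl_into_rtrancl)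

lemma px_side: "px i \<in> side i" unfolding side_def by auto

text \<open>The part on \<open>side i\<close> of the boundary modulo 2 of the set of faces that
  reach level \<open>Suc i\<close>. An edge lies in two faces, so odd means that exactly one of them
  reaches outwards.\<close>

definition cross :: "nat \<Rightarrow> 'v set set" where
  "cross i = {e \<in> E. e \<subseteq> side i \<and> odd (card {F \<in> Fs. e \<subseteq> vt F \<and> vt F \<inter> L (Suc i) \<noteq> {}})}"

text \<open>The vertices of a face are pairwise adjacent. Next to level \<open>Suc i\<close> there
  is nothing of a level below \<open>i\<close>; next to the side there is nothing beyond level
  \<open>Suc i\<close>, and nothing of level \<open>i\<close> outside the side.\<close>

lemma face_side:
  assumes "i < m" "F \<in> Fs" "vt F \<inter> side i \<noteq> {}" "vt F \<inter> L (Suc i) \<noteq> {}"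
  shows "vt F \<subseteq> side i \<union> L (Suc i)"
proof
  fix z assume z: "z \<in> vt F"
  obtain a b where a: "a \<in> vt F" "a \<in> side i" and b: "b \<in> vt F" "b \<in> L (Suc i)" using assms by auto
  have al: "a \<in> L i" using a side_level assms by auto
  show "z \<in> side i \<union> L (Suc i)"
  proof (cases "z = a \<or> z = b")
    case False
    then have ea: "{a, z} \<in> E" and eb: "{b, z} \<in> E" using face_edge assms a b z by auto
    have "z \<in> B (Suc i)" using ea gball_edge al level_subset_gball by blast
    moreover have "z \<notin> B i \<or> z \<in> L i" using level_edge[OF b(2) eb] .
    ultimately show ?thesis using side_edge[OF assms(1) a(2) _ ea] by auto
  qed (use a b in auto)
qed

lemma even_sum_cong:
  "(\<And>x. x \<in> A \<Longrightarrow> even (f x) = even (g x)) \<Longrightarrow> even (sum f A :: nat) = even (sum g A :: nat)"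
  by (induction A rule: infinite_finite_induct) auto

lemma card_edges_face:
  assumes "F \<in> Fs" "vt F = {x, y, z}" "x \<noteq> y" "x \<noteq> z" "y \<noteq> z"
  shows "card {e \<in> E. e \<subseteq> vt F \<and> P e} =
    of_bool (P {x, y}) + of_bool (P {x, z}) + of_bool (P {y, z})"
proof -
  have ne: "{x,y} \<noteq> {x,z}" "{x,y} \<noteq> {y,z}" "{x,z} \<noteq> {y,z}"
    using assms by (auto simp: doubleton_eq_iff)
  have "card {e \<in> E. e \<subseteq> vt F \<and> P e} = card {e \<in> {e \<in> E. e \<subseteq> vt F}. P e}"
    by (rule arg_cong[where f=card]) auto
  also have "\<dots> = (\<Sum>e\<in>{e \<in> E. e \<subseteq> vt F}. of_bool (P e))"
    using finite_E by (simp add: sum.If_cases Int_def of_bool_def)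
  also have "\<dots> = of_bool (P {x, y}) + of_bool (P {x, z}) + of_bool (P {y, z})"
    unfolding face_edges_eq[OF assms] using ne by simp
  finally show ?thesis .
qed

lemma swap_incidence:
  "(\<Sum>F\<in>{F \<in> Fs. Q F}. card {e \<in> E. e \<subseteq> vt F \<and> P e}) =
   (\<Sum>e\<in>{e \<in> E. P e}. card {F \<in> Fs. e \<subseteq> vt F \<and> Q F})"
proof -
  have 1: "card {e \<in> E. e \<subseteq> vt F \<and> P e} = (\<Sum>e\<in>{e \<in> E. P e}. of_bool (e \<subseteq> vt F))" for F
    using finite_E by (simp add: sum.If_cases of_bool_def Int_def conj_ac)
  have 2: "card {F \<in> Fs. e \<subseteq> vt F \<and> Q F} = (\<Sum>F\<in>{F \<in> Fs. Q F}. of_bool (e \<subseteq> vt F))" for e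
    using finite_Fs by (simp add: sum.If_cases of_bool_def Int_def conj_ac)
  show ?thesis unfolding 1 2 by (rule sum.swap)
qed

text \<open>The count of the pairs of an edge on the side and a face beyond it is compared with the count
  of the edges between the side and the next level; every such edge lies in two faces.\<close>

lemma even_cross:
  assumes i: "i < m" and \<sigma>: "\<And>x y. x \<in> B i \<Longrightarrow> y \<in> B i \<Longrightarrow> {x, y} \<in> E \<Longrightarrow> {x, y} \<in> w \<longleftrightarrow> (\<sigma> x :: bool) \<noteq> \<sigma> y"
  shows "even (card (w \<inter> cross i))"
proof -
  let ?Q = "\<lambda>F. vt F \<inter> L (Suc i) \<noteq> {}"
  let ?P = "\<lambda>e. e \<subseteq> side i \<and> e \<in> w"
  \<comment> \<open>\<open>?R\<close> marks the edges from a side vertex of potential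
    \<open>True\<close> to the next level. If an outer face has one vertex on the side, it has two
    marked edges or none, and no edge on the side. If it has two, the edge between them is in
    \<open>w\<close> exactly when one of the other two edges is marked.\<close>
  let ?R = "\<lambda>e. \<exists>a b. e = {a, b} \<and> a \<in> side i \<and> \<sigma> a \<and> b \<in> L (Suc i)"
  have AL: "a \<in> side i \<Longrightarrow> a \<notin> L (Suc i)" for a
    using side_level[OF i] level_subset_gball[of roots i] by auto
  have \<sigma>A: "{x, y} \<in> w \<longleftrightarrow> \<sigma> x \<noteq> \<sigma> y" if "x \<in> side i" "y \<in> side i" "{x, y} \<in> E" for x y
    using \<sigma> that side_level[OF i] level_subset_gball[of roots i] by blast
  have R: "?R {a, b} \<longleftrightarrow> (a \<in> side i \<and> \<sigma> a \<and> b \<in> L (Suc i)) \<or> (b \<in> side i \<and> \<sigma> b \<and> a \<in> L (Suc i))" for a b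
    by (auto simp: doubleton_eq_iff)
  have "even (card {e \<in> E. e \<subseteq> vt F \<and> ?P e}) = even (card {e \<in> E. e \<subseteq> vt F \<and> ?R e})"
    if F: "F \<in> Fs" "?Q F" for F
  proof -
    obtain x y z where v: "vt F = {x, y, z}" "x \<noteq> y" "x \<noteq> z" "y \<noteq> z" using face_3 F by metis
    have e: "{x, y} \<in> E" "{x, z} \<in> E" "{y, z} \<in> E" using face_edge F v by auto
    show ?thesis
    proof (cases "vt F \<inter> side i = {}")
      case True
      then show ?thesis unfolding card_edges_face[OF F(1) v] R using v by auto
    next
      case False
      have "vt F \<subseteq> side i \<union> L (Suc i)" using face_side[OF i F(1) False F(2)] .
      then have sub: "x \<in> L (Suc i) \<longleftrightarrow> x \<notin> side i" "y \<in> L (Suc i) \<longleftrightarrow> y \<notin> side i" "z \<in> L (Suc i) \<longleftrightarrow> z \<notin> side i"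
        using v AL by auto
      have "\<not> (x \<in> side i \<and> y \<in> side i \<and> z \<in> side i)" using F(2) v AL by auto
      then show ?thesis unfolding card_edges_face[OF F(1) v] R sub
        using \<sigma>A[OF _ _ e(1)] \<sigma>A[OF _ _ e(2)] \<sigma>A[OF _ _ e(3)]
        by (cases "x \<in> side i"; cases "y \<in> side i"; cases "z \<in> side i") auto
    qed
  qed
  then have "even (\<Sum>F\<in>{F \<in> Fs. ?Q F}. card {e \<in> E. e \<subseteq> vt F \<and> ?P e}) =
    even (\<Sum>F\<in>{F \<in> Fs. ?Q F}. card {e \<in> E. e \<subseteq> vt F \<and> ?R e})"
    by (intro even_sum_cong) auto
  moreover have "even (\<Sum>F\<in>{F \<in> Fs. ?Q F}. card {e \<in> E. e \<subseteq> vt F \<and> ?R e})"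
  proof (unfold swap_incidence, rule dvd_sum)
    fix e assume "e \<in> {e \<in> E. ?R e}"
    then have "{F \<in> Fs. e \<subseteq> vt F \<and> ?Q F} = {F \<in> Fs. e \<subseteq> vt F}" "e \<in> E" by auto
    then show "even (card {F \<in> Fs. e \<subseteq> vt F \<and> ?Q F})" using two_faces by simp
  qed
  ultimately have "even (\<Sum>e\<in>{e \<in> E. ?P e}. card {F \<in> Fs. e \<subseteq> vt F \<and> ?Q F})"
    by (simp only: swap_incidence)
  then have "even (card {e \<in> {e \<in> E. ?P e}. odd (card {F \<in> Fs. e \<subseteq> vt F \<and> ?Q F})})"
    using finite_E by (simp add: even_sum_iff)
  moreover have "{e \<in> {e \<in> E. ?P e}. odd (card {F \<in> Fs. e \<subseteq> vt F \<and> ?Q F})} = w \<inter> cross i"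
    unfolding cross_def by auto
  ultimately show ?thesis by simp
qed

text \<open>Functionals that are even on all face boundaries are cocycles, and by
  \<open>potential\<close> and \<open>even_cross\<close> these are even on \<open>cross i\<close>.
  So the second alternative of \<open>span_or_functional_mod_2\<close> fails, and
  \<open>cross i\<close> is a sum of face boundaries.\<close>

lemma ex_face_set:
  assumes i: "i < m"
  shows "\<exists>D\<subseteq>Fs. \<forall>e\<in>E. e \<in> cross i \<longleftrightarrow> odd (card {F \<in> D. e \<subseteq> vt F})"
proof -
  have "\<not> (\<exists>w\<subseteq>E. (\<forall>F\<in>Fs. even (card (w \<inter> {e \<in> E. e \<subseteq> vt F}))) \<and> odd (card (w \<inter> cross i)))"
  proof safe
    fix w assume w: "\<forall>F\<in>Fs. even (card (w \<inter> {e \<in> E. e \<subseteq> vt F}))" "odd (card (w \<inter> cross i))"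
    then have "cocycle w" by (intro cocycleI_even) auto
    then obtain \<sigma> :: "'v \<Rightarrow> bool"
      where "\<forall>x\<in>B i. \<forall>y\<in>B i. {x, y} \<in> E \<longrightarrow> ({x, y} \<in> w \<longleftrightarrow> \<sigma> x \<noteq> \<sigma> y)"
      using potential[OF _ i] by blast
    then have "even (card (w \<inter> cross i))" by (intro even_cross[OF i]) auto
    then show False using w by simp
  qed
  moreover have "cross i \<subseteq> E" unfolding cross_def by auto
  moreover have "{e \<in> E. e \<subseteq> vt F} \<subseteq> E" for F by auto
  ultimately obtain D where "D \<subseteq> Fs" "\<forall>e\<in>E. e \<in> cross i \<longleftrightarrow> odd (card {F \<in> D. e \<in> {e \<in> E. e \<subseteq> vt F}})"
    using span_or_functional_mod_2[OF finite_Fs finite_E, of "\<lambda>F. {e \<in> E. e \<subseteq> vt F}" "cross i"] by blast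
  then show ?thesis by (intro exI[of _ D]) auto
qed

text \<open>The face set \<open>D\<close> changes across the edges of \<open>cross i\<close> only. The walk meets the side of
  \<open>px i\<close> in that vertex only if \<open>py i\<close> lies elsewhere; then the faces along the rest of the walk
  are all in \<open>D\<close> or all outside, while around \<open>px i\<close> the membership in \<open>D\<close> changes
  exactly when one passes from the outer faces to the others.\<close>

lemma py_side:
  assumes i: "i < m" shows "py i \<in> side i"
proof (cases "i = 0")
  case True
  have "(p 0, p (Suc 0)) \<in> lrel 0 \<and> (p (Suc 0), p 0) \<in> lrel 0" if "r = 2"
    using that step[of 0] k_ge_3 by (auto simp: lrel_def roots_def insert_commute)
  then show ?thesis using True r_cases closed by (auto simp: side_def)
next
  case False
  then have i0: "0 < i" by simp
  show ?thesis
  proof (rule ccontr)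
    assume n: "py i \<notin> side i"
    obtain D where D: "D \<subseteq> Fs" "\<And>e. e \<in> E \<Longrightarrow> e \<in> cross i \<longleftrightarrow> odd (card {F \<in> D. e \<subseteq> vt F})"
      using ex_face_set[OF i] by blast
    \<comment> \<open>\<open>cross i\<close> is the boundary of \<open>D\<close>, so an edge outside
      it has both or neither of its two faces in \<open>D\<close>.\<close>
    have same: "F \<in> D \<longleftrightarrow> G \<in> D"
      if "e \<in> E" "e \<notin> cross i" "F \<in> Fs" "G \<in> Fs" "e \<subseteq> vt F" "e \<subseteq> vt G" for e F G
    proof (rule ccontr)
      assume FG: "(F \<in> D) \<noteq> (G \<in> D)"
      then have "F \<noteq> G" by auto
      then have "{F \<in> Fs. e \<subseteq> vt F} = {F, G}"
        using two_faces[OF that(1)] that(3-6) finite_Fs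
        by (intro card_seteq[symmetric]) auto
      then have "{F \<in> D. e \<subseteq> vt F} = {F, G} \<inter> D" using D(1) by auto
      then have "odd (card {F \<in> D. e \<subseteq> vt F})" using FG by auto
      then show False using D(2)[OF that(1)] that(2) by simp
    qed
    have star: "F \<in> D \<longleftrightarrow> G \<in> D"
      if "x \<notin> side i" "x \<in> V" "F \<in> Fs" "G \<in> Fs" "x \<in> vt F" "x \<in> vt G" for x F G
    proof (rule link_connected[OF \<open>x \<in> V\<close> _ that(3-6)])
      fix F G e assume "F \<in> Fs" "G \<in> Fs" "e \<in> E" "x \<in> e" "e \<subseteq> vt F" "e \<subseteq> vt G"
      then show "(F \<in> D) = (G \<in> D)" using that(1) by (intro same[of e]) (auto simp: cross_def)
    qed
    have k: "r + i < k - i" using i k_eq r_cases by auto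
    define t where "t = r - Suc 0 + i"
    have t: "0 < t" "t < k" "t + i < k" using i0 i k_eq r_cases by (auto simp: t_def)
    have off_side: "p j \<notin> side i" if "j \<le> k" "j \<noteq> t" for j
    proof
      assume a: "p j \<in> side i"
      show False
      proof (cases "j = k")
        case True
        then have "p 0 \<in> L i" using a side_level[OF i] closed by auto
        then show False using p_level_index[OF i, of 0] t i0 by (auto simp: t_def)
      next
        case False
        then show False using p_level_index[OF i, of j] that a n side_level[OF i] i0 by (auto simp: t_def)
      qed
    qed
    have pV: "p j \<in> V" if "j \<le> k" for j
    proof (cases "j = k")
      case True
      then show ?thesis using step[of 0] t edge_in_V[of "p 0" "p (Suc 0)"] closed by simp
    next
      case False
      then show ?thesis using step[of j] that edge_in_V[of "p j" "p (Suc j)"] by simp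
    qed
    define Q where "Q j b \<longleftrightarrow> (\<forall>F\<in>Fs. p j \<in> vt F \<longrightarrow> (F \<in> D) = b)" for j b
    have star': "(F \<in> D) = (G \<in> D)"
      if "j \<le> k" "j \<noteq> t" "F \<in> Fs" "G \<in> Fs" "p j \<in> vt F" "p j \<in> vt G" for j F G
      using that by (intro star[of "p j"] off_side pV)
    have Q_eq: "Q j b \<longleftrightarrow> (F \<in> D) = b" if "j \<le> k" "j \<noteq> t" "F \<in> Fs" "p j \<in> vt F" for j b F
    proof
      assume "(F \<in> D) = b"
      then show "Q j b" unfolding Q_def using star'[OF that(1,2) _ that(3) _ that(4)] by simp
    qed (use that in \<open>simp add: Q_def\<close>)
    have next_Q: "Q (Suc j) b \<longleftrightarrow> Q j b" if j: "j < k" "j \<noteq> t" "Suc j \<noteq> t" for j b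
    proof -
      obtain F where F: "F \<in> Fs" "{p j, p (Suc j)} \<subseteq> vt F" using edge_face step[OF j(1)] by blast
      then show ?thesis using Q_eq[of j F b] Q_eq[of "Suc j" F b] j by simp
    qed
    have "{p 0, p (Suc 0)} \<in> E" using step[of 0] t by simp
    then obtain F0 where "F0 \<in> Fs" "{p 0, p (Suc 0)} \<subseteq> vt F0" using edge_face by blast
    then have b: "Q 0 b" if "b = (F0 \<in> D)" for b using Q_eq[of 0 F0 b] t that by simp
    define b where "b = (F0 \<in> D)"
    note b = b[OF b_def]
    \<comment> \<open>Consecutive vertices share a face, so the common status of the faces passes
      along the walk: forwards from \<open>p 0\<close> up to \<open>p (t - 1)\<close>, and backwards
      from \<open>p k = p 0\<close> down to \<open>p (Suc t)\<close>.\<close>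
    have below: "Q j b" if "j < t" for j
      using that by (induction j) (use b next_Q t in auto)
    have Qk: "Q k b" using b closed by (simp add: Q_def)
    have above: "Q (k - j) b" if "j < k - t" for j
      using that
    proof (induction j)
      case (Suc j)
      then show ?case using next_Q[of "k - Suc j"] by (auto simp: Suc_diff_Suc)
    qed (use Qk in simp)
    have Q: "Q (t - 1) b" "Q (Suc t) b"
      using below[of "t - 1"] above[of "k - Suc t"] t k by auto
    define out where "out F \<longleftrightarrow> vt F \<inter> L (Suc i) \<noteq> {}" for F
    have pt: "p t \<in> side i" using px_side by (simp add: t_def)
    then have ptL: "p t \<in> L i" using side_level[OF i] by auto
    have around: "((F \<in> D) = out F) = ((G \<in> D) = out G)"
      if "F \<in> Fs" "G \<in> Fs" "p t \<in> vt F" "p t \<in> vt G" for F G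
    proof (rule link_connected[of "p t" "\<lambda>F. (F \<in> D) = out F", OF _ _ that])
      show "p t \<in> V" using pV t by simp
      fix F G e assume h: "F \<in> Fs" "G \<in> Fs" "e \<in> E" "p t \<in> e" "e \<subseteq> vt F" "e \<subseteq> vt G"
      show "((F \<in> D) = out F) = ((G \<in> D) = out G)"
      proof (cases "F = G")
        case False
        have "card e = 2" using edge h(3) by auto
        then obtain a where e: "e = {p t, a}" using h(4) by (auto simp: card_2_iff)
        have two: "{F \<in> Fs. e \<subseteq> vt F} = {F, G}"
          using two_faces[OF h(3)] h False finite_Fs by (intro card_seteq[symmetric]) auto
        show ?thesis
        \<comment> \<open>An edge on the side is in \<open>cross i\<close> if exactly one of its two
          faces is outer, and likewise if exactly one is in \<open>D\<close>. Across any other edge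
          at \<open>p t\<close> neither status changes.\<close>
        proof (cases "a \<in> side i")
          case True
          then have es: "e \<subseteq> side i" using pt e by auto
          have "{F \<in> D. e \<subseteq> vt F} = {F, G} \<inter> D" using D(1) two by auto
          moreover have "{H \<in> Fs. e \<subseteq> vt H \<and> out H} = {F, G} \<inter> {H. out H}" using two by auto
          moreover have "e \<in> cross i \<longleftrightarrow> odd (card {H \<in> Fs. e \<subseteq> vt H \<and> out H})"
            using h(3) es by (simp add: cross_def out_def)
          ultimately have "odd (card ({F, G} \<inter> D)) = odd (card ({F, G} \<inter> {H. out H}))"
            using D(2)[OF h(3)] by simp
          then show ?thesis using False by (auto simp: Int_insert_left split: if_splits)
        next
          case False
          have aL: "a \<notin> L i" using False side_edge[OF i pt] h(3) e by auto
          have "(F \<in> D) = (G \<in> D)"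
            by (rule same[OF h(3) _ h(1,2,5,6)]) (use False e in \<open>auto simp: cross_def\<close>)
          moreover have "out H \<longleftrightarrow> a \<in> L (Suc i)" if H: "H \<in> Fs" "e \<subseteq> vt H" for H
          proof
            assume "out H"
            then obtain c where c: "c \<in> vt H" "c \<in> L (Suc i)" by (auto simp: out_def)
            show "a \<in> L (Suc i)"
            proof (cases "c = a")
              case False
              then have "{c, a} \<in> E" using face_edge H c e by auto
              then have "a \<notin> B i" using level_edge[OF c(2)] aL by blast
              moreover have "a \<in> B (Suc i)"
                using gball_edge[of "p t" roots i a] ptL level_subset_gball[of roots i] h(3) e by auto
              ultimately show ?thesis by simp
            qed (use c in fast)
          next
            assume "a \<in> L (Suc i)" then show "out H" using H e by (auto simp: out_def)
          qed
          ultimately show ?thesis using h by simp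
        qed
      qed simp
    qed
    \<comment> \<open>The face \<open>F\<close> entered before \<open>p t\<close> has a vertex of
      level \<open>i - 1\<close> and so is not outer, while the face \<open>G\<close> left through
      has a vertex of level \<open>Suc i\<close>. Both have status \<open>b\<close>, against
      \<open>around\<close>.\<close>
    have "{p (t - 1), p t} \<in> E" using step[of "t - 1"] t by simp
    then obtain F where F: "F \<in> Fs" "{p (t - 1), p t} \<subseteq> vt F" using edge_face by blast
    have "{p t, p (Suc t)} \<in> E" using step[of t] t by simp
    then obtain G where G: "G \<in> Fs" "{p t, p (Suc t)} \<subseteq> vt G" using edge_face by blast
    have "(F \<in> D) = b" "(G \<in> D) = b" using Q F G unfolding Q_def by auto
    moreover have "out G"
    proof -
      have "p (Suc t) \<in> L (Suc i)" using px_level[of "Suc i"] i by (simp add: t_def del: level.simps)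
      then show ?thesis using G by (auto simp: out_def)
    qed
    moreover have "\<not> out F"
    proof
      assume "out F"
      then obtain c where c: "c \<in> vt F" "c \<in> L (Suc i)" by (auto simp: out_def)
      have tm: "p (t - 1) \<in> L (i - 1)"
        using px_level[of "i - 1"] i i0 r_cases by (auto simp: t_def)
      moreover have "L (i - 1) \<inter> L (Suc i) = {}" by (rule level_disjoint) linarith
      ultimately have "c \<noteq> p (t - 1)" using c by blast
      then have "{c, p (t - 1)} \<in> E" using face_edge F c by auto
      then have "p (t - 1) \<notin> B i \<or> p (t - 1) \<in> L i" using level_edge[OF c(2)] by simp
      moreover have "L (i - 1) \<inter> L i = {}" by (rule level_disjoint) (use i0 in simp)
      ultimately show False using tm
          gball_mono[of "i - 1" i roots] level_subset_gball[of roots "i - 1"] by auto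
    qed
    ultimately show False using around[OF F(1) G(1)] F G by auto
  qed
qed

section \<open>Counting the vertices of the levels\<close>

text \<open>Close a path in the level from \<open>px i\<close> to \<open>py i\<close> with the arc
  of the walk that avoids the roots. Inside the ball the value of \<open>u\<close> depends on the
  end points only, so the path has the same value as the arc through the roots, and the closed walk
  is odd. Its length is at least \<open>k\<close>, which leaves at least
  \<open>2 * i + r - 1\<close> edges for the path.\<close>

lemma card_level:
  assumes i: "i < m"
  shows "2 * i + r \<le> card (L i)"
proof -
  obtain \<sigma> :: "'v \<Rightarrow> bool"
    where "\<forall>x\<in>B i. \<forall>y\<in>B i. {x, y} \<in> E \<longrightarrow> ({x, y} \<in> u \<longleftrightarrow> \<sigma> x \<noteq> \<sigma> y)"
    using potential[OF cocycle_u i] by blast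
  then have \<sigma>: "{x, y} \<in> u \<longleftrightarrow> \<sigma> x \<noteq> \<sigma> y" if "x \<in> B i" "y \<in> B i" "{x, y} \<in> E" for x y
    using that by simp
  have fin: "finite (L i)"
    using gball_subset_V[OF roots_V, of i] level_subset_gball[of roots i] finite_V finite_subset
    by (metis subset_trans)
  have "(px i, py i) \<in> (lrel i)\<^sup>*" using py_side[OF i] by (simp add: side_def)
  then obtain l where l: "l < card (L i)" "(px i, py i) \<in> lrel i ^^ l"
    using rtrancl_relpow_lt_card[OF fin, of "lrel i" "px i" "py i"] px_level[of i] i
    by (auto simp: lrel_def)
  have "walk u (px i) l (\<sigma> (px i) \<noteq> \<sigma> y) y" if "(px i, y) \<in> lrel i ^^ l" for l y
    using that
  proof (induction l arbitrary: y)
    case 0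
    then show ?case by (simp add: walk_0)
  next
    case (Suc l)
    then obtain z where z: "(px i, z) \<in> lrel i ^^ l" "(z, y) \<in> lrel i" by auto
    then have "{z, y} \<in> E" "z \<in> B i" "y \<in> B i"
      using level_subset_gball[of roots i] by (auto simp: lrel_def)
    then show ?case using \<sigma>[of z y] by (intro walk_Suc[OF Suc.IH[OF z(1)]]) auto
  qed
  note across = this[OF l(2)]
  \<comment> \<open>\<open>up\<close> and \<open>down\<close> express the value of \<open>u\<close>
    along the two arms by the potential; together they give the value of the arc through the
    roots.\<close>
  have up: "(s 0 \<noteq> s (r - Suc 0 + j)) = (\<sigma> (p 0) \<noteq> \<sigma> (px j))" if "j \<le> i" for j
    using that
  proof (induction j)
    case 0
    have "p 0 \<in> B i \<and> p 1 \<in> B i" if "r = 2"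
      using gball_mono[of 0 i roots] that by (auto simp: roots_def)
    then have "r = 2 \<Longrightarrow> (s 0 \<noteq> s 1) = (\<sigma> (p 0) \<noteq> \<sigma> (p 1))"
      using step[of 0] \<sigma>[of "p 0" "p 1"] k_ge_3 by auto
    then show ?case using r_cases by auto
  next
    case (Suc j)
    have "px j \<in> B i" "px (Suc j) \<in> B i"
      using px_ball[of j] px_ball[of "Suc j"] gball_mono[of j i roots] gball_mono[of "Suc j" i roots]
        Suc.prems i by (auto simp del: gball.simps)
    then show ?case
      using Suc step[of "r - Suc 0 + j"] \<sigma>[of "px j" "px (Suc j)"] i k_eq r_cases by auto
  qed
  have down: "(s k \<noteq> s (k - j)) = (\<sigma> (p k) \<noteq> \<sigma> (py j))" if "j \<le> i" for j
    using that
  proof (induction j)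
    case (Suc j)
    have "py j \<in> B i" "py (Suc j) \<in> B i"
      using py_ball[of j] py_ball[of "Suc j"] gball_mono[of j i roots] gball_mono[of "Suc j" i roots]
        Suc.prems i by (auto simp del: gball.simps)
    moreover have "Suc (k - Suc j) = k - j" "k - Suc j < k" using Suc.prems i k_eq r_cases by auto
    ultimately show ?case
      using Suc step[of "k - Suc j"] \<sigma>[of "py (Suc j)" "py j"] by auto
  qed simp
  have le: "r - Suc 0 + i \<le> k - i" using i k_eq r_cases by auto
  have "walk u (py i) (l + (k - i - (r - Suc 0 + i)))
      ((s (r - Suc 0 + i) \<noteq> s (k - i)) \<noteq> (\<sigma> (px i) \<noteq> \<sigma> (py i))) (py i)"
    using walk_append[OF across walk_sym[OF segment[OF le]]] by (simp add: add.commute)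
  moreover have "((s (r - Suc 0 + i) \<noteq> s (k - i)) \<noteq> (\<sigma> (px i) \<noteq> \<sigma> (py i)))"
    using up[of i] down[of i] closed s0 sk by auto
  ultimately have "k \<le> l + (k - i - (r - Suc 0 + i))"
    using even_if_shorter[OF _ cocycle_u] not_le by blast
  then show ?thesis using l le r_cases i by auto
qed

lemma k_squared_le: "k\<^sup>2 \<le> 4 * card V"
proof -
  have LV: "L i \<subseteq> V" for i
    using gball_subset_V[OF roots_V, of i] level_subset_gball[of roots i] by auto
  have fin: "finite (L i)" for i using LV finite_V finite_subset by blast
  \<comment> \<open>For odd \<open>k\<close> the levels below \<open>m\<close> sum up to
    \<open>m^2 + m\<close>, just short of \<open>k^2 / 4 = m^2 + m + 1/4\<close>; one vertex of
    level \<open>m\<close> closes the gap. For even \<open>k\<close> the term is 0.\<close>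
  have last: "r - 1 \<le> card (L m)"
  proof -
    have "L m \<noteq> {}" using px_level[of m] by auto
    then have "1 \<le> card (L m)" using fin[of m] by (simp add: Suc_le_eq card_gt_0_iff del: level.simps)
    then show ?thesis using r_cases by auto
  qed
  have "(\<Sum>i<n. 2 * i + r) = n * (n - 1) + r * n" for n
    by (induction n) (auto simp: algebra_simps, (case_tac n; auto)?)
  then have "m * (m - 1) + r * m + (r - 1) \<le> (\<Sum>i<m. card (L i)) + card (L m)"
    using sum_mono[of "{..<m}" "\<lambda>i. 2 * i + r" "\<lambda>i. card (L i)"] card_level last by force
  also have "\<dots> = (\<Sum>i<Suc m. card (L i))" by simp
  also have "\<dots> = card (\<Union>i<Suc m. L i)"
    using fin level_disjoint[of _ _ roots] by (subst card_UN_disjoint) auto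
  also have "\<dots> \<le> card V" using LV by (intro card_mono finite_V) auto
  finally have *: "m * (m - 1) + r * m + (r - 1) \<le> card V" .
  obtain m' where m': "m = Suc m'" using m_pos by (cases m) auto
  show ?thesis
  proof (cases "r = 1")
    case True
    then have "k = 2 * m" using k_eq by auto
    then show ?thesis using * True m' by (auto simp: power2_eq_square algebra_simps)
  next
    case False
    then have "r = 2" "k = 2 * m + 1" using k_eq r_cases by auto
    then show ?thesis using * m' by (auto simp: power2_eq_square algebra_simps)
  qed
qed

end

context combinatorial_surface
begin

theorem short_odd_cycle:
  assumes "cocycle w" "walk w x n True x"
  shows "\<exists>u k p s. cocycle u \<and> 3 \<le> k \<and> inj_on p {..<k} \<and> p k = p 0 \<and>
    (\<forall>j<k. {p j, p (Suc j)} \<in> E \<and> s (Suc j) = (s j \<noteq> ({p j, p (Suc j)} \<in> u))) \<and>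
    \<not> s 0 \<and> s k \<and> k\<^sup>2 \<le> 4 * card V"
proof -
  \<comment> \<open>Cocycles and walks are minimised over together, as \<open>shorter\<close>
    demands.\<close>
  let ?P = "\<lambda>n. \<exists>w x. cocycle w \<and> walk w x n True x"
  define k where "k = (LEAST n. ?P n)"
  have "?P n" using assms by blast
  then have "?P k" unfolding k_def by (rule LeastI)
  then obtain u y where u: "cocycle u" "walk u y k True y" by blast
  have least: "\<not> ?P j" if "j < k" for j using not_less_Least that unfolding k_def by blast
  obtain p s where ps: "p 0 = y" "p k = y" "\<not> s 0" "s k = True"
    "\<forall>j<k. {p j, p (Suc j)} \<in> E \<and> s (Suc j) = (s j \<noteq> ({p j, p (Suc j)} \<in> u))"
    using walk_ex_path[OF u(2)] by blast
  interpret shortest_odd_walk V E Fs vt u k p s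
    by unfold_locales (use u ps least in auto)
  show ?thesis
    by (rule exI[of _ u], rule exI[of _ k], rule exI[of _ p], rule exI[of _ s])
      (use u ps k_ge_3 inj_p k_squared_le in auto)
qed

end

section \<open>Locally constant predicates and double covers\<close>

text \<open>Neighbourhoods are taken in \<open>X\<close> and not in the subspace \<open>S\<close>,
  so that one topology serves for all sets \<open>S\<close> that occur.\<close>

definition loc_const :: "'a topology \<Rightarrow> 'a set \<Rightarrow> ('a \<Rightarrow> bool) \<Rightarrow> bool" where
  "loc_const X S P \<longleftrightarrow> (\<forall>p\<in>S. \<exists>N b. openin X N \<and> p \<in> N \<and> (\<forall>q\<in>N \<inter> S. P q = b))"

lemma loc_constI:
  assumes "\<And>p. p \<in> S \<Longrightarrow> \<exists>N b. openin X N \<and> p \<in> N \<and> (\<forall>q\<in>N \<inter> S. P q = b)"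
  shows "loc_const X S P"
  using assms unfolding loc_const_def by simp

lemma loc_constE:
  assumes "loc_const X S P" "p \<in> S"
  obtains N b where "openin X N" "p \<in> N" "\<forall>q\<in>N \<inter> S. P q = b"
  using assms unfolding loc_const_def by blast

lemma loc_const_subset:
  assumes "loc_const X S P" "T \<subseteq> S" shows "loc_const X T P"
proof (rule loc_constI)
  fix p assume "p \<in> T"
  then have "p \<in> S" using assms(2) by auto
  then obtain N b where "openin X N" "p \<in> N" "\<forall>q\<in>N \<inter> S. P q = b"
    by (rule loc_constE[OF assms(1)])
  then show "\<exists>N b. openin X N \<and> p \<in> N \<and> (\<forall>q\<in>N \<inter> T. P q = b)"
    using assms(2) by (intro exI[of _ N] exI[of _ b]) auto
qed

lemma loc_const_transfer:
  assumes "loc_const X S P" "\<And>p. p \<in> S \<Longrightarrow> Q p = P p"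
  shows "loc_const X S Q"
proof (rule loc_constI)
  fix p assume p: "p \<in> S"
  obtain N b where "openin X N" "p \<in> N" "\<forall>q\<in>N \<inter> S. P q = b"
    by (rule loc_constE[OF assms(1) p])
  then show "\<exists>N b. openin X N \<and> p \<in> N \<and> (\<forall>q\<in>N \<inter> S. Q q = b)"
    by (intro exI[of _ N] exI[of _ b]) (simp add: assms(2))
qed

lemma loc_const_xor:
  assumes "loc_const X S P" "loc_const X S Q"
  shows "loc_const X S (\<lambda>p. P p \<noteq> Q p)"
proof (rule loc_constI)
  fix p assume p: "p \<in> S"
  obtain N b where N: "openin X N" "p \<in> N" "\<forall>q\<in>N \<inter> S. P q = b"
    by (rule loc_constE[OF assms(1) p])
  obtain M c where M: "openin X M" "p \<in> M" "\<forall>q\<in>M \<inter> S. Q q = c"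
    by (rule loc_constE[OF assms(2) p])
  show "\<exists>N b. openin X N \<and> p \<in> N \<and> (\<forall>q\<in>N \<inter> S. (P q \<noteq> Q q) = b)"
    using N M by (intro exI[of _ "N \<inter> M"] exI[of _ "b \<noteq> c"]) (simp add: openin_Int)
qed

lemma loc_const_local:
  assumes "\<And>p. p \<in> S \<Longrightarrow> \<exists>W. openin X W \<and> p \<in> W \<and> loc_const X (S \<inter> W) P"
  shows "loc_const X S P"
proof (rule loc_constI)
  fix p assume p: "p \<in> S"
  obtain W where W: "openin X W" "p \<in> W" "loc_const X (S \<inter> W) P" using assms[OF p] by blast
  have "p \<in> S \<inter> W" using p W by simp
  then obtain N b where "openin X N" "p \<in> N" "\<forall>q\<in>N \<inter> (S \<inter> W). P q = b"
    by (rule loc_constE[OF W(3)])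
  then show "\<exists>N b. openin X N \<and> p \<in> N \<and> (\<forall>q\<in>N \<inter> S. P q = b)"
    using W by (intro exI[of _ "N \<inter> W"] exI[of _ b]) (simp add: openin_Int)
qed

lemma loc_const_vimage:
  assumes "loc_const X S P" "continuous_map Y X f" "T \<subseteq> topspace Y" "f ` T \<subseteq> S"
  shows "loc_const Y T (\<lambda>y. P (f y))"
proof (rule loc_constI)
  fix y assume y: "y \<in> T"
  have "f y \<in> S" using y assms(4) by auto
  then obtain N b where N: "openin X N" "f y \<in> N" "\<forall>q\<in>N \<inter> S. P q = b"
    by (rule loc_constE[OF assms(1)])
  have "openin Y {z \<in> topspace Y. f z \<in> N}" using assms(2) N(1) openin_continuous_map_preimage by blast
  then show "\<exists>M b. openin Y M \<and> y \<in> M \<and> (\<forall>z\<in>M \<inter> T. P (f z) = b)"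
    using N y assms(3,4) by (intro exI[of _ "{z \<in> topspace Y. f z \<in> N}"] exI[of _ b]) auto
qed

lemma loc_const_connected:
  assumes "connectedin X S" "loc_const X S P" "p \<in> S" "q \<in> S"
  shows "P p = P q"
proof (rule ccontr)
  assume ne: "P p \<noteq> P q"
  have "\<forall>x\<in>S. \<exists>N b. openin X N \<and> x \<in> N \<and> (\<forall>y\<in>N \<inter> S. P y = b)"
    using assms(2) by (simp add: loc_const_def)
  then obtain N b where N: "\<And>x. x \<in> S \<Longrightarrow> openin X (N x) \<and> x \<in> N x \<and> (\<forall>y\<in>N x \<inter> S. P y = b x)"
    by metis
  have b: "P x = b x" if "x \<in> S" for x using N[OF that] that by blast
  let ?A = "\<Union>x\<in>{x\<in>S. P x}. N x" and ?B = "\<Union>x\<in>{x\<in>S. \<not> P x}. N x"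
  have op: "openin X ?A" "openin X ?B" using N by (blast intro: openin_Union)+
  have cov: "S \<subseteq> ?A \<union> ?B" using N by blast
  have dis: "?A \<inter> ?B \<inter> S = {}"
  proof safe
    fix y a c assume *: "y \<in> S" "y \<in> N a" "a \<in> S" "P a" "y \<in> N c" "c \<in> S" "\<not> P c"
    have "P y = b a" "P y = b c" using N * by blast+
    then show "y \<in> {}" using b[of a] b[of c] * by simp
  qed
  have "x \<in> ?A" if "x \<in> S" "P x" for x using N[OF that(1)] that by blast
  moreover have "x \<in> ?B" if "x \<in> S" "\<not> P x" for x using N[OF that(1)] that by blast
  ultimately have "?A \<inter> S \<noteq> {}" "?B \<inter> S \<noteq> {}"
    using assms(3,4) ne by (cases "P p"; auto)+
  then show False using op cov dis assms(1) unfolding connectedin by blast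
qed

text \<open>A double cover is given by trivialisations over the sets \<open>U i\<close>: the predicate \<open>g i\<close> selects one
  of the two sheets over each point of \<open>U i\<close>, and the selections over two of these sets need to agree or
  to differ locally constantly. The individual \<open>g i\<close> may be discontinuous, since all of them are
  measured against an arbitrary labelling of the sheets by truth values.\<close>

locale double_cover =
  fixes X :: "'a topology" and I :: "'i set" and U :: "'i \<Rightarrow> 'a set" and g :: "'i \<Rightarrow> 'a \<Rightarrow> bool"
  assumes open_U: "\<And>i. i \<in> I \<Longrightarrow> openin X (U i)"
    and cover: "topspace X \<subseteq> (\<Union>i\<in>I. U i)"
    and compat: "\<And>i j. i \<in> I \<Longrightarrow> j \<in> I \<Longrightarrow> loc_const X (U i \<inter> U j) (\<lambda>p. g i p \<noteq> g j p)"
begin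

section \<open>Sections of double covers and their behaviour under homotopy\<close>

text \<open>A lift of \<open>f\<close> to the double cover: \<open>\<sigma> y\<close> names a sheet
  over \<open>f y\<close>, and continuity means that the comparison with each trivialisation is
  locally constant. \<open>section_on\<close> is the case of an inclusion.\<close>

definition section_along :: "'b topology \<Rightarrow> ('b \<Rightarrow> 'a) \<Rightarrow> ('b \<Rightarrow> bool) \<Rightarrow> bool" where
  "section_along Y f \<sigma> \<longleftrightarrow>
     (\<forall>i\<in>I. loc_const Y {y \<in> topspace Y. f y \<in> U i} (\<lambda>y. \<sigma> y \<noteq> g i (f y)))"

definition section_on :: "'a set \<Rightarrow> ('a \<Rightarrow> bool) \<Rightarrow> bool" where
  "section_on S \<sigma> \<longleftrightarrow> (\<forall>i\<in>I. loc_const X (S \<inter> U i) (\<lambda>p. \<sigma> p \<noteq> g i p))"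

lemma section_on_subset: "section_on S \<sigma> \<Longrightarrow> T \<subseteq> S \<Longrightarrow> section_on T \<sigma>"
  unfolding section_on_def by (meson Int_mono loc_const_subset order_refl)

lemma section_on_not: "section_on S \<sigma> \<Longrightarrow> section_on S (\<lambda>p. \<not> \<sigma> p)"
  unfolding section_on_def
proof
  fix i assume "\<forall>i\<in>I. loc_const X (S \<inter> U i) (\<lambda>p. \<sigma> p \<noteq> g i p)" "i \<in> I"
  then have "loc_const X (S \<inter> U i) (\<lambda>p. \<sigma> p \<noteq> g i p)" by simp
  moreover have "loc_const X (S \<inter> U i) (\<lambda>_. True)"
    unfolding loc_const_def by (metis openin_topspace open_U[OF \<open>i \<in> I\<close>] openin_subset IntD2 subsetD)
  ultimately have "loc_const X (S \<inter> U i) (\<lambda>p. (\<sigma> p \<noteq> g i p) \<noteq> True)" by (rule loc_const_xor)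
  then show "loc_const X (S \<inter> U i) (\<lambda>p. (\<not> \<sigma> p) \<noteq> g i p)" by (rule loc_const_transfer) auto
qed

text \<open>In the comparison of two sections the \<open>g i\<close> cancel, so their difference is
  locally constant. Over a connected set they agree everywhere or nowhere.\<close>

lemma section_on_unique:
  assumes "connectedin X S" "section_on S \<sigma>" "section_on S \<tau>" "p \<in> S" "q \<in> S"
  shows "(\<sigma> p = \<tau> p) = (\<sigma> q = \<tau> q)"
proof -
  have "loc_const X S (\<lambda>p. \<sigma> p \<noteq> \<tau> p)"
  proof (rule loc_const_local)
    fix p assume "p \<in> S"
    then have "p \<in> topspace X" using assms(1) connectedin_subset_topspace by blast
    then obtain i where i: "i \<in> I" "p \<in> U i" using cover by auto
    have "loc_const X (S \<inter> U i) (\<lambda>p. (\<sigma> p \<noteq> g i p) \<noteq> (\<tau> p \<noteq> g i p))"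
      by (rule loc_const_xor) (use assms i in \<open>auto simp: section_on_def\<close>)
    then have "loc_const X (S \<inter> U i) (\<lambda>p. \<sigma> p \<noteq> \<tau> p)"
      by (rule loc_const_transfer) auto
    then show "\<exists>W. openin X W \<and> p \<in> W \<and> loc_const X (S \<inter> W) (\<lambda>p. \<sigma> p \<noteq> \<tau> p)"
      using i open_U by blast
  qed
  from loc_const_connected[OF assms(1) this assms(4,5)] show ?thesis by auto
qed

text \<open>An embedding has a continuous inverse on its image, along which the labels are
  transported; without injectivity a point could receive two of them.\<close>

lemma section_along_imp_section_on:
  assumes e: "embedding_map Y X h" and s: "section_along Y h \<sigma>"
  shows "\<exists>\<tau>. section_on (h ` topspace Y) \<tau>"
proof -
  let ?S = "h ` topspace Y"
  obtain k where k: "homeomorphic_maps Y (subtopology X ?S) h k"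
    using e unfolding embedding_map_def homeomorphic_map_maps by blast
  have kc: "continuous_map (subtopology X ?S) Y k" and kh: "\<And>y. y \<in> topspace Y \<Longrightarrow> k (h y) = y"
    and hk: "\<And>p. p \<in> ?S \<Longrightarrow> h (k p) = p"
    and sub: "?S \<subseteq> topspace X"
    using k unfolding homeomorphic_maps_def
    by (auto simp: topspace_subtopology continuous_map_in_subtopology continuous_map_def)
  have "section_on ?S (\<sigma> \<circ> k)"
    unfolding section_on_def
  proof
    fix i assume i: "i \<in> I"
    have "loc_const (subtopology X ?S) (?S \<inter> U i) (\<lambda>p. \<sigma> (k p) \<noteq> g i (h (k p)))"
      by (rule loc_const_vimage[OF _ kc, of "{y \<in> topspace Y. h y \<in> U i}"])
        (use s i sub kh in \<open>auto simp: section_along_def\<close>)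
    then have *: "loc_const (subtopology X ?S) (?S \<inter> U i) (\<lambda>p. (\<sigma> \<circ> k) p \<noteq> g i p)"
      by (rule loc_const_transfer) (auto simp: hk)
    show "loc_const X (?S \<inter> U i) (\<lambda>p. (\<sigma> \<circ> k) p \<noteq> g i p)"
    proof (rule loc_constI)
      fix p assume p: "p \<in> ?S \<inter> U i"
      obtain N b where N: "openin (subtopology X ?S) N" "p \<in> N"
        "\<forall>q\<in>N \<inter> (?S \<inter> U i). ((\<sigma> \<circ> k) q \<noteq> g i q) = b"
        by (rule loc_constE[OF * p])
      then obtain M where "openin X M" "N = M \<inter> ?S" unfolding openin_subtopology by blast
      then show "\<exists>N b. openin X N \<and> p \<in> N \<and> (\<forall>q\<in>N \<inter> (?S \<inter> U i). ((\<sigma> \<circ> k) q \<noteq> g i q) = b)"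
        using N by (intro exI[of _ M] exI[of _ b]) auto
    qed
  qed
  then show ?thesis by blast
qed

text \<open>A tube lemma: around each \<open>(t0, y)\<close> some product neighbourhood is mapped
  into a single \<open>U i\<close>, and compactness of \<open>Y\<close> yields one time interval for
  all \<open>y\<close>.\<close>

lemma homotopy_lifting_local:
  assumes Y: "compact_space Y" and h: "continuous_map (prod_topology (top_of_set {0..1::real}) Y) X h"
    and t0: "t0 \<in> {0..1}"
  shows "\<exists>W. openin (top_of_set {0..1}) W \<and> t0 \<in> W \<and> connected W \<and>
    (\<forall>y\<in>topspace Y. \<exists>i\<in>I. \<exists>N. openin Y N \<and> y \<in> N \<and> (\<forall>t\<in>W. \<forall>z\<in>N. h (t, z) \<in> U i))"
proof -
  have "\<exists>i\<in>I. \<exists>e>0. \<exists>N. openin Y N \<and> y \<in> N \<and> (\<forall>t\<in>ball t0 e \<inter> {0..1}. \<forall>z\<in>N. h (t, z) \<in> U i)"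
    if y: "y \<in> topspace Y" for y
  proof -
    have "h (t0, y) \<in> topspace X" using h y t0 by (auto simp: continuous_map_def)
    then obtain i where i: "i \<in> I" "h (t0, y) \<in> U i" using cover by auto
    have "openin (prod_topology (top_of_set {0..1}) Y)
      {p \<in> topspace (prod_topology (top_of_set {0..1}) Y). h p \<in> U i}"
      using openin_continuous_map_preimage[OF h open_U[OF i(1)]] .
    moreover have "(t0, y) \<in> {p \<in> topspace (prod_topology (top_of_set {0..1}) Y). h p \<in> U i}"
      using i y t0 by auto
    ultimately have "\<exists>A N. openin (top_of_set {0..1}) A \<and> openin Y N \<and> t0 \<in> A \<and> y \<in> N \<and>
      A \<times> N \<subseteq> {p \<in> topspace (prod_topology (top_of_set {0..1}) Y). h p \<in> U i}"
      unfolding openin_prod_topology_alt by simp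
    then obtain A N where AN: "openin (top_of_set {0..1}) A" "openin Y N" "t0 \<in> A" "y \<in> N"
      "A \<times> N \<subseteq> {p \<in> topspace (prod_topology (top_of_set {0..1}) Y). h p \<in> U i}"
      by blast
    then obtain e where "e > 0" "ball t0 e \<inter> {0..1} \<subseteq> A"
      unfolding openin_contains_ball by blast
    then show ?thesis using i AN by blast
  qed
  then obtain i e N where iN: "\<And>y. y \<in> topspace Y \<Longrightarrow> i y \<in> I \<and> e y > 0 \<and> openin Y (N y) \<and> y \<in> N y \<and>
      (\<forall>t\<in>ball t0 (e y) \<inter> {0..1}. \<forall>z\<in>N y. h (t, z) \<in> U (i y))"
    by metis
  have "\<forall>S\<in>N ` topspace Y. openin Y S" "topspace Y \<subseteq> \<Union>(N ` topspace Y)"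
    using iN by blast+
  then obtain F where F: "finite F" "F \<subseteq> N ` topspace Y" "topspace Y \<subseteq> \<Union>F"
    using Y[unfolded compact_space_alt, rule_format, of "N ` topspace Y"] by blast
  then obtain K where K: "finite K" "K \<subseteq> topspace Y" "F = N ` K"
    by (meson finite_subset_image)
  \<comment> \<open>The entry 1 keeps the minimum defined when \<open>Y\<close> is empty.\<close>
  define d where "d = Min (insert 1 (e ` K))"
  have d: "d > 0" "\<And>y. y \<in> K \<Longrightarrow> d \<le> e y" using K iN by (auto simp: d_def)
  let ?W = "ball t0 d \<inter> {0..1}"
  have "connected ?W" by (intro convex_connected convex_Int) auto
  moreover have "openin (top_of_set {0..1}) ?W"
    by (subst Int_commute) (intro openin_open_Int open_ball)
  moreover have "\<exists>i\<in>I. \<exists>N. openin Y N \<and> y \<in> N \<and> (\<forall>t\<in>?W. \<forall>z\<in>N. h (t, z) \<in> U i)"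
    if "y \<in> topspace Y" for y
  proof -
    have "topspace Y \<subseteq> (\<Union>x\<in>K. N x)" using F(3) K(3) by simp
    then obtain x where x: "x \<in> K" "y \<in> N x" using \<open>y \<in> topspace Y\<close> by auto
    then have "x \<in> topspace Y" using K by auto
    note iNx = iN[OF this]
    have "?W \<subseteq> ball t0 (e x) \<inter> {0..1}" using d(2)[OF x(1)] by auto
    then have "\<forall>t\<in>?W. \<forall>z\<in>N x. h (t, z) \<in> U (i x)" using iNx by blast
    then show ?thesis using iNx x by (intro bexI[of _ "i x"] exI[of _ "N x"] conjI) simp_all
  qed
  ultimately show ?thesis using d(1) t0
    by (intro exI[of _ ?W]) auto
qed

text \<open>Only the existence of sections is transported, not a lift of the whole homotopy. Within
  a time interval from \<open>homotopy_lifting_local\<close> a section at one time yields a section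
  at any other, so existence is a locally constant property of time, and \<open>{0..1}\<close> is
  connected.\<close>

lemma homotopy_section:
  assumes Y: "compact_space Y" and h: "homotopic_with (\<lambda>_. True) Y X f f'"
    and s: "section_along Y f \<sigma>"
  shows "\<exists>\<sigma>. section_along Y f' \<sigma>"
proof -
  obtain h where h: "continuous_map (prod_topology (top_of_set {0..1::real}) Y) X h"
    "\<And>y. h (0, y) = f y" "\<And>y. h (1, y) = f' y"
    using h unfolding homotopic_with_def by blast
  define R where "R t t' \<longleftrightarrow> ((\<exists>\<sigma>. section_along Y (\<lambda>y. h (t, y)) \<sigma>) \<longleftrightarrow> (\<exists>\<sigma>. section_along Y (\<lambda>y. h (t', y)) \<sigma>))"
    for t t' :: real
  have cY: "continuous_map Y X (\<lambda>y. h (t, y))" if "t \<in> {0..1}" for t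
    using that by (intro continuous_map_compose[OF _ h(1), unfolded o_def])
      (auto intro!: continuous_map_pairedI)
  have ct: "continuous_map (top_of_set {0..1}) X (\<lambda>t. h (t, y))" if "y \<in> topspace Y" for y
    using that by (intro continuous_map_compose[OF _ h(1), unfolded o_def])
      (auto intro!: continuous_map_pairedI)
  have half: "\<exists>\<sigma>. section_along Y (\<lambda>y. h (t', y)) \<sigma>"
    if W: "W \<subseteq> {0..1}" "connected W"
      "\<forall>y\<in>topspace Y. \<exists>i\<in>I. \<exists>N. openin Y N \<and> y \<in> N \<and> (\<forall>t\<in>W. \<forall>z\<in>N. h (t, z) \<in> U i)"
      and t: "t \<in> W" "t' \<in> W" and \<sigma>: "section_along Y (\<lambda>y. h (t, y)) \<sigma>" for W t t' \<sigma>
  proof -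
    obtain i N where iN: "\<And>y. y \<in> topspace Y \<Longrightarrow> i y \<in> I \<and> openin Y (N y) \<and> y \<in> N y \<and>
        (\<forall>t\<in>W. \<forall>z\<in>N y. h (t, z) \<in> U (i y))"
      using W(3) by metis
    \<comment> \<open>The position relative to the trivialisation \<open>i y\<close> is kept while
      the time moves from \<open>t\<close> to \<open>t'\<close>. By \<open>\<sigma>'_eq\<close> any
      other trivialisation around the whole path gives the same label, as transition functions are
      constant on the connected set \<open>W\<close>.\<close>
    define \<sigma>' where "\<sigma>' y \<longleftrightarrow> (\<sigma> y \<noteq> g (i y) (h (t, y))) \<noteq> g (i y) (h (t', y))" for y
    have \<sigma>'_eq: "\<sigma>' y \<longleftrightarrow> (\<sigma> y \<noteq> g j (h (t, y))) \<noteq> g j (h (t', y))"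
      if y: "y \<in> topspace Y" and j: "j \<in> I" "\<forall>t\<in>W. h (t, y) \<in> U j" for y j
    proof -
      have "loc_const (top_of_set {0..1}) W (\<lambda>t. g (i y) (h (t, y)) \<noteq> g j (h (t, y)))"
        by (rule loc_const_vimage[OF compat[of "i y" j] ct[OF y]]) (use W y j iN[OF y] in auto)
      moreover have "connectedin (top_of_set {0..1}) W"
        using W by (simp add: connectedin_subtopology)
      ultimately have "(g (i y) (h (t, y)) \<noteq> g j (h (t, y))) = (g (i y) (h (t', y)) \<noteq> g j (h (t', y)))"
        by (intro loc_const_connected[OF _ _ t])
      then show ?thesis unfolding \<sigma>'_def by auto
    qed
    have "section_along Y (\<lambda>y. h (t', y)) \<sigma>'"
      unfolding section_along_def
    proof
      fix j assume j: "j \<in> I"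
      let ?T = "{y \<in> topspace Y. h (t', y) \<in> U j}"
      show "loc_const Y ?T (\<lambda>y. \<sigma>' y \<noteq> g j (h (t', y)))"
      proof (rule loc_const_local)
        fix y assume "y \<in> ?T"
        then have y: "y \<in> topspace Y" by simp
        let ?i = "i y"
        have NT: "N y \<subseteq> topspace Y" using iN[OF y] openin_subset by blast
        have 1: "loc_const Y (?T \<inter> N y) (\<lambda>z. \<sigma> z \<noteq> g ?i (h (t, z)))"
          using \<sigma> iN[OF y] t unfolding section_along_def by (auto elim!: loc_const_subset)
        have 2: "loc_const Y (?T \<inter> N y) (\<lambda>z. g ?i (h (t', z)) \<noteq> g j (h (t', z)))"
          by (rule loc_const_vimage[OF compat[of ?i j] cY]) (use W t j iN[OF y] in auto)
        have "loc_const Y (?T \<inter> N y) (\<lambda>z. \<sigma>' z \<noteq> g j (h (t', z)))"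
          using loc_const_xor[OF 1 2]
          by (rule loc_const_transfer) (use \<sigma>'_eq[of _ ?i] iN[OF y] NT in auto)
        then show "\<exists>M. openin Y M \<and> y \<in> M \<and> loc_const Y (?T \<inter> M) (\<lambda>y. \<sigma>' y \<noteq> g j (h (t', y)))"
          using iN[OF y] by blast
      qed
    qed
    then show ?thesis by blast
  qed
  have "R 0 1"
  proof (rule connected_equivalence_relation[of "{0..1::real}"])
    fix t0 :: real assume t0: "t0 \<in> {0..1}"
    obtain W where W: "openin (top_of_set {0..1}) W" "t0 \<in> W" "connected W"
      "\<forall>y\<in>topspace Y. \<exists>i\<in>I. \<exists>N. openin Y N \<and> y \<in> N \<and> (\<forall>t\<in>W. \<forall>z\<in>N. h (t, z) \<in> U i)"
      using homotopy_lifting_local[OF Y h(1) t0] by blast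
    have "W \<subseteq> {0..1}" using W(1) openin_imp_subset by blast
    then have "\<forall>x\<in>W. R t0 x" using half[OF _ W(3,4)] W(2) unfolding R_def by blast
    then show "\<exists>T. openin (top_of_set {0..1}) T \<and> t0 \<in> T \<and> (\<forall>x\<in>T. R t0 x)" using W by blast
  qed (auto simp: R_def)
  then show ?thesis using s h(2,3) unfolding R_def by auto
qed

text \<open>Along a constant map any constant label is a section, and a null-homotopy carries it to
  \<open>h\<close>. This serves both for closed faces and for contractible cycles.\<close>

lemma ex_section_on_image:
  assumes "compact_space Y" "embedding_map Y X h" "homotopic_with (\<lambda>_. True) Y X h (\<lambda>_. a)"
  shows "\<exists>\<tau>. section_on (h ` topspace Y) \<tau>"
proof -
  have "section_along Y (\<lambda>_. a) (\<lambda>_. False)"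
    unfolding section_along_def loc_const_def by auto
  then show ?thesis
    using homotopy_section[OF assms(1) homotopic_with_symD[OF assms(3)]]
      section_along_imp_section_on[OF assms(2)] by blast
qed

end

section \<open>Local structure of surfaces\<close>

lemma chart:
  assumes "surface X" "x \<in> topspace X"
  obtains U e k where "openin X U" "x \<in> U"
    "homeomorphic_maps (subtopology X U) (euclidean :: complex topology) e k"
  using assms unfolding surface_def homeomorphic_space_def by blast

lemma chart_ball:
  assumes X: "surface X" and N: "openin X N" "x \<in> N"
  obtains c :: "complex \<Rightarrow> 'a" and w :: complex and e :: real
  where "e > 0" "continuous_map (top_of_set (ball w e)) X c" "inj_on c (ball w e)" "c w = x"
    "c ` ball w e \<subseteq> N" "openin X (c ` ball w e)"
proof -
  obtain U d k where U: "openin X U" "x \<in> U"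
    "homeomorphic_maps (subtopology X U) (euclidean :: complex topology) d k"
    using chart[OF X] N openin_subset by (metis subsetD)
  have UX: "topspace (subtopology X U) = U" using openin_subset[OF U(1)] by auto
  have k: "continuous_map euclidean (subtopology X U) k" "\<And>z. d (k z) = z" "\<And>p. p \<in> U \<Longrightarrow> k (d p) = p"
    "\<And>z. k z \<in> U"
    using U(3) UX unfolding homeomorphic_maps_def by (auto simp: continuous_map_def)
  have kX: "continuous_map euclidean X k" using k(1) by (simp add: continuous_map_in_subtopology)
  have "open {z. k z \<in> N}"
    using openin_continuous_map_preimage[OF kX N(1)] by simp
  moreover have "d x \<in> {z. k z \<in> N}" using U N k by simp
  ultimately obtain e where e: "e > 0" "ball (d x) e \<subseteq> {z. k z \<in> N}"
    using open_contains_ball by blast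
  have hk: "homeomorphic_map euclidean (subtopology X U) k"
    using U(3) homeomorphic_map_maps homeomorphic_maps_sym by blast
  have "openin (subtopology X U) (k ` ball (d x) e)"
    using homeomorphic_imp_open_map[OF hk] unfolding open_map_def by simp
  then have "openin X (k ` ball (d x) e)" using U(1) openin_trans_full by blast
  moreover have "continuous_map (top_of_set (ball (d x) e)) X k"
    using kX continuous_map_from_subtopology by blast
  moreover have "inj_on k (ball (d x) e)" by (metis inj_onI k(2))
  ultimately show thesis using that[of e "d x" k] e U k by auto
qed

text \<open>Read in a chart, \<open>G\<close> is an injective continuous map of a planar domain into
  the plane, so that the planar invariance of domain applies.\<close>

lemma invariance_of_domain_surface:
  fixes G :: "complex \<Rightarrow> 'a"
  assumes X: "surface X" and G: "continuous_map (top_of_set W) X G" "inj_on G W" and W: "open W"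
  shows "openin X (G ` W)"
proof (subst openin_subopen, safe)
  fix w assume w: "w \<in> W"
  then have "G w \<in> topspace X" using G by (auto simp: continuous_map_def)
  then obtain U d k where U: "openin X U" "G w \<in> U"
    "homeomorphic_maps (subtopology X U) (euclidean :: complex topology) d k"
    using chart[OF X] by metis
  have UX: "topspace (subtopology X U) = U" using openin_subset[OF U(1)] by auto
  have d: "continuous_map (subtopology X U) euclidean d" "\<And>p. p \<in> U \<Longrightarrow> k (d p) = p"
    using U(3) UX unfolding homeomorphic_maps_def by auto
  define W' where "W' = {z \<in> W. G z \<in> U}"
  have "openin (top_of_set W) W'"
    using openin_continuous_map_preimage[OF G(1) U(1)] by (simp add: W'_def)
  then have W': "open W'" "W' \<subseteq> W" using W openin_open_trans by (auto simp: W'_def)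
  have "G ` W' \<subseteq> U" by (auto simp: W'_def)
  then have "continuous_map (top_of_set W') (subtopology X U) G"
    using continuous_map_from_subtopology_mono[OF G(1) W'(2)]
    by (simp add: continuous_map_in_subtopology image_subset_iff_funcset)
  then have "continuous_map (top_of_set W') euclidean (d \<circ> G)" using continuous_map_compose d(1) by blast
  then have "continuous_on W' (d \<circ> G)" by simp
  moreover have "inj_on (d \<circ> G) W'"
  proof (rule inj_onI)
    fix a b assume ab: "a \<in> W'" "b \<in> W'" "(d \<circ> G) a = (d \<circ> G) b"
    then have "G a \<in> U" "G b \<in> U" by (auto simp: W'_def)
    then have k: "k (d (G a)) = G a" "k (d (G b)) = G b" using d(2) by simp_all
    have "d (G a) = d (G b)" using ab(3) by simp
    then have "k (d (G a)) = k (d (G b))" by (rule arg_cong)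
    then have "G a = G b" unfolding k .
    moreover have "a \<in> W" "b \<in> W" using ab W'(2) by auto
    ultimately show "a = b" by (rule inj_onD[OF G(2)])
  qed
  ultimately have "open ((d \<circ> G) ` W')" using invariance_of_domain W'(1) by blast
  moreover have "homeomorphic_map euclidean (subtopology X U) k"
    using U(3) homeomorphic_map_maps homeomorphic_maps_sym by blast
  then have "open_map euclidean (subtopology X U) k" by (rule homeomorphic_imp_open_map)
  ultimately have "openin (subtopology X U) (k ` (d \<circ> G) ` W')"
    unfolding open_map_def by simp
  moreover have "k ` (d \<circ> G) ` W' = G ` W'"
    using d(2) by (force simp: W'_def image_image)
  ultimately have "openin X (G ` W')" using U(1) openin_trans_full by metis
  then show "\<exists>T. openin X T \<and> G w \<in> T \<and> T \<subseteq> G ` W"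
    using w U W' by (intro exI[of _ "G ` W'"]) (auto simp: W'_def)
qed

lemma connectedin_punctured_ball:
  assumes "continuous_map (top_of_set (ball w e)) X c" "inj_on c (ball w e)" "e > 0"
  shows "connectedin X (c ` ball w e - {c (w :: complex)})"
proof -
  have "connected (ball w e - {w})"
    by (rule connected_punctured_ball) simp
  then have "connectedin (top_of_set (ball w e)) (ball w e - {w})"
    by (auto simp: connectedin_subtopology)
  then have "connectedin X (c ` (ball w e - {w}))"
    using assms(1) connectedin_continuous_map_image by blast
  moreover have "c ` (ball w e - {w}) = c ` ball w e - {c w}"
    using assms(2,3) by (auto dest: inj_onD)
  ultimately show ?thesis by simp
qed

section \<open>Incidences in a triangulated surface\<close>

locale triangulated_surface =
  fixes X :: "'a topology" and V :: "'v set" and E :: "'v set set"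
    and \<phi> :: "'v \<Rightarrow> 'a" and \<psi> :: "'v set \<Rightarrow> real \<Rightarrow> 'a"
  assumes surface: "surface X" and triangulation: "surface_triangulation X V E \<phi> \<psi>"
begin

definition arc where "arc e = \<psi> e ` {0..1}"
definition inner_arc where "inner_arc e = \<psi> e ` {0<..<1}"
definition Fs where "Fs = faces X V E \<phi> \<psi>"
text \<open>The closure determines the vertices without a choice of the bounding triangle, whose
  mere existence is given; \<open>face_structure\<close> identifies them with its corners.\<close>

definition vt where "vt F = {x \<in> V. \<phi> x \<in> X closure_of F}"

lemma Hausdorff: "Hausdorff_space X"
  using surface unfolding surface_def by auto

lemma embedded: "embedded_graph X V E \<phi> \<psi>"
  using triangulation unfolding surface_triangulation_def by simp

lemma finite_V: "finite V" and edge: "e \<in> E \<Longrightarrow> e \<subseteq> V \<and> card e = 2"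
  and inj_\<phi>: "inj_on \<phi> V" and \<phi>_in: "x \<in> V \<Longrightarrow> \<phi> x \<in> topspace X"
  and \<psi>_emb: "e \<in> E \<Longrightarrow> embedding_map (top_of_set {0..1}) X (\<psi> e)"
  and \<psi>_ends: "e \<in> E \<Longrightarrow> {\<psi> e 0, \<psi> e 1} = \<phi> ` e"
  and inner_V: "e \<in> E \<Longrightarrow> inner_arc e \<inter> \<phi> ` V = {}"
  and inner_disjoint: "e \<in> E \<Longrightarrow> e' \<in> E \<Longrightarrow> e \<noteq> e' \<Longrightarrow> inner_arc e \<inter> inner_arc e' = {}"
  using embedded unfolding embedded_graph_def finite_simple_graph_def inner_arc_def by auto

lemma finite_E: "finite E"
  using finite_V edge by (meson PowI finite_Pow_iff finite_subset subsetI)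

lemma \<psi>_cont: "e \<in> E \<Longrightarrow> continuous_map (top_of_set {0..1}) X (\<psi> e)"
  using \<psi>_emb unfolding embedding_map_def homeomorphic_eq_everything_map
  by (auto simp: continuous_map_in_subtopology)

lemma \<psi>_inj: "e \<in> E \<Longrightarrow> inj_on (\<psi> e) {0..1}"
  using \<psi>_emb unfolding embedding_map_def homeomorphic_eq_everything_map by auto

lemma arc_eq: "e \<in> E \<Longrightarrow> arc e = inner_arc e \<union> \<phi> ` e"
proof -
  assume "e \<in> E"
  have 01: "{0..1::real} = {0<..<1} \<union> {0, 1}" by auto
  show ?thesis unfolding arc_def inner_arc_def 01 image_Un using \<psi>_ends[OF \<open>e \<in> E\<close>] by simp
qed

lemma arc_closed: "e \<in> E \<Longrightarrow> closedin X (arc e)"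
  unfolding arc_def
  by (intro compactin_imp_closedin Hausdorff image_compactin[OF _ \<psi>_cont]) (auto simp: compactin_subtopology)

lemma arc_Int_arc:
  assumes "e \<in> E" "e' \<in> E" "e \<noteq> e'" shows "inner_arc e \<inter> arc e' = {}"
proof -
  have "\<phi> ` e' \<subseteq> \<phi> ` V" using edge[OF assms(2)] by auto
  then show ?thesis
    unfolding arc_eq[OF assms(2)] Int_Un_distrib inner_disjoint[OF assms]
    using inner_V[OF assms(1)] by blast
qed

lemma drawn_E: "drawn_edges \<psi> S = (\<Union>e\<in>S. arc e)"
  unfolding drawn_edges_def arc_def ..

lemma face_off_graph:
  assumes "F \<in> Fs" shows "F \<subseteq> topspace X" "F \<inter> \<phi> ` V = {}" "e \<in> E \<Longrightarrow> F \<inter> arc e = {}"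
proof -
  have "F \<subseteq> topspace X - (\<phi> ` V \<union> (\<Union>e\<in>E. arc e))"
    using connected_components_of_subset[OF assms[unfolded Fs_def faces_def]]
    by (simp add: topspace_subtopology drawn_E)
  then show "F \<subseteq> topspace X" "F \<inter> \<phi> ` V = {}" "e \<in> E \<Longrightarrow> F \<inter> arc e = {}" by blast+
qed

lemma faces_disjoint: "F \<in> Fs \<Longrightarrow> F' \<in> Fs \<Longrightarrow> F \<noteq> F' \<Longrightarrow> F \<inter> F' = {}"
  unfolding Fs_def faces_def
  using pairwise_disjoint_connected_components_of by (metis pairwiseD disjnt_def)

lemma Union_faces: "topspace X \<subseteq> \<Union>Fs \<union> \<phi> ` V \<union> (\<Union>e\<in>E. arc e)"
  unfolding Fs_def faces_def using Union_connected_components_of[of "subtopology X (topspace X - (\<phi> ` V \<union> drawn_edges \<psi> E))"]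
  by (auto simp: topspace_subtopology drawn_E)

definition disc where
  "disc F h \<longleftrightarrow> embedding_map (top_of_set (cball (0::complex) 1)) X h \<and> h ` ball 0 1 = F \<and>
     h ` sphere 0 1 = (\<Union>e\<in>{e \<in> E. e \<subseteq> vt F}. arc e) \<and> X closure_of F = h ` cball 0 1"

lemma cball_split: "cball (0::complex) 1 = ball 0 1 \<union> sphere 0 1"
  by auto

lemma embedding_disc_continuous:
  "embedding_map (top_of_set (cball (0::complex) 1)) X h \<Longrightarrow> continuous_map (top_of_set (cball 0 1)) X h"
  "embedding_map (top_of_set (cball (0::complex) 1)) X h \<Longrightarrow> inj_on h (cball 0 1)"
  unfolding embedding_map_def homeomorphic_eq_everything_map
  by (auto simp: continuous_map_in_subtopology)

text \<open>A vertex in the closure of a face lies on the image of the boundary circle, hence on the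
  bounding triangle; the open arcs contain no vertex, so it is a corner.\<close>

lemma face_structure:
  assumes F: "F \<in> Fs"
  shows "\<exists>a b c h. vt F = {a, b, c} \<and> a \<noteq> b \<and> a \<noteq> c \<and> b \<noteq> c \<and> {a, b} \<in> E \<and> {a, c} \<in> E \<and> {b, c} \<in> E \<and>
    disc F h"
proof -
  have "bounded_by_triangle X V E \<psi> F"
    using F triangulation unfolding surface_triangulation_def Fs_def by simp
  then obtain vs h where vs: "graph_cycle V E vs" "length vs = 3"
    and h: "embedding_map (top_of_set (cball (0::complex) 1)) X h" "h ` ball 0 1 = F"
      "h ` sphere 0 1 = drawn_edges \<psi> (cycle_edges vs)"
    unfolding bounded_by_triangle_def by blast
  obtain a b c where abc: "vs = [a, b, c]"
    using vs(2) by (auto simp: numeral_3_eq_3 length_Suc_conv)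
  have ne: "a \<noteq> b" "a \<noteq> c" "b \<noteq> c" and V: "a \<in> V" "b \<in> V" "c \<in> V"
    using vs(1) unfolding abc graph_cycle_def by auto
  have "{i. i < length vs} = {0, 1, 2}" unfolding abc by auto
  then have ce: "cycle_edges vs = {{a, b}, {b, c}, {c, a}}"
  proof -
    have "cycle_edges vs = (\<lambda>i. {vs ! i, vs ! (Suc i mod length vs)}) ` {0, 1, 2}"
      unfolding cycle_edges_def \<open>{i. i < length vs} = {0, 1, 2}\<close>[symmetric] by blast
    then show ?thesis unfolding abc by (simp add: numeral_2_eq_2)
  qed
  have E: "{a, b} \<in> E" "{b, c} \<in> E" "{a, c} \<in> E"
    using vs(1) ce unfolding graph_cycle_def by (auto simp: insert_commute)
  have hs: "h ` sphere 0 1 = arc {a, b} \<union> arc {b, c} \<union> arc {a, c}"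
    unfolding h(3) ce drawn_E by (auto simp: insert_commute)
  note hc = embedding_disc_continuous[OF h(1)]
  have cl: "X closure_of F = h ` cball 0 1"
  proof
    have "closedin X (h ` cball 0 1)"
      by (intro compactin_imp_closedin Hausdorff image_compactin[OF _ hc(1)]) (auto simp: compactin_subtopology)
    moreover have "F \<subseteq> h ` cball 0 1" using h(2) by auto
    ultimately show "X closure_of F \<subseteq> h ` cball 0 1" by (simp add: closure_of_minimal)
    have "h ` (top_of_set (cball 0 1) closure_of ball 0 1) \<subseteq> X closure_of (h ` ball 0 1)"
      using hc(1) continuous_map_image_closure_subset by blast
    moreover have "top_of_set (cball 0 1) closure_of ball (0::complex) 1 = cball 0 1"
      by (simp add: closure_of_subtopology Int_absorb1 Int_absorb2)
    ultimately show "h ` cball 0 1 \<subseteq> X closure_of F" using h(2) by simp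
  qed
  have vt: "vt F = {a, b, c}"
  proof -
    have "\<phi> x \<in> X closure_of F \<longleftrightarrow> x \<in> {a, b, c}" if x: "x \<in> V" for x
    proof -
      have "\<phi> x \<notin> F" using face_off_graph(2)[OF F] x by auto
      then have "\<phi> x \<in> X closure_of F \<longleftrightarrow> \<phi> x \<in> h ` sphere 0 1"
        unfolding cl cball_split image_Un h(2) by simp
      also have "\<dots> \<longleftrightarrow> \<phi> x \<in> \<phi> ` {a, b, c}"
        unfolding hs arc_eq[OF E(1)] arc_eq[OF E(2)] arc_eq[OF E(3)]
        using inner_V[OF E(1)] inner_V[OF E(2)] inner_V[OF E(3)] x by auto
      also have "\<dots> \<longleftrightarrow> x \<in> {a, b, c}" using inj_\<phi> x V by (auto dest: inj_onD)
      finally show ?thesis .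
    qed
    then show ?thesis using V unfolding vt_def by auto
  qed
  have "{e \<in> E. e \<subseteq> vt F} = {{a, b}, {b, c}, {a, c}}"
  proof (intro equalityI subsetI)
    fix e assume e: "e \<in> {e \<in> E. e \<subseteq> vt F}"
    then have "card e = 2" using edge by auto
    then obtain x y where "e = {x, y}" "x \<noteq> y" unfolding card_2_iff by auto
    then show "e \<in> {{a, b}, {b, c}, {a, c}}" using e unfolding vt by auto
  qed (use E vt in auto)
  then have "disc F h" unfolding disc_def using h hs cl by auto
  then show ?thesis using vt ne E by blast
qed

lemma face_disc: "F \<in> Fs \<Longrightarrow> \<exists>h. disc F h" using face_structure by blast

lemma card_face: "F \<in> Fs \<Longrightarrow> card (vt F) = 3"
  using face_structure[of F] by auto

lemma face_edge: "F \<in> Fs \<Longrightarrow> x \<in> vt F \<Longrightarrow> y \<in> vt F \<Longrightarrow> x \<noteq> y \<Longrightarrow> {x, y} \<in> E"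
  using face_structure[of F] by (auto simp: insert_commute)

lemma closure_face:
  assumes "F \<in> Fs" shows "X closure_of F = F \<union> (\<Union>e\<in>{e \<in> E. e \<subseteq> vt F}. arc e)"
proof -
  obtain h where "disc F h" using face_disc assms by blast
  then show ?thesis unfolding disc_def cball_split image_Un by auto
qed

lemma vt_V: "vt F \<subseteq> V" unfolding vt_def by auto

lemma vertex_closure_face: "x \<in> vt F \<Longrightarrow> \<phi> x \<in> X closure_of F" unfolding vt_def by auto

text \<open>The closure of a face adds only its three closed arcs, and an inner point of
  \<open>e\<close> lies on no other arc.\<close>

lemma inner_closure_face:
  assumes "F \<in> Fs" "e \<in> E" "p \<in> inner_arc e"
  shows "p \<in> X closure_of F \<longleftrightarrow> e \<subseteq> vt F"
proof -
  have "p \<in> arc e" using arc_eq assms by auto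
  then have "p \<notin> F" using face_off_graph(3) assms by blast
  moreover have "p \<notin> arc e'" if "e' \<in> E" "e' \<noteq> e" for e' using arc_Int_arc assms that by blast
  ultimately show ?thesis unfolding closure_face[OF assms(1)] using assms(2) \<open>p \<in> arc e\<close> by auto
qed

lemma edge_midpoint: "e \<in> E \<Longrightarrow> \<psi> e (1/2) \<in> inner_arc e"
  unfolding inner_arc_def by auto

text \<open>Shrinking the radius extends this parametrisation to a half-disc, so that two faces can be
  glued along an edge.\<close>

lemma boundary_parametrisation:
  assumes "disc F h" "F \<in> Fs" "e \<in> E" "e \<subseteq> vt F"
  shows "\<exists>\<tau>. continuous_on {0<..<1} \<tau> \<and> (\<forall>s\<in>{0<..<1}. norm (\<tau> s) = 1 \<and> h (\<tau> s) = \<psi> e s)"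
proof -
  have h: "embedding_map (top_of_set (cball (0::complex) 1)) X h" 
    and hs: "h ` sphere 0 1 = (\<Union>e\<in>{e \<in> E. e \<subseteq> vt F}. arc e)"
    using assms(1) unfolding disc_def by auto
  let ?C = "h ` cball 0 1"
  obtain k where k: "homeomorphic_maps (top_of_set (cball 0 1)) (subtopology X ?C) h k"
    using h unfolding embedding_map_def homeomorphic_map_maps by auto
  then have kc: "continuous_map (subtopology X ?C) (top_of_set (cball 0 1)) k"
    and kh: "\<And>z. z \<in> cball 0 1 \<Longrightarrow> k (h z) = z"
    unfolding homeomorphic_maps_def by auto
  have arc: "arc e \<subseteq> h ` sphere 0 1" unfolding hs using assms by auto
  then have sub: "\<psi> e s \<in> h ` sphere 0 1" if "s \<in> {0<..<1}" for s
    using that unfolding arc_def by auto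
  have "continuous_map (top_of_set {0<..<1}) X (\<psi> e)"
    by (rule continuous_map_from_subtopology_mono[OF \<psi>_cont[OF assms(3)]]) auto
  then have "continuous_map (top_of_set {0<..<1}) (subtopology X ?C) (\<psi> e)"
    using sub by (fastforce simp: continuous_map_in_subtopology)
  then have "continuous_map (top_of_set {0<..<1}) (top_of_set (cball 0 1)) (k \<circ> \<psi> e)"
    using kc continuous_map_compose by blast
  then have "continuous_on {0<..<1} (k \<circ> \<psi> e)" by (simp add: continuous_map_in_subtopology)
  moreover have "norm ((k \<circ> \<psi> e) s) = 1 \<and> h ((k \<circ> \<psi> e) s) = \<psi> e s" if "s \<in> {0<..<1}" for s
  proof -
    have "\<psi> e s \<in> h ` sphere 0 1" using sub[OF that] .
    then obtain z where "z \<in> sphere 0 1" "\<psi> e s = h z" by auto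
    then show ?thesis using kh[of z] by auto
  qed
  ultimately show ?thesis by blast
qed

section \<open>Every edge lies in exactly two faces\<close>

text \<open>Half-discs in the two faces are glued along \<open>e\<close> to an injective continuous
  map \<open>G\<close> of an open rectangle, and invariance of domain makes its image open in the
  surface.\<close>

lemma two_faces_neighbourhood:
  assumes F: "F1 \<in> Fs" "F2 \<in> Fs" "F1 \<noteq> F2" and e: "e \<in> E" "e \<subseteq> vt F1" "e \<subseteq> vt F2"
  shows "\<exists>N. openin X N \<and> \<psi> e (1/2) \<in> N \<and> N \<subseteq> F1 \<union> F2 \<union> inner_arc e"
proof -
  obtain h1 h2 where h: "disc F1 h1" "disc F2 h2" using face_disc F by metis
  obtain \<tau>1 where \<tau>1: "continuous_on {0<..<1} \<tau>1" "\<And>s. s \<in> {0<..<1} \<Longrightarrow> norm (\<tau>1 s) = 1 \<and> h1 (\<tau>1 s) = \<psi> e s"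
    using boundary_parametrisation[OF h(1) F(1) e(1,2)] by blast
  obtain \<tau>2 where \<tau>2: "continuous_on {0<..<1} \<tau>2" "\<And>s. s \<in> {0<..<1} \<Longrightarrow> norm (\<tau>2 s) = 1 \<and> h2 (\<tau>2 s) = \<psi> e s"
    using boundary_parametrisation[OF h(2) F(2) e(1,3)] by blast
  define W where "W = {z :: complex. 0 < Re z \<and> Re z < 1 \<and> - 1 < Im z \<and> Im z < 1}"
  have openW: "open W"
    unfolding W_def by (intro open_Collect_conj open_Collect_less continuous_intros)
  \<comment> \<open>Polar coordinates in the two discs: the boundary parameter is
    \<open>Re z\<close>, and the distance from the real axis is subtracted from the radius. The
    radius stays positive, so the centre is never reached and both coordinates can be
    recovered.\<close>
  define f1 where "f1 z = (1 - Im z) *\<^sub>R \<tau>1 (Re z)" for z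
  define f2 where "f2 z = (1 + Im z) *\<^sub>R \<tau>2 (Re z)" for z
  define G where "G z = (if 0 \<le> Im z then h1 (f1 z) else h2 (f2 z))" for z
  have cs: "continuous_on (W \<inter> S) f1" "continuous_on (W \<inter> S) f2" for S
    unfolding f1_def f2_def
    by (intro continuous_intros continuous_on_compose2[OF \<tau>1(1)] continuous_on_compose2[OF \<tau>2(1)];
        auto simp: W_def)+
  have n1: "norm (f1 z) = 1 - Im z" "norm (f2 z) = 1 + Im z" if "z \<in> W" for z
    using that \<tau>1(2)[of "Re z"] \<tau>2(2)[of "Re z"] by (auto simp: f1_def f2_def W_def)
  have hc: "continuous_map (top_of_set (cball 0 1)) X h1" "inj_on h1 (cball 0 1)" "h1 ` ball 0 1 = F1"
    "continuous_map (top_of_set (cball 0 1)) X h2" "inj_on h2 (cball 0 1)" "h2 ` ball 0 1 = F2"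
    using h embedding_disc_continuous unfolding disc_def by auto
  have inF1: "h1 (f1 z) \<in> F1" if "z \<in> W" "0 < Im z" for z
    using n1(1)[OF that(1)] that hc(3) by (auto simp: image_iff)
  have inF2: "h2 (f2 z) \<in> F2" if "z \<in> W" "Im z < 0" for z
    using n1(2)[OF that(1)] that hc(6) by (auto simp: image_iff)
  have on0: "h1 (f1 z) = \<psi> e (Re z)" "h2 (f2 z) = \<psi> e (Re z)" if "z \<in> W" "Im z = 0" for z
    using that \<tau>1(2)[of "Re z"] \<tau>2(2)[of "Re z"] by (auto simp: f1_def f2_def W_def)
  have c1: "continuous_map (top_of_set (W \<inter> {z. 0 \<le> Im z})) X (h1 \<circ> f1)"
    by (rule continuous_map_compose[OF _ hc(1)]) (use cs n1 in \<open>auto simp: continuous_map_in_subtopology\<close>)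
  have c2: "continuous_map (top_of_set (W \<inter> {z. Im z \<le> 0})) X (h2 \<circ> f2)"
    by (rule continuous_map_compose[OF _ hc(4)]) (use cs n1 in \<open>auto simp: continuous_map_in_subtopology\<close>)
  have "continuous_map (top_of_set W) X G"
    unfolding G_def
  proof (rule continuous_map_cases_le)
    show "continuous_map (subtopology (top_of_set W) {z \<in> topspace (top_of_set W). 0 \<le> Im z}) X (\<lambda>z. h1 (f1 z))"
      using c1 by (simp add: subtopology_subtopology o_def Int_def conj_ac)
    show "continuous_map (subtopology (top_of_set W) {z \<in> topspace (top_of_set W). Im z \<le> 0}) X (\<lambda>z. h2 (f2 z))"
      using c2 by (simp add: subtopology_subtopology o_def Int_def conj_ac)
  qed (use on0 in \<open>auto intro: continuous_intros\<close>)
  moreover have inj: "inj_on G W"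
  proof (rule inj_onI)
    fix z w assume zw: "z \<in> W" "w \<in> W" "G z = G w"
    have re: "Re z \<in> {0<..<1}" "Re w \<in> {0<..<1}" using zw unfolding W_def by auto
    have inn: "\<psi> e (Re z) \<in> inner_arc e" "\<psi> e (Re w) \<in> inner_arc e"
      using re unfolding inner_arc_def by auto
    have dis: "F1 \<inter> F2 = {}" "F1 \<inter> inner_arc e = {}" "F2 \<inter> inner_arc e = {}"
      using faces_disjoint[OF F] face_off_graph(3)[OF F(1) e(1)] face_off_graph(3)[OF F(2) e(1)]
        arc_eq[OF e(1)] by auto
    have \<tau>_inj: "s = t" if "s \<in> {0<..<1}" "t \<in> {0<..<1}" "\<psi> e s = \<psi> e t" for s t
      using \<psi>_inj[OF e(1)] that by (auto dest: inj_onD)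
    have sc: "a = b \<and> s = t" if "(a :: real) *\<^sub>R \<tau> s = b *\<^sub>R \<tau> t" "0 < a" "0 < b"
      "\<And>s. s \<in> {0<..<1} \<Longrightarrow> norm (\<tau> s) = 1 \<and> h' (\<tau> s) = \<psi> e s" "s \<in> {0<..<1}" "t \<in> {0<..<1}"
      for a b s t and \<tau> :: "real \<Rightarrow> complex" and h' :: "complex \<Rightarrow> 'a"
    proof -
      have "norm (a *\<^sub>R \<tau> s) = norm (b *\<^sub>R \<tau> t)" using that(1) by simp
      moreover have "norm (\<tau> s) = 1" "norm (\<tau> t) = 1" using that(4-6) by blast+
      ultimately have "a = b" using that(2,3) by simp
      then have "\<tau> s = \<tau> t" using that by simp
      then show ?thesis using \<open>a = b\<close> that(4)[OF that(5)] that(4)[OF that(6)] \<tau>_inj that by metis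
    qed
    consider (pp) "0 < Im z" "0 < Im w" | (nn) "Im z < 0" "Im w < 0" | (00) "Im z = 0" "Im w = 0"
      | (d) "sgn (Im z) \<noteq> sgn (Im w)"
      by (cases "Im z" "0::real" rule: linorder_cases; cases "Im w" "0::real" rule: linorder_cases) auto
    then show "z = w"
    proof cases
      case pp
      then have "f1 z = f1 w"
        using zw n1 hc(2) by (auto simp: G_def dest!: inj_onD)
      then have "1 - Im z = 1 - Im w \<and> Re z = Re w"
        unfolding f1_def by (rule sc[OF _ _ _ \<tau>1(2)]) (use zw re in \<open>auto simp: W_def\<close>)
      then show ?thesis by (simp add: complex_eq_iff)
    next
      case nn
      then have "f2 z = f2 w"
        using zw n1 hc(5) by (auto simp: G_def dest!: inj_onD)
      then have "1 + Im z = 1 + Im w \<and> Re z = Re w"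
        unfolding f2_def by (rule sc[OF _ _ _ \<tau>2(2)]) (use zw re in \<open>auto simp: W_def\<close>)
      then show ?thesis by (simp add: complex_eq_iff)
    next
      case 00
      then have "Re z = Re w" using zw on0 re \<tau>_inj by (simp add: G_def)
      then show ?thesis using 00 by (simp add: complex_eq_iff)
    next
      case d
      have cls: "(0 < Im y \<and> G y \<in> F1) \<or> (Im y = 0 \<and> G y \<in> inner_arc e) \<or> (Im y < 0 \<and> G y \<in> F2)"
        if "y \<in> W" for y
      proof -
        have "\<psi> e (Re y) \<in> inner_arc e" using that by (auto simp: inner_arc_def W_def)
        then show ?thesis using inF1[OF that] inF2[OF that] on0[OF that]
          by (cases "Im y" "0::real" rule: linorder_cases) (auto simp: G_def)
      qed
      from cls[OF zw(1)] cls[OF zw(2)] dis zw(3) d show ?thesis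
        by (elim disjE conjE) (auto simp: sgn_if)
    qed
  qed
  ultimately have "openin X (G ` W)" using invariance_of_domain_surface[OF surface] openW by blast
  moreover have "\<psi> e (1/2) \<in> G ` W"
  proof
    show "Complex (1/2) 0 \<in> W" by (simp add: W_def)
    then show "\<psi> e (1/2) = G (Complex (1/2) 0)" using on0[of "Complex (1/2) 0"] by (simp add: G_def)
  qed
  moreover have "G ` W \<subseteq> F1 \<union> F2 \<union> inner_arc e"
  proof safe
    fix z assume z: "z \<in> W" "G z \<notin> inner_arc e" "G z \<notin> F2"
    have "\<psi> e (Re z) \<in> inner_arc e" using z by (auto simp: inner_arc_def W_def)
    then show "G z \<in> F1" using z inF1[OF z(1)] inF2[OF z(1)] on0[OF z(1)]
      by (cases "Im z" "0::real" rule: linorder_cases) (auto simp: G_def)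
  qed
  ultimately show ?thesis by blast
qed

text \<open>The midpoint of \<open>e\<close> is in the closure of a third face, which would have to
  enter the neighbourhood filled by the first two faces and the open arc.\<close>

lemma at_most_two_faces:
  assumes "F1 \<in> Fs" "F2 \<in> Fs" "F3 \<in> Fs" "e \<in> E" "e \<subseteq> vt F1" "e \<subseteq> vt F2" "e \<subseteq> vt F3"
    and "F1 \<noteq> F2"
  shows "F3 = F1 \<or> F3 = F2"
proof (rule ccontr)
  assume n: "\<not> ?thesis"
  obtain N where N: "openin X N" "\<psi> e (1/2) \<in> N" "N \<subseteq> F1 \<union> F2 \<union> inner_arc e"
    using two_faces_neighbourhood[OF assms(1,2,8,4,5,6)] by blast
  have "\<psi> e (1/2) \<in> X closure_of F3"
    using inner_closure_face[OF assms(3,4) edge_midpoint[OF assms(4)]] assms by blast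
  then have "N \<inter> F3 \<noteq> {}" using N unfolding in_closure_of by blast
  moreover have "F3 \<inter> inner_arc e = {}" using face_off_graph(3)[OF assms(3,4)] arc_eq[OF assms(4)] by auto
  ultimately show False using N(3) faces_disjoint[OF assms(1,3)] faces_disjoint[OF assms(2,3)] n by blast
qed

lemma faces_at_edge:
  assumes "e \<in> E" shows "finite {F \<in> Fs. e \<subseteq> vt F}" "card {F \<in> Fs. e \<subseteq> vt F} \<le> 2"
proof -
  have "\<exists>F G. {F \<in> Fs. e \<subseteq> vt F} \<subseteq> {F, G}"
  proof (cases "\<exists>F G. F \<in> Fs \<and> G \<in> Fs \<and> e \<subseteq> vt F \<and> e \<subseteq> vt G \<and> F \<noteq> G")
    case True
    then obtain F G where "F \<in> Fs" "G \<in> Fs" "e \<subseteq> vt F" "e \<subseteq> vt G" "F \<noteq> G" by blast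
    then have "{F \<in> Fs. e \<subseteq> vt F} \<subseteq> {F, G}" using at_most_two_faces[of F G _ e] assms by blast
    then show ?thesis by blast
  next
    case False
    then show ?thesis by (cases "{F \<in> Fs. e \<subseteq> vt F} = {}") blast+
  qed
  then obtain F G where *: "{F \<in> Fs. e \<subseteq> vt F} \<subseteq> {F, G}" by blast
  show "finite {F \<in> Fs. e \<subseteq> vt F}" by (rule finite_subset[OF *]) simp
  have "card {F \<in> Fs. e \<subseteq> vt F} \<le> card {F, G}" by (rule card_mono[OF _ *]) simp
  also have "\<dots> \<le> 2" by (simp add: card_insert_if)
  finally show "card {F \<in> Fs. e \<subseteq> vt F} \<le> 2" .
qed

lemma finite_Fs: "finite Fs"
proof (rule finite_subset)
  show "Fs \<subseteq> (\<Union>e\<in>E. {F \<in> Fs. e \<subseteq> vt F})"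
  proof
    fix F assume F: "F \<in> Fs"
    then obtain a b c where "vt F = {a, b, c}" "{a, b} \<in> E" using face_structure by metis
    then show "F \<in> (\<Union>e\<in>E. {F \<in> Fs. e \<subseteq> vt F})" using F by blast
  qed
  show "finite (\<Union>e\<in>E. {F \<in> Fs. e \<subseteq> vt F})" using finite_E faces_at_edge by blast
qed

lemma face_subset_closure: "F \<in> Fs \<Longrightarrow> F \<subseteq> X closure_of F"
  by (rule closure_of_subset[OF face_off_graph(1)])

lemma arc_subset:
  assumes "e \<in> E" shows "arc e \<subseteq> inner_arc e \<union> \<phi> ` V"
proof -
  have "\<phi> ` e \<subseteq> \<phi> ` V" using edge[OF assms] by auto
  then show ?thesis using arc_eq[OF assms] by blast
qed

lemma cell_cases:
  assumes "p \<in> topspace X"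
  obtains (vertex) x where "x \<in> V" "p = \<phi> x" | (edge) e where "e \<in> E" "p \<in> inner_arc e"
    | (face) F where "F \<in> Fs" "p \<in> F"
proof -
  have "p \<in> \<Union>Fs \<union> \<phi> ` V \<union> (\<Union>e\<in>E. arc e)" by (rule subsetD[OF Union_faces assms])
  then consider F where "F \<in> Fs" "p \<in> F" | "p \<in> \<phi> ` V" | e where "e \<in> E" "p \<in> arc e" by auto
  then show thesis
  proof cases
    case 3
    then show thesis using arc_subset[OF 3(1)] vertex edge by auto
  qed (auto intro: vertex face)
qed

text \<open>Without a face at \<open>e\<close> a disc around its midpoint would embed into an arc.
  With a single face it would embed into the closed unit disc with the midpoint sent to the boundary
  circle. Invariance of domain forbids both.\<close>

lemma at_least_two_faces:
  assumes e: "e \<in> E" shows "\<not> card {F \<in> Fs. e \<subseteq> vt F} \<le> 1"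
proof
  assume c: "card {F \<in> Fs. e \<subseteq> vt F} \<le> 1"
  let ?p = "\<psi> e (1/2)"
  \<comment> \<open>Removing these closed cells, none of which contains the midpoint, leaves only
    inner points of \<open>e\<close> and points of faces at \<open>e\<close>, as recorded in
    \<open>N\<close>.\<close>
  let ?C = "(\<Union>e'\<in>E - {e}. arc e') \<union> (\<Union>F\<in>{F \<in> Fs. \<not> e \<subseteq> vt F}. X closure_of F) \<union> \<phi> ` V"
  have p: "?p \<in> inner_arc e" using edge_midpoint e .
  have pX: "?p \<in> topspace X"
    using \<psi>_cont[OF e] by (auto simp: continuous_map_def)
  have cl\<phi>: "closedin X (\<phi> ` V)"
    using finite_V \<phi>_in Hausdorff by (auto intro: closedin_Hausdorff_finite)
  have "closedin X ?C"
    by (intro closedin_Un closedin_Union cl\<phi>) (use finite_E finite_Fs arc_closed in auto)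
  then have "openin X (topspace X - ?C)" by blast
  define M where "M = topspace X - ?C"
  have openN: "openin X M" using \<open>openin X (topspace X - ?C)\<close> by (simp only: M_def)
  have "?p \<notin> ?C"
    using inner_closure_face[OF _ e p] arc_Int_arc[OF e] p inner_V[OF e] by blast
  then have pN: "?p \<in> M" unfolding M_def using pX by blast
  obtain d w r where d: "0 < r" "continuous_map (top_of_set (ball (w::complex) r)) X d" "inj_on d (ball w r)" "d w = ?p"
    "d ` ball w r \<subseteq> M"
    using chart_ball[OF surface openN pN] by metis
  have N: "q \<in> inner_arc e \<or> (\<exists>F\<in>Fs. e \<subseteq> vt F \<and> q \<in> F)" if "q \<in> M" for q
  proof -
    have q: "q \<in> topspace X - ?C" using that by (simp only: M_def)
    have "q \<in> topspace X" using q by (rule DiffD1)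
    then show ?thesis
    proof (cases rule: cell_cases)
      case (vertex x)
      then show ?thesis using q by auto
    next
      case (edge e')
      then have "q \<in> arc e'" using arc_eq by simp
      then have "e' = e" using q edge(1) by auto
      then show ?thesis using edge by simp
    next
      case (face F)
      then have "q \<in> X closure_of F" using face_subset_closure by (meson subsetD)
      then show ?thesis using q face by auto
    qed
  qed
  consider (0) "{F \<in> Fs. e \<subseteq> vt F} = {}" | (1) F where "{F \<in> Fs. e \<subseteq> vt F} = {F}"
  proof (cases "card {F \<in> Fs. e \<subseteq> vt F} = 0")
    case True
    then show thesis using 0 card_0_eq[OF faces_at_edge(1)[OF e]] by blast
  next
    case False
    then have "card {F \<in> Fs. e \<subseteq> vt F} = Suc 0" using c by linarith
    then show thesis using 1 unfolding card_1_singleton_iff by blast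
  qed
  then show False
  proof cases
    case 0
    obtain j where j: "homeomorphic_maps (top_of_set {0..1}) (subtopology X (arc e)) (\<psi> e) j"
      using \<psi>_emb[OF e] unfolding embedding_map_def homeomorphic_map_maps arc_def by auto
    have jc: "continuous_map (subtopology X (arc e)) (top_of_set {0..1}) j"
      and \<psi>j: "\<And>p. p \<in> arc e \<Longrightarrow> \<psi> e (j p) = p"
      using j arc_closed[OF e, THEN closedin_subset] unfolding homeomorphic_maps_def
      by (auto simp: topspace_subtopology)
    have dsub: "d ` ball w r \<subseteq> arc e" using d(5) N 0 arc_eq[OF e] by blast
    then have "continuous_map (top_of_set (ball w r)) (subtopology X (arc e)) d"
      using d(2) by (simp add: continuous_map_in_subtopology image_subset_iff_funcset)
    then have "continuous_map (top_of_set (ball w r)) (top_of_set {0..1}) (j \<circ> d)"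
      using jc continuous_map_compose by blast
    then have "continuous_on (ball w r) (j \<circ> d)" by (simp add: continuous_map_in_subtopology)
    then have "continuous_on (ball w r) (of_real \<circ> (j \<circ> d) :: complex \<Rightarrow> complex)"
      by (intro continuous_on_compose continuous_intros)
    moreover have "inj_on (of_real \<circ> (j \<circ> d) :: complex \<Rightarrow> complex) (ball w r)"
    proof (rule inj_onI)
      fix a b assume ab: "a \<in> ball w r" "b \<in> ball w r"
        "(of_real \<circ> (j \<circ> d) :: complex \<Rightarrow> complex) a = (of_real \<circ> (j \<circ> d)) b"
      then have "\<psi> e (j (d a)) = \<psi> e (j (d b))" by simp
      moreover have "\<psi> e (j (d a)) = d a" "\<psi> e (j (d b)) = d b" using \<psi>j dsub ab(1,2) by blast+
      ultimately have "d a = d b" by simp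
      then show "a = b" using inj_onD[OF d(3)] ab(1,2) by blast
    qed
    ultimately have "open ((of_real \<circ> (j \<circ> d) :: complex \<Rightarrow> complex) ` ball w r)"
      using invariance_of_domain by blast
    moreover have "of_real (j (d w)) \<in> (of_real \<circ> (j \<circ> d) :: complex \<Rightarrow> complex) ` ball w r"
      by (rule image_eqI[of _ _ w]) (use d(1) in simp_all)
    ultimately obtain t where t: "t > 0" "ball (of_real (j (d w))) t \<subseteq> (of_real \<circ> (j \<circ> d) :: complex \<Rightarrow> complex) ` ball w r"
      by (rule openE)
    \<comment> \<open>The image is open in the plane but consists of real numbers, so a small
      vertical shift leads out of it.\<close>
    have "of_real (j (d w)) + Complex 0 (t/2) \<in> ball (of_real (j (d w))) t"
      using t(1) by (simp add: dist_norm complex_norm)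
    then have "of_real (j (d w)) + Complex 0 (t/2) \<in> (of_real \<circ> (j \<circ> d) :: complex \<Rightarrow> complex) ` ball w r"
      using t(2) by blast
    then obtain y where "of_real (j (d w)) + Complex 0 (t/2) = (of_real (j (d y)) :: complex)" by auto
    then have "Im (of_real (j (d w)) + Complex 0 (t/2)) = 0" by simp
    then show False using t(1) by simp
  next
    case 1
    then have F: "F \<in> Fs" "e \<subseteq> vt F" by auto
    obtain h where h: "disc F h" using face_disc F by blast
    let ?S = "h ` cball 0 1"
    have hd: "embedding_map (top_of_set (cball (0::complex) 1)) X h" "h ` ball 0 1 = F"
      "h ` sphere 0 1 = (\<Union>e\<in>{e \<in> E. e \<subseteq> vt F}. arc e)"
      using h unfolding disc_def by auto
    obtain k where k: "homeomorphic_maps (top_of_set (cball 0 1)) (subtopology X ?S) h k"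
      using hd(1) unfolding embedding_map_def homeomorphic_map_maps by auto
    then have kc: "continuous_map (subtopology X ?S) (top_of_set (cball 0 1)) k"
      and kh: "\<And>z. z \<in> cball 0 1 \<Longrightarrow> k (h z) = z"
      unfolding homeomorphic_maps_def by auto
    have hk: "h (k p) = p \<and> k p \<in> cball 0 1" if "p \<in> ?S" for p using that kh by auto
    have "arc e \<subseteq> h ` sphere 0 1" unfolding hd(3) using F e by auto
    then have inner: "inner_arc e \<subseteq> h ` sphere 0 1" using arc_eq[OF e] by blast
    have "d ` ball w r \<subseteq> F \<union> inner_arc e" using d(5) N 1 by blast
    then have dsub: "d ` ball w r \<subseteq> ?S" using inner hd(2) unfolding cball_split image_Un by blast
    then have "continuous_map (top_of_set (ball w r)) (subtopology X ?S) d"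
      using d(2) by (simp add: continuous_map_in_subtopology image_subset_iff_funcset)
    then have "continuous_map (top_of_set (ball w r)) (top_of_set (cball 0 1)) (k \<circ> d)"
      using kc continuous_map_compose by blast
    then have kd: "continuous_on (ball w r) (k \<circ> d)" "(k \<circ> d) ` ball w r \<subseteq> cball 0 1"
      by (auto simp: continuous_map_in_subtopology)
    moreover have "inj_on (k \<circ> d) (ball w r)"
    proof (rule inj_onI)
      fix a b assume ab: "a \<in> ball w r" "b \<in> ball w r" "(k \<circ> d) a = (k \<circ> d) b"
      then have "h (k (d a)) = h (k (d b))" by simp
      moreover have "h (k (d a)) = d a" "h (k (d b)) = d b" using hk dsub ab(1,2) by blast+
      ultimately have "d a = d b" by simp
      then show "a = b" using inj_onD[OF d(3)] ab(1,2) by blast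
    qed
    ultimately have "open ((k \<circ> d) ` ball w r)"
      using invariance_of_domain by blast
    then have "(k \<circ> d) ` ball w r \<subseteq> ball 0 1"
      using kd(2) interior_maximal[of "(k \<circ> d) ` ball w r" "cball 0 1"] by simp
    moreover have "k ?p \<in> (k \<circ> d) ` ball w r"
      by (rule image_eqI[of _ _ w]) (use d(1,4) in simp_all)
    ultimately have "k ?p \<in> ball 0 1" by (rule subsetD)
    moreover have "?p \<in> h ` sphere 0 1" using inner p by blast
    then obtain z where z: "z \<in> sphere 0 1" "?p = h z" by blast
    have "k ?p \<in> sphere 0 1" using kh[of z] z by simp
    ultimately show False by simp
  qed
qed

lemma two_faces: "e \<in> E \<Longrightarrow> card {F \<in> Fs. e \<subseteq> vt F} = 2"
  using at_least_two_faces[of e] faces_at_edge(2)[of e] by linarith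

lemma edge_face:
  assumes "e \<in> E" obtains F where "F \<in> Fs" "e \<subseteq> vt F"
proof -
  have "{F \<in> Fs. e \<subseteq> vt F} \<noteq> {}" using two_faces[OF assms] by fastforce
  then show thesis using that by blast
qed

section \<open>Open stars and links of vertices\<close>

text \<open>The open star of \<open>x\<close>, written as the complement of the finitely many closed
  cells that avoid \<open>x\<close>, so that openness is immediate. The lemmas below show that it
  consists of the open cells that have \<open>x\<close> as a vertex.\<close>

definition star where
  "star x = topspace X - ((\<Union>e\<in>{e \<in> E. x \<notin> e}. arc e) \<union> (\<Union>F\<in>{F \<in> Fs. x \<notin> vt F}. X closure_of F) \<union> \<phi> ` (V - {x}))"

lemma open_star: "openin X (star x)"
proof -
  have "closedin X (\<phi> ` (V - {x}))"
    using finite_V \<phi>_in Hausdorff by (auto intro!: closedin_Hausdorff_finite)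
  then show ?thesis
    unfolding star_def
    by (intro openin_diff openin_topspace closedin_Un closedin_Union)
      (use finite_E finite_Fs arc_closed in auto)
qed

lemma vertex_in_star: "x \<in> V \<Longrightarrow> y \<in> V \<Longrightarrow> \<phi> x \<in> star y \<longleftrightarrow> x = y"
proof
  assume x: "x \<in> V" and "y \<in> V" and "x = y"
  have "\<phi> x \<notin> arc e" if "e \<in> E" "x \<notin> e" for e
    using arc_eq[OF that(1)] inner_V[OF that(1)] edge[OF that(1)] that(2) x inj_\<phi> by (auto dest: inj_onD)
  moreover have "\<phi> x \<notin> \<phi> ` (V - {x})" using inj_\<phi> x by (auto dest: inj_onD)
  ultimately show "\<phi> x \<in> star y" using \<phi>_in[OF x] x unfolding star_def \<open>x = y\<close>[symmetric] by (auto simp: vt_def)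
qed (auto simp: star_def)

lemma inner_in_star: "e \<in> E \<Longrightarrow> p \<in> inner_arc e \<Longrightarrow> p \<in> star x \<longleftrightarrow> x \<in> e"
proof
  assume e: "e \<in> E" and p: "p \<in> inner_arc e" and "p \<in> star x"
  then show "x \<in> e" using arc_eq[OF e] by (auto simp: star_def)
next
  assume e: "e \<in> E" and p: "p \<in> inner_arc e" and x: "x \<in> e"
  have "p \<notin> arc e'" if "e' \<in> E" "x \<notin> e'" for e' using arc_Int_arc[OF e that(1)] x p that by blast
  moreover have "p \<notin> X closure_of F" if "F \<in> Fs" "x \<notin> vt F" for F
    using inner_closure_face[OF that(1) e p] that x by blast
  moreover have "p \<notin> \<phi> ` (V - {x})" using inner_V[OF e] p by blast
  moreover have "p \<in> topspace X" using arc_closed[OF e, THEN closedin_subset] arc_eq[OF e] p by blast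
  ultimately show "p \<in> star x" unfolding star_def by blast
qed

lemma face_in_star: "F \<in> Fs \<Longrightarrow> p \<in> F \<Longrightarrow> p \<in> star x \<longleftrightarrow> x \<in> vt F"
proof
  assume F: "F \<in> Fs" and p: "p \<in> F" and "p \<in> star x"
  then show "x \<in> vt F" using face_subset_closure[OF F] by (auto simp: star_def)
next
  assume F: "F \<in> Fs" and p: "p \<in> F" and x: "x \<in> vt F"
  have "p \<notin> arc e" if "e \<in> E" for e using face_off_graph(3)[OF F that] p by blast
  moreover have "p \<notin> \<phi> ` (V - {x})" using face_off_graph(2)[OF F] p by blast
  moreover have "p \<notin> X closure_of G" if "G \<in> Fs" "x \<notin> vt G" for G
  proof -
    have "F \<noteq> G" using x that by auto
    then show ?thesis
      using faces_disjoint[OF F that(1)] face_off_graph(3)[OF F] p unfolding closure_face[OF that(1)] by blast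
  qed
  ultimately show "p \<in> star x" using face_off_graph(1)[OF F] p unfolding star_def by blast
qed

text \<open>The open star of a vertex without faces would be a single point, since every edge has a
  face; no point of a surface is open.\<close>

lemma vertex_face:
  assumes x: "x \<in> V" obtains F where "F \<in> Fs" "x \<in> vt F"
proof -
  have "\<exists>F\<in>Fs. x \<in> vt F"
  proof (rule ccontr)
    assume n: "\<not> ?thesis"
    have "star x \<subseteq> {\<phi> x}"
    proof
      fix p assume p: "p \<in> star x"
      then have "p \<in> topspace X" by (simp add: star_def)
      then show "p \<in> {\<phi> x}"
      proof (cases rule: cell_cases)
        case (vertex y)
        then show ?thesis using vertex_in_star[of y x] p x by auto
      next
        case (edge e)
        then have "x \<in> e" using inner_in_star p by blast
        then show ?thesis using edge_face[OF edge(1)] n by blast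
      next
        case (face F)
        then show ?thesis using face_in_star p n by blast
      qed
    qed
    obtain w r d where d: "0 < r" "continuous_map (top_of_set (ball (w::complex) r)) X d" "inj_on d (ball w r)" "d w = \<phi> x"
      "d ` ball w r \<subseteq> star x"
      using chart_ball[OF surface open_star, of "\<phi> x" x] vertex_in_star[OF x x] by metis
    have w: "w \<in> ball w r" "w + of_real (r/2) \<in> ball w r" using d(1) by (auto simp: dist_norm)
    have "d ` ball w r \<subseteq> {\<phi> x}" using d(5) \<open>star x \<subseteq> {\<phi> x}\<close> by (rule subset_trans)
    then have "d (w + of_real (r/2)) = \<phi> x" "d w = \<phi> x"
      using imageI[OF w(1), of d] imageI[OF w(2), of d] by auto
    then have "d (w + of_real (r/2)) = d w" by simp
    then have "w + of_real (r/2) = w" using inj_onD[OF d(3)] w by blast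
    then show False using d(1) by simp
  qed
  then show thesis using that by blast
qed

lemma closures_cover:
  assumes "p \<in> topspace X" obtains F where "F \<in> Fs" "p \<in> X closure_of F"
  using assms
proof (cases rule: cell_cases)
  case (vertex x)
  then show thesis using vertex_face[of x] vertex_closure_face that by metis
next
  case (edge e)
  then show thesis using edge_face[of e] inner_closure_face that by metis
next
  case (face F)
  then show thesis using face_subset_closure that by blast
qed

text \<open>A punctured disc around a vertex is connected, so the closed faces at the vertex cannot be
  split into two families without a common edge at the vertex.\<close>

lemma link_connected:
  assumes x: "x \<in> V"
    and P: "\<And>F G e. F \<in> Fs \<Longrightarrow> G \<in> Fs \<Longrightarrow> e \<in> E \<Longrightarrow> x \<in> e \<Longrightarrow> e \<subseteq> vt F \<Longrightarrow> e \<subseteq> vt G \<Longrightarrow> P F = P G"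
    and F: "F \<in> Fs" "G \<in> Fs" "x \<in> vt F" "x \<in> vt G"
  shows "(P F :: bool) = P G"
proof (rule ccontr)
  assume ne: "P F \<noteq> P G"
  obtain w r d where d: "0 < r" "continuous_map (top_of_set (ball (w::complex) r)) X d" "inj_on d (ball w r)" "d w = \<phi> x"
    "d ` ball w r \<subseteq> star x" "openin X (d ` ball w r)"
    using chart_ball[OF surface open_star, of "\<phi> x" x] vertex_in_star[OF x x] by metis
  define D where "D = d ` ball w r - {\<phi> x}"
  have conn: "connectedin X D"
    unfolding D_def using connectedin_punctured_ball[OF d(2,3,1)] d(4) by simp
  define S where "S b = (\<Union>H\<in>{H \<in> Fs. x \<in> vt H \<and> P H = b}. X closure_of H)" for b
  have closed: "closedin X (S b)" for b
    unfolding S_def by (intro closedin_Union) (use finite_Fs in auto)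
  have D: "\<exists>H\<in>Fs. x \<in> vt H \<and> p \<in> X closure_of H" if p: "p \<in> D" for p
  proof -
    have ps: "p \<in> star x" using p d(5) by (auto simp: D_def)
    then have "p \<in> topspace X" by (simp add: star_def)
    then obtain H where "H \<in> Fs" "p \<in> X closure_of H" by (rule closures_cover)
    then show ?thesis using ps by (auto simp: star_def)
  qed
  have cover: "D \<subseteq> S True \<union> S False" using D unfolding S_def by blast
  have disjoint: "S True \<inter> S False \<inter> D = {}"
  proof (rule ccontr)
    assume "S True \<inter> S False \<inter> D \<noteq> {}"
    then obtain p H K where p: "p \<in> D" and H: "H \<in> Fs" "x \<in> vt H" "P H" "p \<in> X closure_of H"
      and K: "K \<in> Fs" "x \<in> vt K" "\<not> P K" "p \<in> X closure_of K"
      unfolding S_def by blast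
    have ps: "p \<in> star x" "p \<noteq> \<phi> x" using p d(5) by (auto simp: D_def)
    then have "p \<in> topspace X" by (simp add: star_def)
    then show False
    proof (cases rule: cell_cases)
      case (vertex y)
      then show ?thesis using vertex_in_star[of y x] x ps by auto
    next
      case (edge e)
      then have "x \<in> e" "e \<subseteq> vt H" "e \<subseteq> vt K"
        using inner_in_star ps(1) inner_closure_face H K by blast+
      then show ?thesis using P[OF H(1) K(1) edge(1)] H K by blast
    next
      case (face M)
      have "M = H'" if "H' \<in> Fs" "p \<in> X closure_of H'" for H'
      proof (rule ccontr)
        assume "M \<noteq> H'"
        then show False using that faces_disjoint[OF face(1) that(1)] face_off_graph(3)[OF face(1)] face(2)
          unfolding closure_face[OF that(1)] by blast
      qed
      then have "M = H" "M = K" using H(1,4) K(1,4) by blast+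
      then show ?thesis using H(3) K(3) by blast
    qed
  qed
  have meets: "S (P H) \<inter> D \<noteq> {}" if H: "H \<in> Fs" "x \<in> vt H" for H
  proof -
    have "\<phi> x \<in> d ` ball w r" by (rule image_eqI[of _ _ w]) (use d(1,4) in simp_all)
    then obtain q where q: "q \<in> H" "q \<in> d ` ball w r"
      using vertex_closure_face[OF H(2)] d(6) unfolding in_closure_of by auto
    moreover have "q \<noteq> \<phi> x" using face_off_graph(2)[OF H(1)] x q by auto
    moreover have "q \<in> S (P H)" unfolding S_def using subsetD[OF face_subset_closure[OF H(1)] q(1)] H by auto
    ultimately show ?thesis unfolding D_def by auto
  qed
  have "S True \<inter> D \<noteq> {}" "S False \<inter> D \<noteq> {}"
    using meets[OF F(1,3)] meets[OF F(2,4)] ne by (cases "P F"; simp)+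
  then have "\<exists>E1 E2. closedin X E1 \<and> closedin X E2 \<and> D \<subseteq> E1 \<union> E2 \<and>
      E1 \<inter> E2 \<inter> D = {} \<and> E1 \<inter> D \<noteq> {} \<and> E2 \<inter> D \<noteq> {}"
    by (intro exI[of _ "S True"] exI[of _ "S False"] conjI closed cover disjoint)
  then show False using conn unfolding connectedin_closedin by simp
qed

end

section \<open>Cocycles and non-contractible cycles\<close>

sublocale triangulated_surface \<subseteq> comb: combinatorial_surface V E Fs vt
proof
  show "finite V" by (rule finite_V)
  show "\<And>e. e \<in> E \<Longrightarrow> e \<subseteq> V \<and> card e = 2" by (rule edge)
  show "finite Fs" by (rule finite_Fs)
  show "\<And>F. F \<in> Fs \<Longrightarrow> card (vt F) = 3" by (rule card_face)
  show "\<And>F x y. F \<in> Fs \<Longrightarrow> x \<in> vt F \<Longrightarrow> y \<in> vt F \<Longrightarrow> x \<noteq> y \<Longrightarrow> {x, y} \<in> E" by (rule face_edge)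
  show "\<And>e. e \<in> E \<Longrightarrow> card {F \<in> Fs. e \<subseteq> vt F} = 2" by (rule two_faces)
next
  fix x and P :: "_ \<Rightarrow> bool" and F G
  assume "x \<in> V" "\<And>F G e. F \<in> Fs \<Longrightarrow> G \<in> Fs \<Longrightarrow> e \<in> E \<Longrightarrow> x \<in> e \<Longrightarrow> e \<subseteq> vt F \<Longrightarrow> e \<subseteq> vt G \<Longrightarrow> P F = P G"
    "F \<in> Fs" "G \<in> Fs" "x \<in> vt F" "x \<in> vt G"
  then show "P F = P G" by (rule link_connected)
qed

context triangulated_surface
begin

section \<open>The double cover of a simplicial cocycle\<close>

text \<open>The stars that contain \<open>p\<close> are those of the vertices of the open cell of
  \<open>p\<close>, and every cell belongs to a face. So the overlaps of the cover by open stars are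
  governed by the triangulation itself.\<close>

lemma stars_in_face:
  assumes "p \<in> topspace X"
  shows "\<exists>F\<in>Fs. \<forall>x\<in>V. p \<in> star x \<longrightarrow> x \<in> vt F"
  using assms
proof (cases rule: cell_cases)
  case (vertex y)
  obtain F where "F \<in> Fs" "y \<in> vt F" by (rule vertex_face[OF vertex(1)])
  then show ?thesis using vertex vertex_in_star by (intro bexI[of _ F]) auto
next
  case (edge e)
  obtain F where "F \<in> Fs" "e \<subseteq> vt F" by (rule edge_face[OF edge(1)])
  then show ?thesis using inner_in_star[OF edge] by (intro bexI[of _ F]) auto
next
  case (face F)
  then show ?thesis using face_in_star by (intro bexI[of _ F]) auto
qed

text \<open>An arbitrary reference vertex, relative to which the two sheets over \<open>p\<close>
  are labelled. It may jump, since labels need not be continuous.\<close>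

definition centre :: "'a \<Rightarrow> 'v" where
  "centre p = (SOME x. x \<in> V \<and> p \<in> star x)"

lemma centre:
  assumes "p \<in> topspace X" shows "centre p \<in> V" "p \<in> star (centre p)"
proof -
  have "\<exists>x. x \<in> V \<and> p \<in> star x"
    using assms
  proof (cases rule: cell_cases)
    case (vertex y)
    then show ?thesis using vertex_in_star by blast
  next
    case (edge e)
    have "card e = 2" using comb.edge edge(1) by blast
    then obtain x where "x \<in> e" by fastforce
    then show ?thesis using inner_in_star[OF edge] comb.edge edge(1) by blast
  next
    case (face F)
    have "vt F \<noteq> {}" using card_face[OF face(1)] by auto
    then show ?thesis using face_in_star[OF face] vt_V by blast
  qed
  from someI_ex[OF this] show "centre p \<in> V" "p \<in> star (centre p)" unfolding centre_def by auto
qed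

lemma centre_vertex: "x \<in> V \<Longrightarrow> centre (\<phi> x) = x"
  using centre[of "\<phi> x"] \<phi>_in vertex_in_star by auto

text \<open>The value of \<open>u\<close> on the edge from \<open>x\<close> to the reference vertex.
  The first conjunct sets it to 0 when both coincide, as nothing prevents \<open>u\<close> from
  containing singletons.\<close>

definition star_sheet :: "'v set set \<Rightarrow> 'v \<Rightarrow> 'a \<Rightarrow> bool" where
  "star_sheet u x p \<longleftrightarrow> x \<noteq> centre p \<and> {x, centre p} \<in> u"

text \<open>Some face contains \<open>x\<close>, \<open>y\<close> and the centre of
  \<open>p\<close>, and the cocycle condition there eliminates the centre. The transition functions
  are thus constant with the values of \<open>u\<close>.\<close>

lemma star_sheet_diff:
  assumes u: "comb.cocycle u" and "x \<in> V" "y \<in> V" "p \<in> star x" "p \<in> star y"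
  shows "(star_sheet u x p \<noteq> star_sheet u y p) \<longleftrightarrow> x \<noteq> y \<and> {x, y} \<in> u"
proof -
  have p: "p \<in> topspace X" using assms(4) by (simp add: star_def)
  obtain F where F: "F \<in> Fs" "\<And>x. x \<in> V \<Longrightarrow> p \<in> star x \<Longrightarrow> x \<in> vt F"
    using stars_in_face[OF p] by auto
  define z where "z = centre p"
  have vt: "x \<in> vt F" "y \<in> vt F" "z \<in> vt F" using F(2) assms centre[OF p] by (auto simp: z_def)
  show ?thesis
  proof (cases "x = y \<or> x = z \<or> y = z")
    case True
    then show ?thesis unfolding star_sheet_def z_def[symmetric] by (auto simp: insert_commute)
  next
    case False
    then have "{x, y, z} = vt F"
      using vt card_face[OF F(1)] by (intro card_seteq) (auto intro: card_ge_0_finite)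
    then have "{x, y} \<in> u \<longleftrightarrow> ({x, z} \<in> u) \<noteq> ({y, z} \<in> u)"
      using u F(1) False unfolding comb.cocycle_def by metis
    then show ?thesis using False unfolding star_sheet_def z_def[symmetric] by auto
  qed
qed

lemma double_cover_star:
  assumes "comb.cocycle u" shows "double_cover X V star (star_sheet u)"
proof
  fix x y assume "x \<in> V" "y \<in> V"
  then show "loc_const X (star x \<inter> star y) (\<lambda>p. star_sheet u x p \<noteq> star_sheet u y p)"
    using star_sheet_diff[OF assms] open_star[of x]
    by (intro loc_constI exI[of _ "star x"] exI[of _ "x \<noteq> y \<and> {x, y} \<in> u"]) auto
qed (use open_star centre in auto)

text \<open>Without its far end the arc stays in the star of \<open>x\<close>, so that one
  trivialisation covers the way from the vertex to the midpoint.\<close>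

lemma half_arc:
  assumes e: "e \<in> E" and x: "x \<in> e"
  shows "connectedin X (insert (\<phi> x) (inner_arc e))" "insert (\<phi> x) (inner_arc e) \<subseteq> star x"
    "insert (\<phi> x) (inner_arc e) \<subseteq> arc e"
proof -
  have V: "x \<in> V" using edge[OF e] x by auto
  have "\<phi> x \<in> {\<psi> e 0, \<psi> e 1}" using \<psi>_ends[OF e] x by auto
  then have "\<exists>S. insert (\<phi> x) (inner_arc e) = \<psi> e ` S \<and> connected S \<and> S \<subseteq> {0..1}"
  proof
    assume "\<phi> x = \<psi> e 0"
    moreover have "{0..<1::real} = insert 0 {0<..<1}" by auto
    ultimately have "insert (\<phi> x) (inner_arc e) = \<psi> e ` {0..<1}" by (simp add: inner_arc_def)
    then show ?thesis by (intro exI[of _ "{0..<1}"]) auto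
  next
    assume "\<phi> x \<in> {\<psi> e 1}"
    moreover have "{0<..1::real} = insert 1 {0<..<1}" by auto
    ultimately have "insert (\<phi> x) (inner_arc e) = \<psi> e ` {0<..1}" by (simp add: inner_arc_def)
    then show ?thesis by (intro exI[of _ "{0<..1}"]) auto
  qed
  then obtain S where S: "insert (\<phi> x) (inner_arc e) = \<psi> e ` S" "connected S" "S \<subseteq> {0..1}" by auto
  have "connectedin (top_of_set {0..1}) S" using S by (simp add: connectedin_subtopology)
  then show "connectedin X (insert (\<phi> x) (inner_arc e))"
    unfolding S(1) by (rule connectedin_continuous_map_image[OF \<psi>_cont[OF e]])
  show "insert (\<phi> x) (inner_arc e) \<subseteq> star x"
    using inner_in_star[OF e] vertex_in_star[OF V V] x by auto
  show "insert (\<phi> x) (inner_arc e) \<subseteq> arc e" using arc_eq[OF e] x by auto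
qed

text \<open>On each half of the arc the section is constant relative to the trivialisation of the
  end vertex, which has label \<open>False\<close> at that vertex. At the midpoint the two
  trivialisations differ by the value of \<open>u\<close>.\<close>

lemma section_on_cycle:
  assumes u: "comb.cocycle u" and \<tau>: "double_cover.section_on X V star (star_sheet u) S \<tau>"
    and e: "{x, y} \<in> E" "arc {x, y} \<subseteq> S"
  shows "{x, y} \<in> u \<longleftrightarrow> \<tau> (\<phi> x) \<noteq> \<tau> (\<phi> y)"
proof -
  interpret double_cover X V star "star_sheet u" by (rule double_cover_star[OF u])
  let ?q = "\<psi> {x, y} (1/2)"
  have q: "?q \<in> inner_arc {x, y}" by (rule edge_midpoint[OF e(1)])
  have half: "\<tau> ?q \<noteq> star_sheet u z ?q \<longleftrightarrow> \<tau> (\<phi> z)" if z: "z \<in> {x, y}" for z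
  proof -
    have V: "z \<in> V" using edge[OF e(1)] z by auto
    note H = half_arc[OF e(1) z]
    have "loc_const X (S \<inter> star z) (\<lambda>p. \<tau> p \<noteq> star_sheet u z p)"
      using \<tau> V unfolding section_on_def by blast
    then have "loc_const X (insert (\<phi> z) (inner_arc {x, y})) (\<lambda>p. \<tau> p \<noteq> star_sheet u z p)"
      by (rule loc_const_subset) (use H e(2) in auto)
    then have "(\<tau> ?q \<noteq> star_sheet u z ?q) = (\<tau> (\<phi> z) \<noteq> star_sheet u z (\<phi> z))"
      by (rule loc_const_connected[OF H(1)]) (use q in auto)
    then show ?thesis using centre_vertex[OF V] by (simp add: star_sheet_def)
  qed
  have "x \<in> V" "y \<in> V" "x \<noteq> y" using edge[OF e(1)] comb.edge_neq[OF e(1)] by auto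
  then show ?thesis
    using half[of x] half[of y] star_sheet_diff[OF u, of x y ?q] inner_in_star[OF e(1) q] by auto
qed

text \<open>The double cover of \<open>u\<close> has a section over a contractible embedded circle.
  The values of \<open>u\<close> on the edges are differences of this section and telescope to 0
  around the cycle.\<close>

lemma contractible_cycle_even:
  assumes u: "comb.cocycle u" and f: "embedding_map (top_of_set (sphere (0::complex) 1)) X f"
    "f ` sphere 0 1 = (\<Union>j<k. arc {p j, p (Suc j)})" "contractible_curve X f"
    and p: "p k = p 0" "\<And>j. j < k \<Longrightarrow> {p j, p (Suc j)} \<in> E \<and> s (Suc j) = (s j \<noteq> ({p j, p (Suc j)} \<in> u))"
  shows "s k = s 0"
proof -
  interpret double_cover X V star "star_sheet u" by (rule double_cover_star[OF u])
  let ?S = "f ` sphere 0 1"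
  obtain a where "homotopic_with (\<lambda>_. True) (top_of_set (sphere 0 1)) X f (\<lambda>_. a)"
    using f(3) unfolding contractible_curve_def by blast
  moreover have "compact_space (top_of_set (sphere (0::complex) 1))"
    by (simp add: compact_space_subtopology)
  ultimately obtain \<tau> where \<tau>: "section_on ?S \<tau>" using ex_section_on_image[OF _ f(1)] by auto
  have edge_eq: "{p j, p (Suc j)} \<in> u \<longleftrightarrow> \<tau> (\<phi> (p j)) \<noteq> \<tau> (\<phi> (p (Suc j)))" if "j < k" for j
    by (rule section_on_cycle[OF u \<tau>]) (use that p(2) f(2) in auto)
  have "(s 0 = s n) = (\<tau> (\<phi> (p 0)) = \<tau> (\<phi> (p n)))" if "n \<le> k" for n
    using that by (induction n) (use edge_eq p(2) in auto)
  from this[of k] show ?thesis using p(1) by auto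
qed

end

section \<open>From double covers to cocycles\<close>

text \<open>A pasting lemma: for each of the finitely many closed sets a point \<open>p\<close> has
  a neighbourhood that avoids the set or on which \<open>P\<close> has the value \<open>P p\<close>
  along it. These are intersected.\<close>

lemma loc_const_finite_closed:
  assumes fin: "finite \<C>" and closed: "\<And>C. C \<in> \<C> \<Longrightarrow> closedin X C" and cover: "S \<subseteq> \<Union>\<C>" "S \<subseteq> topspace X"
    and lc: "\<And>C. C \<in> \<C> \<Longrightarrow> loc_const X (S \<inter> C) P"
  shows "loc_const X S P"
proof (rule loc_constI)
  fix p assume p: "p \<in> S"
  have "\<exists>N. openin X N \<and> p \<in> N \<and> (\<forall>q\<in>N \<inter> (S \<inter> C). P q = P p)" if C: "C \<in> \<C>" for C
  proof (cases "p \<in> C")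
    case True
    then have "p \<in> S \<inter> C" using p by simp
    then obtain N b where N: "openin X N" "p \<in> N" "\<forall>q\<in>N \<inter> (S \<inter> C). P q = b"
      by (rule loc_constE[OF lc[OF C]])
    then have "P p = b" using p True by simp
    then show ?thesis using N by (intro exI[of _ N]) simp
  next
    case False
    then show ?thesis using closed[OF C] p cover(2) by (intro exI[of _ "topspace X - C"]) auto
  qed
  then have "\<forall>C\<in>\<C>. \<exists>N. openin X N \<and> p \<in> N \<and> (\<forall>q\<in>N \<inter> (S \<inter> C). P q = P p)" by (rule ballI)
  then have "\<exists>N. \<forall>C\<in>\<C>. openin X (N C) \<and> p \<in> N C \<and> (\<forall>q\<in>N C \<inter> (S \<inter> C). P q = P p)" by (rule bchoice)
  then obtain N where N: "\<forall>C\<in>\<C>. openin X (N C) \<and> p \<in> N C \<and> (\<forall>q\<in>N C \<inter> (S \<inter> C). P q = P p)" by (elim exE)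
  let ?N = "topspace X \<inter> (\<Inter>C\<in>\<C>. N C)"
  have "openin X ?N"
  proof (cases "\<C> = {}")
    case False
    then show ?thesis using fin N by (intro openin_Int openin_topspace openin_Inter) auto
  qed simp
  moreover have "p \<in> ?N" using p cover(2) N by auto
  moreover have "P q = P p" if q: "q \<in> ?N \<inter> S" for q
  proof -
    obtain C where "C \<in> \<C>" "q \<in> C" using q cover(1) by auto
    then show ?thesis using N[rule_format, of C, THEN conjunct2, THEN conjunct2, rule_format, of q] q by simp
  qed
  ultimately show "\<exists>N b. openin X N \<and> p \<in> N \<and> (\<forall>q\<in>N \<inter> S. P q = b)" by blast
qed

context combinatorial_surface
begin

text \<open>The potential of \<open>x\<close> is the value of any walk to \<open>x\<close> from a
  base point; two such walks form an even closed walk, so the value is unambiguous.\<close>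

lemma coboundary_if_even:
  assumes even: "\<And>x n. \<not> walk u x n True x"
  shows "\<exists>s :: 'v \<Rightarrow> bool. \<forall>x y. {x, y} \<in> E \<longrightarrow> ({x, y} \<in> u \<longleftrightarrow> s x \<noteq> s y)"
proof -
  define R where "R x = {r. \<exists>n b. walk u r n b x}" for x
  \<comment> \<open>One base point for each component: adjacent vertices have the same set
    \<open>R\<close>, and \<open>SOME\<close> then makes the same choice.\<close>
  define c where "c x = (SOME r. r \<in> R x)" for x
  have "x \<in> R x" for x unfolding R_def using walk_0 by blast
  then have c: "c x \<in> R x" for x unfolding c_def by (rule someI)
  have sub: "R x \<subseteq> R y" if "{x, y} \<in> E" for x y
    unfolding R_def using walk_Suc[OF _ that] by blast
  define s where "s x \<longleftrightarrow> (\<exists>n. walk u (c x) n True x)" for x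
  have uniq: "b = b'" if "walk u r n b x" "walk u r n' b' x" for r n b x n' b'
    using walk_append[OF walk_sym[OF that(2)] that(1)] even by (cases "b = b'") auto
  have s: "\<exists>n. walk u (c x) n (s x) x" for x
  proof -
    obtain n b where "walk u (c x) n b x" using c unfolding R_def by blast
    then have "s x = b" unfolding s_def using uniq[of "c x" n b x _ True] by (cases b) auto
    then show ?thesis using \<open>walk u (c x) n b x\<close> by blast
  qed
  have "{x, y} \<in> u \<longleftrightarrow> s x \<noteq> s y" if e: "{x, y} \<in> E" for x y
  proof -
    have "{y, x} \<in> E" using e by (simp add: insert_commute)
    then have "R x = R y" using sub[OF e] sub by blast
    then have cxy: "c x = c y" unfolding c_def by simp
    obtain n n' where "walk u (c y) n (s x) x" "walk u (c y) n' (s y) y" using s cxy by metis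
    then show ?thesis using uniq[OF walk_Suc[OF _ e refl]] by blast
  qed
  then show ?thesis by (intro exI[of _ s]) simp
qed

end

locale covered_triangulation = triangulated_surface X V E \<phi> \<psi> + double_cover X I U g
  for X :: "'a topology" and V :: "'v set" and E \<phi> \<psi> and I :: "'i set" and U g
begin

lemma connectedin_arc: "e \<in> E \<Longrightarrow> connectedin X (arc e)"
  unfolding arc_def
  by (rule connectedin_continuous_map_image[OF \<psi>_cont]) (auto simp: connectedin_subtopology)

lemma arc_closure_face: "F \<in> Fs \<Longrightarrow> e \<in> E \<Longrightarrow> e \<subseteq> vt F \<Longrightarrow> arc e \<subseteq> X closure_of F"
  using closure_face by auto

text \<open>A closed face is an embedded disc, hence contractible in the surface. This is where it
  matters that faces are discs.\<close>

lemma section_on_face: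
  assumes F: "F \<in> Fs" shows "\<exists>\<sigma>. section_on (X closure_of F) \<sigma>"
proof -
  obtain h where h: "disc F h" using face_disc F by blast
  then have hd: "embedding_map (top_of_set (cball (0::complex) 1)) X h" "X closure_of F = h ` cball 0 1"
    unfolding disc_def by auto
  have "contractible_space (top_of_set (cball (0::complex) 1))"
    by (simp add: convex_imp_contractible)
  then obtain a where "homotopic_with (\<lambda>_. True) (top_of_set (cball (0::complex) 1)) (top_of_set (cball 0 1)) id (\<lambda>_. a)"
    unfolding contractible_space_def by blast
  then have "homotopic_with (\<lambda>_. True) (top_of_set (cball 0 1)) X (h \<circ> id) (h \<circ> (\<lambda>_. a))"
    by (rule homotopic_with_compose_continuous_map_left) (use embedding_disc_continuous(1)[OF hd(1)] in auto)
  then have "homotopic_with (\<lambda>_. True) (top_of_set (cball 0 1)) X h (\<lambda>_. h a)" by (simp add: o_def)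
  moreover have "compact_space (top_of_set (cball (0::complex) 1))"
    by (simp add: compact_space_subtopology)
  ultimately show ?thesis using ex_section_on_image[OF _ hd(1)] hd(2) by auto
qed

text \<open>The cochain of the cover relative to the given labels of the sheets over the vertices:
  an edge belongs to it if a section over the edge changes its label. Exchanging the labels over a
  vertex would alter it by a coboundary.\<close>

definition monodromy :: "'v set set" where
  "monodromy = {e \<in> E. \<exists>F\<in>Fs. \<exists>\<sigma> x y. e = {x, y} \<and> e \<subseteq> vt F \<and> section_on (X closure_of F) \<sigma> \<and>
     \<sigma> (\<phi> x) \<noteq> \<sigma> (\<phi> y)}"

text \<open>Two sections over the connected arc agree everywhere or nowhere, so neither the face nor
  the section in \<open>monodromy\<close> matters.\<close>

lemma monodromy_iff:
  assumes F: "F \<in> Fs" "section_on (X closure_of F) \<sigma>" "x \<in> vt F" "y \<in> vt F" "x \<noteq> y"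
  shows "{x, y} \<in> monodromy \<longleftrightarrow> \<sigma> (\<phi> x) \<noteq> \<sigma> (\<phi> y)"
proof
  have e: "{x, y} \<in> E" using face_edge F by blast
  assume "{x, y} \<in> monodromy"
  then obtain G \<tau> a b where G: "G \<in> Fs" "{x, y} = {a, b}" "{x, y} \<subseteq> vt G"
    "section_on (X closure_of G) \<tau>" "\<tau> (\<phi> a) \<noteq> \<tau> (\<phi> b)"
    unfolding monodromy_def by blast
  then have \<tau>: "\<tau> (\<phi> x) \<noteq> \<tau> (\<phi> y)" by (auto simp: doubleton_eq_iff)
  have "section_on (arc {x, y}) \<sigma>"
    by (rule section_on_subset[OF F(2) arc_closure_face[OF F(1) e]]) (use F in auto)
  moreover have "section_on (arc {x, y}) \<tau>"
    by (rule section_on_subset[OF G(4) arc_closure_face[OF G(1) e G(3)]])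
  moreover have "\<phi> x \<in> arc {x, y}" "\<phi> y \<in> arc {x, y}" using arc_eq[OF e] by auto
  ultimately have "(\<sigma> (\<phi> x) = \<tau> (\<phi> x)) = (\<sigma> (\<phi> y) = \<tau> (\<phi> y))"
    by (rule section_on_unique[OF connectedin_arc[OF e]])
  then show "\<sigma> (\<phi> x) \<noteq> \<sigma> (\<phi> y)" using \<tau> by auto
next
  assume "\<sigma> (\<phi> x) \<noteq> \<sigma> (\<phi> y)"
  then show "{x, y} \<in> monodromy" unfolding monodromy_def using F face_edge by blast
qed

lemma cocycle_monodromy: "comb.cocycle monodromy"
  unfolding comb.cocycle_def
proof (intro ballI allI impI)
  fix F x y z assume F: "F \<in> Fs" "vt F = {x, y, z}" "x \<noteq> y" "x \<noteq> z" "y \<noteq> z"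
  obtain \<sigma> where \<sigma>: "section_on (X closure_of F) \<sigma>" using section_on_face F by blast
  show "({x, y} \<in> monodromy) = (({x, z} \<in> monodromy) \<noteq> ({y, z} \<in> monodromy))"
    using monodromy_iff[OF F(1) \<sigma>, of x y] monodromy_iff[OF F(1) \<sigma>, of x z]
      monodromy_iff[OF F(1) \<sigma>, of y z] F by auto
qed

lemma face_unique: "H \<in> Fs \<Longrightarrow> p \<in> H \<Longrightarrow> F \<in> Fs \<Longrightarrow> p \<in> X closure_of F \<Longrightarrow> F = H"
  using faces_disjoint[of H F] face_off_graph(3)[of H] unfolding closure_face by auto

text \<open>A potential \<open>s\<close> of the monodromy prescribes labels at the vertices, and
  each face has a section with these labels. Sections of neighbouring faces agree at the vertices,
  thus on common arcs by uniqueness, and can be pasted over the finitely many closed faces.\<close>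

lemma global_section:
  assumes s: "\<And>x y. {x, y} \<in> E \<Longrightarrow> {x, y} \<in> monodromy \<longleftrightarrow> (s x :: bool) \<noteq> s y"
  shows "\<exists>\<sigma>. section_on (topspace X) \<sigma>"
proof -
  have "\<exists>\<sigma>. section_on (X closure_of F) \<sigma> \<and> (\<forall>x\<in>vt F. \<sigma> (\<phi> x) = s x)" if F: "F \<in> Fs" for F
  proof -
    obtain \<sigma>0 where \<sigma>0: "section_on (X closure_of F) \<sigma>0" using section_on_face F by blast
    obtain a where a: "a \<in> vt F" using card_face[OF F] by fastforce
    \<comment> \<open>Of the two sections \<open>\<sigma>0\<close> and its exchange, this is the one
      with label \<open>s a\<close> over \<open>\<phi> a\<close>; \<open>monodromy_iff\<close> then
      fixes the other two vertices.\<close>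
    define \<sigma> where "\<sigma> p \<longleftrightarrow> \<sigma>0 p = (\<sigma>0 (\<phi> a) = s a)" for p
    have "\<sigma> = \<sigma>0 \<or> \<sigma> = (\<lambda>p. \<not> \<sigma>0 p)" unfolding \<sigma>_def by auto
    then have \<sigma>: "section_on (X closure_of F) \<sigma>" using \<sigma>0 section_on_not by blast
    have "\<sigma> (\<phi> x) = s x" if x: "x \<in> vt F" for x
    proof (cases "x = a")
      case False
      then show ?thesis
        using s[OF face_edge[OF F a x]] monodromy_iff[OF F \<sigma> a x] unfolding \<sigma>_def by auto
    qed (auto simp: \<sigma>_def)
    then show ?thesis using \<sigma> by blast
  qed
  then obtain \<sigma>F where \<sigma>F: "\<And>F. F \<in> Fs \<Longrightarrow> section_on (X closure_of F) (\<sigma>F F)"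
    "\<And>F x. F \<in> Fs \<Longrightarrow> x \<in> vt F \<Longrightarrow> \<sigma>F F (\<phi> x) = s x" by metis
  have agree: "\<sigma>F F p = \<sigma>F G p"
    if F: "F \<in> Fs" "p \<in> X closure_of F" and G: "G \<in> Fs" "p \<in> X closure_of G" for F G p
  proof -
    have "p \<in> topspace X" using F(2) closure_of_subset_topspace by fast
    then show ?thesis
    proof (cases rule: cell_cases)
      case (vertex x)
      then have "x \<in> vt F" "x \<in> vt G" using F G by (auto simp: vt_def)
      then show ?thesis using \<sigma>F(2) F(1) G(1) vertex(2) by simp
    next
      case (edge e)
      have sub: "e \<subseteq> vt F" "e \<subseteq> vt G" using inner_closure_face[OF _ edge] F G by auto
      have "card e = 2" using comb.edge edge(1) by blast
      then obtain x where x: "x \<in> e" by fastforce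
      have "p \<in> arc e" "\<phi> x \<in> arc e" using arc_eq[OF edge(1)] edge(2) x by auto
      moreover have "section_on (arc e) (\<sigma>F F)" "section_on (arc e) (\<sigma>F G)"
        using section_on_subset[OF \<sigma>F(1)[OF F(1)] arc_closure_face[OF F(1) edge(1) sub(1)]]
          section_on_subset[OF \<sigma>F(1)[OF G(1)] arc_closure_face[OF G(1) edge(1) sub(2)]] .
      ultimately have "(\<sigma>F F (\<phi> x) = \<sigma>F G (\<phi> x)) = (\<sigma>F F p = \<sigma>F G p)"
        using section_on_unique[OF connectedin_arc[OF edge(1)]] by blast
      moreover have "\<sigma>F F (\<phi> x) = s x" "\<sigma>F G (\<phi> x) = s x"
        using \<sigma>F(2)[OF F(1)] \<sigma>F(2)[OF G(1)] x sub by blast+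
      ultimately show ?thesis by simp
    next
      case (face H)
      then have "F = H" "G = H" using face_unique[OF face] F G by auto
      then show ?thesis by simp
    qed
  qed
  define \<sigma> where "\<sigma> p = \<sigma>F (SOME F. F \<in> Fs \<and> p \<in> X closure_of F) p" for p
  have \<sigma>: "\<sigma> p = \<sigma>F F p" if F: "F \<in> Fs" "p \<in> X closure_of F" for F p
  proof -
    let ?G = "SOME F. F \<in> Fs \<and> p \<in> X closure_of F"
    have "?G \<in> Fs \<and> p \<in> X closure_of ?G" by (rule someI[of _ F]) (use F in simp)
    then show ?thesis unfolding \<sigma>_def using agree F by blast
  qed
  have "section_on (topspace X) \<sigma>"
    unfolding section_on_def
  proof
    fix i assume i: "i \<in> I"
    show "loc_const X (topspace X \<inter> U i) (\<lambda>p. \<sigma> p \<noteq> g i p)"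
    proof (rule loc_const_finite_closed[of "(\<lambda>F. X closure_of F) ` Fs"])
      show "topspace X \<inter> U i \<subseteq> \<Union>((\<lambda>F. X closure_of F) ` Fs)"
        using closures_cover by blast
      fix C assume "C \<in> (\<lambda>F. X closure_of F) ` Fs"
      then obtain F where F: "F \<in> Fs" "C = X closure_of F" by auto
      have "loc_const X (C \<inter> U i) (\<lambda>p. \<sigma>F F p \<noteq> g i p)"
        using \<sigma>F(1)[OF F(1)] i unfolding section_on_def F(2) by blast
      then have "loc_const X (topspace X \<inter> U i \<inter> C) (\<lambda>p. \<sigma>F F p \<noteq> g i p)"
        by (rule loc_const_subset) auto
      then show "loc_const X (topspace X \<inter> U i \<inter> C) (\<lambda>p. \<sigma> p \<noteq> g i p)"
        by (rule loc_const_transfer) (use \<sigma> F in auto)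
    qed (use finite_Fs in auto)
  qed
  then show ?thesis by blast
qed

theorem odd_walk:
  assumes "\<And>\<sigma>. \<not> section_on (topspace X) \<sigma>"
  shows "\<exists>u n x. comb.cocycle u \<and> comb.walk u x n True x"
proof (rule ccontr)
  assume "\<not> ?thesis"
  then have "\<And>x n. \<not> comb.walk monodromy x n True x" using cocycle_monodromy by blast
  then have "\<exists>s :: 'v \<Rightarrow> bool. \<forall>x y. {x, y} \<in> E \<longrightarrow> ({x, y} \<in> monodromy \<longleftrightarrow> s x \<noteq> s y)"
    by (rule comb.coboundary_if_even)
  then obtain s :: "'v \<Rightarrow> bool" where "\<forall>x y. {x, y} \<in> E \<longrightarrow> ({x, y} \<in> monodromy \<longleftrightarrow> s x \<noteq> s y)"
    by (elim exE)
  then have "{x, y} \<in> E \<Longrightarrow> {x, y} \<in> monodromy \<longleftrightarrow> s x \<noteq> s y" for x y by simp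
  then obtain \<sigma> where "section_on (topspace X) \<sigma>" using global_section[of s] by auto
  then show False using assms by simp
qed

end

section \<open>The double cover of a Moebius band\<close>

lemma loc_const_two_pieces:
  assumes "openin X A" "openin X B" "S \<subseteq> A \<union> B"
    and "\<And>p. p \<in> S \<inter> A \<Longrightarrow> P p = a" "\<And>p. p \<in> S \<inter> B \<Longrightarrow> P p = b"
  shows "loc_const X S P"
proof (rule loc_constI)
  fix p assume "p \<in> S"
  then consider "p \<in> A" | "p \<in> B" using assms(3) by auto
  then show "\<exists>N b. openin X N \<and> p \<in> N \<and> (\<forall>q\<in>N \<inter> S. P q = b)"
  proof cases
    case 1
    then show ?thesis using assms by (intro exI[of _ A] exI[of _ a]) auto
  next
    case 2
    then show ?thesis using assms by (intro exI[of _ B] exI[of _ b]) auto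
  qed
qed

text \<open>The double cover whose sheets are exchanged when the core circle of the band is crossed.
  On two overlapping rectangles of the band a sheet is given by a side of the core; the second
  rectangle straddles the identified edges, where the sides are interchanged, so on the core
  itself its choice depends on the side of the seam.\<close>

locale moebius_in_surface =
  fixes X :: "'a topology" and h :: "real \<times> real \<Rightarrow> 'a"
  assumes surface: "surface X"
    and cont: "continuous_map (top_of_set ({0..1} \<times> {-1..1})) X h"
    and ident: "\<And>p q. p \<in> {0..1} \<times> {-1..1} \<Longrightarrow> q \<in> {0..1} \<times> {-1..1} \<Longrightarrow> h p = h q \<longleftrightarrow> moebius_identified p q"
begin

definition "R1 = {z :: complex. 0 < Re z \<and> Re z < 1 \<and> - 1 < Im z \<and> Im z < 1}"
definition "R2 = {z :: complex. - (1/2) < Re z \<and> Re z < 1/2 \<and> - 1 < Im z \<and> Im z < 1}"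
definition "G1 z = h (Re z, Im z)"
text \<open>Coordinates across the seam: a point with \<open>Re z < 0\<close> is found at the right
  edge of the square, turned upside down.\<close>

definition "G2 z = (if 0 \<le> Re z then h (Re z, Im z) else h (Re z + 1, - Im z))"
definition "J = h ` ({0..1} \<times> {0})"
definition "U i = (if i = (0::nat) then topspace X - J else if i = 1 then G1 ` R1 else G2 ` R2)"
definition "g i p \<longleftrightarrow> (if i = (0::nat) then False else if i = 1 then \<exists>z\<in>R1. p = G1 z \<and> 0 < Im z
   else \<exists>z\<in>R2. p = G2 z \<and> (0 < Im z \<or> Im z = 0 \<and> Re z < 0))"

lemma identD: "0 \<le> a \<Longrightarrow> a \<le> 1 \<Longrightarrow> 0 \<le> c \<Longrightarrow> c \<le> 1 \<Longrightarrow> -1 \<le> b \<Longrightarrow> b \<le> 1 \<Longrightarrow> -1 \<le> d \<Longrightarrow> d \<le> 1 \<Longrightarrow>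
   h (a, b) = h (c, d) \<longleftrightarrow> (a = c \<and> b = d) \<or> (a = 0 \<and> c = 1 \<and> d = - b) \<or> (a = 1 \<and> c = 0 \<and> d = - b)"
  by (subst ident) (auto simp: moebius_identified_def)

lemma inj_G1: "inj_on G1 R1"
  by (rule inj_onI) (auto simp: G1_def R1_def identD complex_eq_iff)

lemma inj_G2: "inj_on G2 R2"
  by (rule inj_onI) (auto simp: G2_def R2_def identD complex_eq_iff split: if_splits)

lemma open_R: "open R1" "open R2"
  unfolding R1_def R2_def by (intro open_Collect_conj open_Collect_less continuous_intros)+

lemma cont_G1: "continuous_map (top_of_set R1) X G1"
proof -
  have "continuous_map (top_of_set R1) (top_of_set ({0..1} \<times> {-1..1})) (\<lambda>z. (Re z, Im z))"
    by (auto simp: continuous_map_in_subtopology R1_def intro!: continuous_intros)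
  from continuous_map_compose[OF this cont] show ?thesis by (simp add: o_def G1_def[abs_def])
qed

lemma cont_G2: "continuous_map (top_of_set R2) X G2"
  unfolding G2_def[abs_def]
proof (rule continuous_map_cases_le)
  have "continuous_map (top_of_set (R2 \<inter> {z. 0 \<le> Re z})) (top_of_set ({0..1} \<times> {-1..1})) (\<lambda>z. (Re z, Im z))"
    by (auto simp: continuous_map_in_subtopology R2_def intro!: continuous_intros)
  from continuous_map_compose[OF this cont]
  show "continuous_map (subtopology (top_of_set R2) {z \<in> topspace (top_of_set R2). 0 \<le> Re z}) X (\<lambda>z. h (Re z, Im z))"
    by (simp add: subtopology_subtopology o_def Int_def conj_ac)
  have "continuous_map (top_of_set (R2 \<inter> {z. Re z \<le> 0})) (top_of_set ({0..1} \<times> {-1..1})) (\<lambda>z. (Re z + 1, - Im z))"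
    by (auto simp: continuous_map_in_subtopology R2_def intro!: continuous_intros)
  from continuous_map_compose[OF this cont]
  show "continuous_map (subtopology (top_of_set R2) {z \<in> topspace (top_of_set R2). Re z \<le> 0}) X (\<lambda>z. h (Re z + 1, - Im z))"
    by (simp add: subtopology_subtopology o_def Int_def conj_ac)
  fix z assume "z \<in> topspace (top_of_set R2)" "0 = Re z"
  then show "h (Re z, Im z) = h (Re z + 1, - Im z)" by (auto simp: identD R2_def)
qed (auto intro: continuous_intros)

text \<open>Open rectangles of the band are open in the whole surface by invariance of domain, so
  they can serve in a cover of \<open>X\<close>.\<close>

lemma open_G1: "open W \<Longrightarrow> W \<subseteq> R1 \<Longrightarrow> openin X (G1 ` W)"
  by (rule invariance_of_domain_surface[OF surface continuous_map_from_subtopology_mono[OF cont_G1]])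
    (auto intro: inj_on_subset[OF inj_G1])

lemma open_G2: "open W \<Longrightarrow> W \<subseteq> R2 \<Longrightarrow> openin X (G2 ` W)"
  by (rule invariance_of_domain_surface[OF surface continuous_map_from_subtopology_mono[OF cont_G2]])
    (auto intro: inj_on_subset[OF inj_G2])

lemma g1: "z \<in> R1 \<Longrightarrow> g 1 (G1 z) \<longleftrightarrow> 0 < Im z"
  using inj_G1 by (auto simp: g_def dest: inj_onD)

lemma g2: "z \<in> R2 \<Longrightarrow> g 2 (G2 z) \<longleftrightarrow> 0 < Im z \<or> Im z = 0 \<and> Re z < 0"
  using inj_G2 by (auto simp: g_def dest: inj_onD)

lemma open_pieces:
  "open (R1 \<inter> {z. 0 < Im z})" "open (R1 \<inter> {z. Im z < 0})"
  "open (R2 \<inter> {z. 0 < Im z})" "open (R2 \<inter> {z. Im z < 0})"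
  "open (R2 \<inter> {z. 0 < Re z})" "open (R2 \<inter> {z. Re z < 0})"
  by (intro open_Int open_R open_Collect_less continuous_intros)+

lemma J_G1: "z \<in> R1 \<Longrightarrow> Im z = 0 \<Longrightarrow> G1 z \<in> J"
  unfolding J_def G1_def R1_def by auto

lemma J_G2: "z \<in> R2 \<Longrightarrow> Im z = 0 \<Longrightarrow> G2 z \<in> J"
  unfolding J_def G2_def R2_def by auto

lemma compat_01: "loc_const X (U 0 \<inter> U 1) (\<lambda>p. g 0 p \<noteq> g 1 p)"
proof (rule loc_const_two_pieces)
  show "openin X (G1 ` (R1 \<inter> {z. 0 < Im z}))" "openin X (G1 ` (R1 \<inter> {z. Im z < 0}))"
    by (intro open_G1 open_pieces; auto)+
  show "U 0 \<inter> U 1 \<subseteq> G1 ` (R1 \<inter> {z. 0 < Im z}) \<union> G1 ` (R1 \<inter> {z. Im z < 0})"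
  proof
    fix p assume p: "p \<in> U 0 \<inter> U 1"
    then obtain z where z: "z \<in> R1" "p = G1 z" "p \<notin> J" by (auto simp: U_def)
    then have "Im z \<noteq> 0" using J_G1 by auto
    then show "p \<in> G1 ` (R1 \<inter> {z. 0 < Im z}) \<union> G1 ` (R1 \<inter> {z. Im z < 0})"
      using z by (cases "0 < Im z") auto
  qed
  fix p
  show "p \<in> U 0 \<inter> U 1 \<inter> G1 ` (R1 \<inter> {z. 0 < Im z}) \<Longrightarrow> (g 0 p \<noteq> g 1 p) = True"
    using g1 by (auto simp: g_def[of 0])
  show "p \<in> U 0 \<inter> U 1 \<inter> G1 ` (R1 \<inter> {z. Im z < 0}) \<Longrightarrow> (g 0 p \<noteq> g 1 p) = False"
    using g1 by (auto simp: g_def[of 0])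
qed

lemma compat_02: "loc_const X (U 0 \<inter> U 2) (\<lambda>p. g 0 p \<noteq> g 2 p)"
proof (rule loc_const_two_pieces)
  show "openin X (G2 ` (R2 \<inter> {z. 0 < Im z}))" "openin X (G2 ` (R2 \<inter> {z. Im z < 0}))"
    by (intro open_G2 open_pieces; auto)+
  show "U 0 \<inter> U 2 \<subseteq> G2 ` (R2 \<inter> {z. 0 < Im z}) \<union> G2 ` (R2 \<inter> {z. Im z < 0})"
  proof
    fix p assume p: "p \<in> U 0 \<inter> U 2"
    then obtain z where z: "z \<in> R2" "p = G2 z" "p \<notin> J" by (auto simp: U_def)
    then have "Im z \<noteq> 0" using J_G2 by auto
    then show "p \<in> G2 ` (R2 \<inter> {z. 0 < Im z}) \<union> G2 ` (R2 \<inter> {z. Im z < 0})"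
      using z by (cases "0 < Im z") auto
  qed
  fix p
  show "p \<in> U 0 \<inter> U 2 \<inter> G2 ` (R2 \<inter> {z. 0 < Im z}) \<Longrightarrow> (g 0 p \<noteq> g 2 p) = True"
    using g2 by (auto simp: g_def[of 0])
  show "p \<in> U 0 \<inter> U 2 \<inter> G2 ` (R2 \<inter> {z. Im z < 0}) \<Longrightarrow> (g 0 p \<noteq> g 2 p) = False"
    using g2 by (auto simp: g_def[of 0])
qed

text \<open>The seam lies outside \<open>U 1\<close> and splits the overlap into two open parts. On
  one the two coordinates coincide; on the other the sides are interchanged, and the clause on
  \<open>Im z = 0\<close> in \<open>g\<close> makes the sheets differ on the core as well.\<close>

lemma compat_12: "loc_const X (U 1 \<inter> U 2) (\<lambda>p. g 1 p \<noteq> g 2 p)"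
proof (rule loc_const_two_pieces)
  show "openin X (G2 ` (R2 \<inter> {z. 0 < Re z}))" "openin X (G2 ` (R2 \<inter> {z. Re z < 0}))"
    by (intro open_G2 open_pieces; auto)+
  show "U 1 \<inter> U 2 \<subseteq> G2 ` (R2 \<inter> {z. 0 < Re z}) \<union> G2 ` (R2 \<inter> {z. Re z < 0})"
  proof
    fix p assume p: "p \<in> U 1 \<inter> U 2"
    then obtain z w where z: "z \<in> R2" "p = G2 z" and w: "w \<in> R1" "p = G1 w" by (auto simp: U_def)
    have "Re z \<noteq> 0"
    proof
      assume "Re z = 0"
      then have "h (0, Im z) = h (Re w, Im w)" using z w by (simp add: G1_def G2_def)
      then show False using z(1) w(1) \<open>Re z = 0\<close> by (auto simp: identD R1_def R2_def)
    qed
    then show "p \<in> G2 ` (R2 \<inter> {z. 0 < Re z}) \<union> G2 ` (R2 \<inter> {z. Re z < 0})"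
      using z by (cases "0 < Re z") auto
  qed
  fix p
  assume "p \<in> U 1 \<inter> U 2 \<inter> G2 ` (R2 \<inter> {z. 0 < Re z})"
  then obtain z where z: "z \<in> R2" "0 < Re z" "p = G2 z" by auto
  then have "z \<in> R1" "p = G1 z" by (auto simp: R1_def R2_def G1_def G2_def)
  then show "(g 1 p \<noteq> g 2 p) = False" using g1[of z] g2[of z] z by auto
next
  fix p
  assume "p \<in> U 1 \<inter> U 2 \<inter> G2 ` (R2 \<inter> {z. Re z < 0})"
  then obtain z where z: "z \<in> R2" "Re z < 0" "p = G2 z" by auto
  define w where "w = Complex (Re z + 1) (- Im z)"
  have "w \<in> R1" "p = G1 w" using z by (auto simp: R1_def R2_def G1_def G2_def w_def)
  then show "(g 1 p \<noteq> g 2 p) = True" using g1[of w] g2[of z] z by (auto simp: w_def)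
qed

lemma J_closed: "closedin X J"
proof -
  have "compactin (top_of_set ({0..1} \<times> {-1..1::real})) ({0..1::real} \<times> {0})"
    by (auto simp: compactin_subtopology compact_Times)
  then have "compactin X J" unfolding J_def by (rule image_compactin[OF _ cont])
  then show ?thesis using surface compactin_imp_closedin unfolding surface_def by blast
qed

lemma double_cover_moebius: "double_cover X {0, 1, 2} U g"
proof
  show openU: "openin X (U i)" if "i \<in> {0, 1, 2}" for i
    using J_closed open_G1[OF open_R(1)] open_G2[OF open_R(2)] by (auto simp: U_def)
  have "J \<subseteq> G1 ` R1 \<union> G2 ` R2"
  proof
    fix p assume "p \<in> J"
    then obtain s where s: "0 \<le> s" "s \<le> 1" "p = h (s, 0)" unfolding J_def by auto
    show "p \<in> G1 ` R1 \<union> G2 ` R2"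
    proof (cases "0 < s \<and> s < 1")
      case True
      then have "Complex s 0 \<in> R1" "p = G1 (Complex s 0)" using s by (auto simp: R1_def G1_def)
      then show ?thesis by blast
    next
      case False
      then have "s = 0 \<or> s = 1" using s by auto
      then have "p = h (0, 0)" using s identD[of 0 1 0 0] by auto
      then have "0 \<in> R2" "p = G2 0" by (auto simp: R2_def G2_def)
      then show ?thesis by blast
    qed
  qed
  then show "topspace X \<subseteq> (\<Union>i\<in>{0, 1, 2}. U i)" by (auto simp: U_def)
  show "loc_const X (U i \<inter> U j) (\<lambda>p. g i p \<noteq> g j p)" if "i \<in> {0, 1, 2}" "j \<in> {0, 1, 2}" for i j
  proof (cases "i = j")
    case True
    then show ?thesis using openU[OF that(1)]
      by (intro loc_constI exI[of _ "U i"] exI[of _ False]) auto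
  next
    case False
    have swap: "loc_const X (U j \<inter> U i) (\<lambda>p. g j p \<noteq> g i p) \<Longrightarrow> loc_const X (U i \<inter> U j) (\<lambda>p. g i p \<noteq> g j p)"
      by (subst Int_commute) (erule loc_const_transfer, auto)
    show ?thesis using that False compat_01 compat_02 compat_12 swap by auto
  qed
qed

text \<open>Off the core the cover is trivial, and the two halves of the band are joined through the
  seam, so a section has equal labels at \<open>h (1/2, 1/2)\<close> and
  \<open>h (1/2, -(1/2))\<close>. Along the segment \<open>?L\<close>, which crosses the core, the
  labels must differ.\<close>

lemma no_section: "\<not> double_cover.section_on X {0, 1, 2} U g (topspace X) \<sigma>"
proof
  interpret double_cover X "{0, 1, 2}" U g by (rule double_cover_moebius)
  assume \<sigma>: "section_on (topspace X) \<sigma>"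
  have img: "connectedin X (h ` S)" if "connected S" "S \<subseteq> {0..1} \<times> {-1..1}" for S
    by (rule connectedin_continuous_map_image[OF cont]) (use that in \<open>simp add: connectedin_subtopology\<close>)
  let ?A = "h ` ({0..1} \<times> {0<..<1})" and ?B = "h ` ({0..1} \<times> {-1<..<0})"
  let ?L = "h ` ({1/2} \<times> {-1<..<1})"
  have AB: "connectedin X ?A" "connectedin X ?B" "connectedin X ?L"
    by (intro img connected_Times convex_connected; auto)+
  have "h (0, 1/2) = h (1, - (1/2))" by (simp add: identD)
  moreover have "h (0, 1/2) \<in> ?A" by (rule imageI) simp
  moreover have "h (1, - (1/2)) \<in> ?B" by (rule imageI) simp
  ultimately have "?A \<inter> ?B \<noteq> {}" by (metis IntI empty_iff)
  then have conn: "connectedin X (?A \<union> ?B)" using connectedin_Un AB by blast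
  have htop: "h p \<in> topspace X" if "p \<in> {0..1} \<times> {-1..1}" for p
    using cont that by (auto simp: continuous_map_def)
  have off: "h (s, t) \<notin> J" if "0 \<le> s" "s \<le> 1" "-1 \<le> t" "t \<le> 1" "t \<noteq> 0" for s t
    unfolding J_def using that by (auto simp: identD)
  have "?A \<union> ?B \<subseteq> topspace X \<inter> U 0"
    using htop off by (auto simp: U_def)
  moreover have "loc_const X (topspace X \<inter> U 0) (\<lambda>p. \<sigma> p \<noteq> g 0 p)"
    using \<sigma> unfolding section_on_def by blast
  ultimately have "loc_const X (?A \<union> ?B) (\<lambda>p. \<sigma> p \<noteq> g 0 p)" by (rule loc_const_subset[rotated])
  then have "(\<sigma> (h (1/2, 1/2)) \<noteq> g 0 (h (1/2, 1/2))) = (\<sigma> (h (1/2, -(1/2))) \<noteq> g 0 (h (1/2, -(1/2))))"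
    by (rule loc_const_connected[OF conn]) auto
  then have 1: "\<sigma> (h (1/2, 1/2)) = \<sigma> (h (1/2, -(1/2)))" by (auto simp: g_def)
  have "?L \<subseteq> topspace X \<inter> U 1"
  proof
    fix p assume "p \<in> ?L"
    then obtain t where t: "-1 < t" "t < 1" "p = h (1/2, t)" by auto
    then have "Complex (1/2) t \<in> R1" "p = G1 (Complex (1/2) t)" by (auto simp: R1_def G1_def)
    moreover have "p \<in> topspace X" unfolding t(3) by (rule htop) (use t in simp)
    ultimately show "p \<in> topspace X \<inter> U 1" by (simp add: U_def)
  qed
  moreover have "loc_const X (topspace X \<inter> U 1) (\<lambda>p. \<sigma> p \<noteq> g 1 p)"
    using \<sigma> unfolding section_on_def by blast
  ultimately have "loc_const X ?L (\<lambda>p. \<sigma> p \<noteq> g 1 p)" by (rule loc_const_subset[rotated])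
  then have "(\<sigma> (h (1/2, 1/2)) \<noteq> g 1 (h (1/2, 1/2))) = (\<sigma> (h (1/2, -(1/2))) \<noteq> g 1 (h (1/2, -(1/2))))"
    by (rule loc_const_connected[OF AB(3)]) auto
  moreover have "g 1 (h (1/2, 1/2))" "\<not> g 1 (h (1/2, -(1/2)))"
    using g1[of "Complex (1/2) (1/2)"] g1[of "Complex (1/2) (-(1/2))"] by (auto simp: R1_def G1_def)
  ultimately show False using 1 by auto
qed

end

lemma non_orientable_double_cover:
  assumes "surface X" "non_orientable X"
  shows "\<exists>I (U :: nat \<Rightarrow> 'a set) g. double_cover X I U g \<and> (\<forall>\<sigma>. \<not> double_cover.section_on X I U g (topspace X) \<sigma>)"
proof -
  obtain S h where h: "S \<subseteq> topspace X" "quotient_map (top_of_set ({0..1} \<times> {-1..1})) (subtopology X S) h"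
    "\<forall>p\<in>{0..1} \<times> {-1..1}. \<forall>q\<in>{0..1} \<times> {-1..1}. h p = h q \<longleftrightarrow> moebius_identified p q"
    using assms(2) unfolding non_orientable_def moebius_band_def by blast
  have "continuous_map (top_of_set ({0..1} \<times> {-1..1})) X h"
    using quotient_imp_continuous_map[OF h(2)] by (simp add: continuous_map_in_subtopology)
  then interpret moebius_in_surface X h
    using assms(1) h(3) by unfold_locales auto
  show ?thesis using double_cover_moebius no_section by blast
qed

section \<open>Parametrising a cycle by the circle\<close>

text \<open>Each path takes one unit of time, and \<open>x\<close> is the value of the empty
  concatenation. At a joint the earlier path decides, which is harmless when the ends match.\<close>

primrec concat_paths :: "(nat \<Rightarrow> real \<Rightarrow> 'a) \<Rightarrow> 'a \<Rightarrow> nat \<Rightarrow> real \<Rightarrow> 'a" where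
  "concat_paths a x 0 = (\<lambda>t. x)"
| "concat_paths a x (Suc n) = (\<lambda>t. if t \<le> real n then concat_paths a x n t else a n (t - real n))"

lemma concat_paths_eq:
  assumes "\<And>i. i < n \<Longrightarrow> a i 0 = v i" "\<And>i. i < n \<Longrightarrow> a i 1 = v (Suc i)" "i < n" "0 \<le> t" "t \<le> 1"
  shows "concat_paths a (v 0) n (real i + t) = a i t"
  using assms
proof (induction n arbitrary: i t)
  case (Suc n)
  note IH = Suc.IH[OF Suc.prems(1) Suc.prems(2), simplified]
  have last: "n = 0 \<or> concat_paths a (v 0) n (real n) = v n"
  proof (cases n)
    case (Suc m)
    then have "concat_paths a (v 0) n (real m + 1) = a m 1" by (intro IH) auto
    then show ?thesis using Suc.prems(2)[of m] Suc by (simp add: add.commute)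
  qed simp
  show ?case
  proof (cases "i = n")
    case True
    show ?thesis
    proof (cases "t = 0")
      case t0: True
      show ?thesis using last Suc.prems(1)[of n] t0 True by auto
    next
      case False
      then show ?thesis using Suc.prems(4) True by simp
    qed
  next
    case False
    then have "i < n" "real i + t \<le> real n" using Suc.prems by linarith+
    then show ?thesis using IH[of i t] Suc.prems by simp
  qed
qed simp

lemma continuous_concat_paths:
  assumes "\<And>i. i < n \<Longrightarrow> continuous_map (top_of_set {0..1}) X (a i)"
    and "\<And>i. i < n \<Longrightarrow> a i 0 = v i" "\<And>i. i < n \<Longrightarrow> a i 1 = v (Suc i)" "v 0 \<in> topspace X"
  shows "continuous_map (top_of_set {0..real n}) X (concat_paths a (v 0) n)"
  using assms(1-3)
proof (induction n)
  case 0
  then show ?case using assms(4) by simp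
next
  case (Suc n)
  have IH: "continuous_map (top_of_set {0..real n}) X (concat_paths a (v 0) n)"
    using Suc by simp
  have end_eq: "concat_paths a (v 0) n (real n) = v n"
  proof (cases n)
    case (Suc m)
    then have "concat_paths a (v 0) n (real m + 1) = a m 1"
      using Suc.prems by (intro concat_paths_eq) auto
    then show ?thesis using Suc.prems(3)[of m] Suc by (simp add: add.commute)
  qed simp
  show ?case
    unfolding concat_paths.simps
  proof (rule continuous_map_cases_le)
    have "{0..real (Suc n)} \<inter> {x. x \<le> real n} = {0..real n}" by auto
    then show "continuous_map (subtopology (top_of_set {0..real (Suc n)})
        {x \<in> topspace (top_of_set {0..real (Suc n)}). x \<le> real n}) X (concat_paths a (v 0) n)"
      using IH by (simp add: subtopology_subtopology Int_def conj_ac)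
    have "continuous_map (top_of_set {real n..real (Suc n)}) (top_of_set {0..1}) (\<lambda>t. t - real n)"
      by (auto simp: continuous_map_in_subtopology intro!: continuous_intros)
    from continuous_map_compose[OF this Suc.prems(1)[of n]]
    have "continuous_map (top_of_set {real n..real (Suc n)}) X (\<lambda>t. a n (t - real n))"
      by (simp add: o_def)
    moreover have "{0..real (Suc n)} \<inter> {x \<in> {0..real (Suc n)}. real n \<le> x} = {real n..real (Suc n)}" by auto
    ultimately show "continuous_map (subtopology (top_of_set {0..real (Suc n)})
        {x \<in> topspace (top_of_set {0..real (Suc n)}). real n \<le> x}) X (\<lambda>t. a n (t - real n))"
      by (simp add: subtopology_subtopology)
    fix x assume "x \<in> topspace (top_of_set {0..real (Suc n)})" "x = real n"
    then show "concat_paths a (v 0) n x = a n (x - real n)"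
      using end_eq Suc.prems(2)[of n] by simp
  qed auto
qed

text \<open>The exponential map presents the circle as a quotient of the interval that identifies
  only its ends. So \<open>F\<close> factors through it injectively, and an injective continuous map
  from a compact to a Hausdorff space is an embedding.\<close>

lemma circle_embedding:
  assumes F: "continuous_map (top_of_set {0..real k}) X F" and k: "0 < k"
    and ends: "F (real k) = F 0" and inj: "inj_on F {0..<real k}" and X: "Hausdorff_space X"
  shows "\<exists>f. embedding_map (top_of_set (sphere (0::complex) 1)) X f \<and> f ` sphere 0 1 = F ` {0..real k}"
proof -
  define q where "q x = exp (\<i> * of_real (2 * pi * x / real k))" for x
  have q1: "q (real k) = q 0" using k exp_two_pi_i' by (simp add: q_def mult_ac)
  have qS: "\<exists>x\<in>{0..<real k}. z = q x" if z: "z \<in> sphere 0 1" for z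
  proof -
    obtain t where t: "0 \<le> t" "t < 2 * pi" "z = Complex (cos t) (sin t)"
      using complex_unimodular_polar[of z] z by auto
    have "z = exp (\<i> * of_real t)" unfolding t(3) by (simp add: cis_conv_exp[symmetric] complex_eq_iff)
    moreover have "2 * pi * (real k * t / (2 * pi)) / real k = t" using k by simp
    ultimately have "z = q (real k * t / (2 * pi))" unfolding q_def by simp
    moreover have "real k * t / (2 * pi) < real k" using t k by (simp add: field_simps)
    ultimately show ?thesis using t(1) k by (intro bexI[of _ "real k * t / (2 * pi)"]) auto
  qed
  have inj_q: "x = y" if "x \<in> {0..<real k}" "y \<in> {0..<real k}" "q x = q y" for x y
  proof -
    have "\<bar>x - y\<bar> < real k" using that(1,2) by auto
    then have "\<bar>x - y\<bar> / real k < 1" using k by simp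
    then have lt: "2 * pi * (\<bar>x - y\<bar> / real k) < 2 * pi * 1" by (intro mult_strict_left_mono) simp_all
    define a b where "a = 2 * pi * x / real k" and "b = 2 * pi * y / real k"
    have "a - b = 2 * pi * ((x - y) / real k)"
      unfolding a_def b_def by (simp add: algebra_simps diff_divide_distrib)
    then have "\<bar>a - b\<bar> = \<bar>2 * pi * ((x - y) / real k)\<bar>" by (rule arg_cong)
    also have "\<dots> = 2 * pi * (\<bar>x - y\<bar> / real k)" by (simp add: abs_mult)
    also note lt
    finally have "\<bar>Im (\<i> * complex_of_real a) - Im (\<i> * complex_of_real b)\<bar> < 2 * pi" by simp
    moreover have "exp (\<i> * complex_of_real a) = exp (\<i> * complex_of_real b)"
      using that(3) unfolding q_def a_def b_def .
    ultimately have "\<i> * complex_of_real a = \<i> * complex_of_real b" by (rule exp_complex_eqI)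
    then have "a = b" by simp
    then have "2 * pi * x / real k = 2 * pi * y / real k" by (simp only: a_def b_def)
    then show ?thesis using k by simp
  qed
  \<comment> \<open>Replacing the right end by 0 moves every parameter into the half-open interval
    on which \<open>q\<close> is injective.\<close>
  define red where "red x = (if x = real k then 0 else x)" for x
  have red: "red x \<in> {0..<real k}" "q (red x) = q x" "F (red x) = F x" if "x \<in> {0..real k}" for x
    using that k q1 ends by (auto simp: red_def)
  have eq: "F x = F y" if "x \<in> {0..real k}" "y \<in> {0..real k}" "q x = q y" for x y
  proof -
    have "red x = red y" by (rule inj_q) (use red that in auto)
    then show ?thesis using red(3) that by metis
  qed
  have "continuous_on {0..real k} q" unfolding q_def by (intro continuous_intros) (use k in auto)
  moreover have qim: "q ` {0..real k} = sphere 0 1"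
  proof
    show "q ` {0..real k} \<subseteq> sphere 0 1" by (auto simp: q_def)
    show "sphere 0 1 \<subseteq> q ` {0..real k}" using qS by force
  qed
  ultimately have quot: "quotient_map (top_of_set {0..real k}) (top_of_set (sphere 0 1)) q"
    by (intro continuous_imp_quotient_map)
      (auto simp: continuous_map_in_subtopology compact_space_subtopology Hausdorff_space_subtopology)
  have eqt: "F x = F y" if "x \<in> topspace (top_of_set {0..real k})" "y \<in> topspace (top_of_set {0..real k})" "q x = q y" for x y
    by (rule eq[OF _ _ that(3)]) (use that(1,2) in simp_all)
  have "\<exists>f. continuous_map (top_of_set (sphere 0 1)) X f \<and>
      f ` topspace (top_of_set (sphere 0 1)) = F ` topspace (top_of_set {0..real k}) \<and>
      (\<forall>x\<in>topspace (top_of_set {0..real k}). f (q x) = F x)"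
    by (rule quotient_map_lift_exists[OF quot F eqt]) (assumption+, blast)
  then obtain f where f: "continuous_map (top_of_set (sphere 0 1)) X f"
    "f ` topspace (top_of_set (sphere 0 1)) = F ` topspace (top_of_set {0..real k})"
    "\<forall>x\<in>topspace (top_of_set {0..real k}). f (q x) = F x"
    by blast
  have "inj_on f (sphere 0 1)"
  proof (rule inj_onI)
    fix z w assume zw: "z \<in> sphere 0 1" "w \<in> sphere 0 1" "f z = f w"
    obtain x y where xy: "x \<in> {0..<real k}" "z = q x" "y \<in> {0..<real k}" "w = q y"
      using qS zw(1,2) by metis
    then have "f (q x) = F x" "f (q y) = F y" using f(3) by auto
    then have "F x = F y" using zw(3) xy(2,4) by simp
    then show "z = w" using inj_onD[OF inj] xy by blast
  qed
  then have "embedding_map (top_of_set (sphere 0 1)) X f"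
    using f(1) X by (intro continuous_imp_embedding_map) (auto simp: compact_space_subtopology)
  then show ?thesis using f(2) by auto
qed

context triangulated_surface
begin

text \<open>Edges are unordered, so \<open>\<psi>\<close> may run from \<open>y\<close> to
  \<open>x\<close>; it is then reversed.\<close>

lemma oriented_edge:
  assumes "{x, y} \<in> E"
  shows "\<exists>a :: real \<Rightarrow> 'a. continuous_map (top_of_set {0..1}) X a \<and> inj_on a {0..1} \<and> a 0 = \<phi> x \<and> a 1 = \<phi> y \<and>
    a ` {0..1} = arc {x, y} \<and> a ` {0<..<1} = inner_arc {x, y}"
proof -
  let ?p = "\<psi> {x, y}"
  have ends: "?p 0 = \<phi> x \<and> ?p 1 = \<phi> y \<or> ?p 0 = \<phi> y \<and> ?p 1 = \<phi> x"
    using \<psi>_ends[OF assms] by (auto simp: doubleton_eq_iff)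
  then show ?thesis
  proof
    assume "?p 0 = \<phi> x \<and> ?p 1 = \<phi> y"
    then show ?thesis using \<psi>_cont[OF assms] \<psi>_inj[OF assms]
      by (intro exI[of _ ?p]) (simp add: arc_def inner_arc_def)
  next
    assume e: "?p 0 = \<phi> y \<and> ?p 1 = \<phi> x"
    have "continuous_map (top_of_set {0..1::real}) (top_of_set {0..1}) (\<lambda>t. 1 - t)"
      by (auto simp: continuous_map_in_subtopology intro!: continuous_intros)
    from continuous_map_compose[OF this \<psi>_cont[OF assms]]
    have c: "continuous_map (top_of_set {0..1}) X (\<lambda>t. ?p (1 - t))" by (simp add: o_def)
    have i: "inj_on (\<lambda>t. ?p (1 - t)) {0..1}"
      using inj_onD[OF \<psi>_inj[OF assms]] by (intro inj_onI) fastforce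
    have "(\<lambda>t. 1 - t) ` {0..1::real} = {0..1}" "(\<lambda>t. 1 - t) ` {0<..<1::real} = {0<..<1}"
      by (auto simp: image_iff intro!: bexI[of _ "1 - _"])
    then have "(\<lambda>t. ?p (1 - t)) ` {0..1} = arc {x, y}" "(\<lambda>t. ?p (1 - t)) ` {0<..<1} = inner_arc {x, y}"
      unfolding arc_def inner_arc_def by (metis image_image)+
    then show ?thesis using c i e by (intro exI[of _ "\<lambda>t. ?p (1 - t)"]) simp
  qed
qed

text \<open>Open arcs of different edges are disjoint and contain no vertex, so the concatenated
  arcs return to a point at the closing end only.\<close>

lemma cycle_embedding:
  assumes k: "3 \<le> k" and inj: "inj_on p {..<k}" and closed: "p k = p 0"
    and e: "\<And>j. j < k \<Longrightarrow> {p j, p (Suc j)} \<in> E"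
  shows "\<exists>f. embedding_map (top_of_set (sphere (0::complex) 1)) X f \<and>
    f ` sphere 0 1 = (\<Union>j<k. arc {p j, p (Suc j)})"
proof -
  have "\<exists>a :: nat \<Rightarrow> real \<Rightarrow> 'a. \<forall>j\<in>{..<k}. continuous_map (top_of_set {0..1}) X (a j) \<and> inj_on (a j) {0..1} \<and>
    a j 0 = \<phi> (p j) \<and> a j 1 = \<phi> (p (Suc j)) \<and>
    a j ` {0..1} = arc {p j, p (Suc j)} \<and> a j ` {0<..<1} = inner_arc {p j, p (Suc j)}"
    by (rule bchoice, rule ballI, rule oriented_edge, rule e) simp
  then obtain a :: "nat \<Rightarrow> real \<Rightarrow> 'a"
    where A: "\<forall>j\<in>{..<k}. continuous_map (top_of_set {0..1}) X (a j) \<and> inj_on (a j) {0..1} \<and>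
      a j 0 = \<phi> (p j) \<and> a j 1 = \<phi> (p (Suc j)) \<and>
      a j ` {0..1} = arc {p j, p (Suc j)} \<and> a j ` {0<..<1} = inner_arc {p j, p (Suc j)}"
    by (elim exE)
  have a: "\<And>j. j < k \<Longrightarrow> continuous_map (top_of_set {0..1}) X (a j)"
    "\<And>j. j < k \<Longrightarrow> inj_on (a j) {0..1}"
    "\<And>j. j < k \<Longrightarrow> a j 0 = \<phi> (p j)" "\<And>j. j < k \<Longrightarrow> a j 1 = \<phi> (p (Suc j))"
    "\<And>j. j < k \<Longrightarrow> a j ` {0..1} = arc {p j, p (Suc j)}"
    "\<And>j. j < k \<Longrightarrow> a j ` {0<..<1} = inner_arc {p j, p (Suc j)}"
    using A by simp_all
  define F where "F = concat_paths a (\<phi> (p 0)) k"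
  have F: "F (real i + t) = a i t" if "i < k" "0 \<le> t" "t \<le> 1" for i t
    unfolding F_def by (rule concat_paths_eq[where v="\<lambda>j. \<phi> (p j)"]) (use a that in auto)
  have pV: "p j \<in> V" if "j < k" for j using edge[OF e[OF that]] by auto
  have cont: "continuous_map (top_of_set {0..real k}) X F"
    unfolding F_def
    by (rule continuous_concat_paths[where v="\<lambda>j. \<phi> (p j)"]) (use a \<phi>_in pV[of 0] k in auto)
  have pos: "\<exists>i<k. \<exists>t. 0 \<le> t \<and> t < 1 \<and> x = real i + t" if "x \<in> {0..<real k}" for x
    by (rule exI[of _ "nat \<lfloor>x\<rfloor>"]) (use that in \<open>auto intro!: exI[of _ "frac x"] simp: frac_lt_1 frac_def\<close>; linarith)
  have endF: "F (real k) = F 0"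
    using F[of "k - 1" 1] F[of 0 0] a(4)[of "k - 1"] a(3)[of 0] k closed by (simp add: of_nat_diff)
  have vin: "a i 0 \<in> \<phi> ` V" "a i 0 = \<phi> (p i)" if "i < k" for i using a(3) pV that by auto
  have inn: "a i t \<in> inner_arc {p i, p (Suc i)}" "a i t \<notin> \<phi> ` V" if "i < k" "0 < t" "t < 1" for i t
  proof -
    show *: "a i t \<in> inner_arc {p i, p (Suc i)}" unfolding a(6)[OF that(1), symmetric] using that by auto
    show "a i t \<notin> \<phi> ` V" using * inner_V[OF e[OF that(1)]] by auto
  qed
  \<comment> \<open>Two different steps along the same edge would be cyclic successors of each
    other, impossible for \<open>k\<close> at least 3. The index \<open>nx\<close> wraps around
    because \<open>p\<close> is injective only below \<open>k\<close>.\<close>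
  have edges_distinct: "i = j" if ij: "i < k" "j < k" "{p i, p (Suc i)} = {p j, p (Suc j)}" for i j
  proof (rule ccontr)
    assume ne: "i \<noteq> j"
    define nx where "nx l = (if Suc l = k then 0 else Suc l)" for l
    have nx: "p (Suc l) = p (nx l)" "l < k \<Longrightarrow> nx l < k" for l using closed k by (auto simp: nx_def)
    have inj': "x = y" if "x < k" "y < k" "p x = p y" for x y
      by (rule inj_onD[OF inj that(3)]) (use that in auto)
    have "p i \<noteq> p j" using inj' ij ne by blast
    then have "p i = p (nx j) \<and> p (nx i) = p j" using ij(3) unfolding nx(1) doubleton_eq_iff by blast
    then have "i = nx j" "nx i = j" using inj' nx(2) ij(1,2) by blast+
    then show False using k by (auto simp: nx_def split: if_splits)
  qed
  have injF: "inj_on F {0..<real k}"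
  proof (rule inj_onI)
    fix x y assume xy: "x \<in> {0..<real k}" "y \<in> {0..<real k}" "F x = F y"
    obtain i t j s where i: "i < k" "0 \<le> t" "t < 1" "x = real i + t" and j: "j < k" "0 \<le> s" "s < 1" "y = real j + s"
      using pos[OF xy(1)] pos[OF xy(2)] by blast
    have eq: "a i t = a j s" using xy(3) F[of i t] F[of j s] i j by simp
    show "x = y"
    proof (cases "t = 0 \<or> s = 0")
      case True
      then have "t = 0 \<and> s = 0"
        using eq vin(1) inn(2) i j by (metis order_le_less)
      then have "\<phi> (p i) = \<phi> (p j)" using eq vin(2) i j by metis
      then have "p i = p j" using inj_\<phi> pV i j by (meson inj_onD)
      then have "i = j" using inj i j by (auto dest: inj_onD)
      then show ?thesis using \<open>t = 0 \<and> s = 0\<close> i j by simp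
    next
      case False
      then have "a i t \<in> inner_arc {p i, p (Suc i)} \<inter> inner_arc {p j, p (Suc j)}"
        using inn(1)[of i t] inn(1)[of j s] eq i j by auto
      then have "{p i, p (Suc i)} = {p j, p (Suc j)}"
        using inner_disjoint[OF e[OF i(1)] e[OF j(1)]] by blast
      then have "i = j" using edges_distinct i j by blast
      then have "t = s" using inj_onD[OF a(2)[OF i(1)], of t s] eq i j by simp
      then show ?thesis using \<open>i = j\<close> i j by simp
    qed
  qed
  have "F ` {0..real k} = (\<Union>j<k. arc {p j, p (Suc j)})"
  proof
    show "F ` {0..real k} \<subseteq> (\<Union>j<k. arc {p j, p (Suc j)})"
    proof safe
      fix x assume x: "x \<in> {0..real k}"
      obtain x' where x': "x' \<in> {0..<real k}" "F x' = F x"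
        using x endF k by (cases "x = real k") (auto intro: that[of 0] that[of x])
      obtain i t where i: "i < k" "0 \<le> t" "t < 1" "x' = real i + t" using pos[OF x'(1)] by blast
      then have "F x = a i t" using F x' by simp
      moreover have "a i t \<in> a i ` {0..1}" using i by auto
      ultimately show "F x \<in> (\<Union>j<k. arc {p j, p (Suc j)})" using a(5) i by auto
    qed
    show "(\<Union>j<k. arc {p j, p (Suc j)}) \<subseteq> F ` {0..real k}"
    proof safe
      fix j y assume j: "j < k" "y \<in> arc {p j, p (Suc j)}"
      then obtain t where t: "t \<in> {0..1}" "y = a j t" using a(5)[OF j(1)] by blast
      then have "y = F (real j + t)" using F[OF j(1)] by simp
      moreover have "real j + t \<in> {0..real k}" using t j by auto
      ultimately show "y \<in> F ` {0..real k}" by blast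
    qed
  qed
  then show ?thesis
    using circle_embedding[OF cont _ endF injF Hausdorff] k by auto
qed

theorem short_non_contractible_cycle:
  assumes "comb.cocycle w" "comb.walk w x n True x"
  shows "\<exists>vs. graph_cycle V E vs \<and> non_contractible_cycle X \<psi> vs \<and> (length vs)\<^sup>2 \<le> 4 * card V"
proof -
  obtain u k p s where u: "comb.cocycle u" and k: "3 \<le> k" and inj: "inj_on p {..<k}" and closed: "p k = p 0"
    and p: "\<forall>j<k. {p j, p (Suc j)} \<in> E \<and> s (Suc j) = (s j \<noteq> ({p j, p (Suc j)} \<in> u))"
    and s: "\<not> s 0" "s k" and bound: "k\<^sup>2 \<le> 4 * card V"
    using comb.short_odd_cycle[OF assms] by blast
  have e: "{p j, p (Suc j)} \<in> E" if "j < k" for j using p that by simp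
  define vs where "vs = map p [0..<k]"
  have len: "length vs = k" by (simp add: vs_def)
  have nth: "vs ! (Suc i mod length vs) = p (Suc i)" if "i < k" for i
    using that closed k by (cases "Suc i = k") (auto simp: vs_def)
  have ce: "cycle_edges vs = (\<lambda>j. {p j, p (Suc j)}) ` {..<k}"
  proof -
    have "cycle_edges vs = (\<lambda>i. {vs ! i, vs ! (Suc i mod length vs)}) ` {..<k}"
      by (simp only: cycle_edges_def setcompr_eq_image lessThan_def len)
    also have "\<dots> = (\<lambda>j. {p j, p (Suc j)}) ` {..<k}"
      by (rule image_cong) (use nth in \<open>auto simp: vs_def\<close>)
    finally show ?thesis .
  qed
  have "graph_cycle V E vs"
    unfolding graph_cycle_def ce using k inj e edge[OF e]
    by (auto simp: vs_def distinct_map atLeast0LessThan)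
  moreover obtain f where f: "embedding_map (top_of_set (sphere (0::complex) 1)) X f"
    "f ` sphere 0 1 = (\<Union>j<k. arc {p j, p (Suc j)})"
    using cycle_embedding[OF k inj closed e] by blast
  have "\<not> contractible_curve X f"
    using contractible_cycle_even[OF u f _ closed, of s] p s by auto
  then have "non_contractible_cycle X \<psi> vs"
    unfolding non_contractible_cycle_def drawn_E ce using f by (intro exI[of _ f]) auto
  ultimately show ?thesis using bound by (intro exI[of _ vs]) (simp add: vs_def)
qed

end

theorem theorem5:
  fixes X :: "'a topology"
    and V :: "'v set" and E :: "'v set set"
    and \<phi> :: "'v \<Rightarrow> 'a" and \<psi> :: "'v set \<Rightarrow> real \<Rightarrow> 'a"
    and n :: nat
  assumes "surface X"
    and "non_orientable X"
    and "surface_triangulation X V E \<phi> \<psi>"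
    and "card V = n"
  shows "\<exists>vs. graph_cycle V E vs \<and> non_contractible_cycle X \<psi> vs \<and>
           real (length vs) \<le> 2 * sqrt (real n)"
proof -
  interpret triangulated_surface X V E \<phi> \<psi>
    using assms(1,3) by unfold_locales
  obtain I and U :: "nat \<Rightarrow> 'a set" and g where dc: "double_cover X I U g"
    "\<forall>\<sigma>. \<not> double_cover.section_on X I U g (topspace X) \<sigma>"
    using non_orientable_double_cover[OF assms(1,2)] by blast
  interpret covered_triangulation X V E \<phi> \<psi> I U g
    using dc(1) triangulated_surface_axioms by (simp add: covered_triangulation_def)
  obtain u m x where "comb.cocycle u" "comb.walk u x m True x"
    using odd_walk dc(2) by blast
  from short_non_contractible_cycle[OF this]
  obtain vs where vs: "graph_cycle V E vs" "non_contractible_cycle X \<psi> vs" "(length vs)\<^sup>2 \<le> 4 * card V"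
    by blast
  have "(real (length vs))\<^sup>2 \<le> (2 * sqrt (real n))\<^sup>2"
    using vs(3) assms(4) by (simp add: power_mult_distrib flip: of_nat_power of_nat_mult)
  then have "real (length vs) \<le> 2 * sqrt (real n)" by (rule power2_le_imp_le) simp
  then show ?thesis using vs by blast
qed

end
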